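(* Let $\mathbb{V}: V_1\xrightarrow{\mathrm d}V_0$ be a 2-term complex of finite-dimensional real vector spaces, let $(H_1,H_0,t,\Phi)$ be a crossed module of Lie groups, and let $(\Psi_1,\Psi_0)$ be a strict morphism of crossed modules of Lie groups from $(H_1,H_0,t,\Phi)$ to $\mathrm{Aut}(\mathbb{V})$. Then there is a strict Lie 2-group with manifold of objects $H_0\times V_0$ and manifold of arrows $H_0\times H_1\times V_0\times V_1$, in which (for $x,y\in H_0$, $a,b\in H_1$, $\xi,\eta\in V_0$, $m,n\in V_1$): (1) the source of $(x,a,\xi,m)$ is $(x,\xi)$ and the target of $(x,a,\xi,m)$ is $(t(a)x,\ \xi+\mathrm d m)$; (2) the vertical multiplication is $$(y,b,\eta,n)\cdot_{\mathrm v}(x,a,\xi,m)=(x,ba,\xi,m+n),\qquad\text{defined when } y=t(a)x,\ \eta=\xi+\mathrm d m;$$ (3) the horizontal multiplication of arrows is $$(x,a,\xi,m)\cdot_{\mathrm h}(y,b,\eta,n)=\Big(xy,\ a\,\Phi_x b,\ \xi+\Psi_0(x)(\eta),\ m+\Psi_0(t(a)x)(n)+\Psi_1(a)\circ\Psi_0(x)(\eta)\Big);$$ (4) the horizontal multiplication of objects is $(x,\xi)\cdot_{\mathrm h}(y,\eta)=(xy,\ \xi+\Psi_0(x)(\eta))$. The identities (for $\cdot_{\mathrm h}$) of arrows and objects are $(1_{H_0},1_{H_1},0,0)$ and $(1_{H_0},0)$ respectively, and the inverse of $(x,a,\xi,m)$ with respect to $\cdot_{\mathrm h}$ is $$\big(x^{-1},\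 \Phi_{x^{-1}}a^{-1},\ -\Psi_0(x^{-1})(\xi),\ -\Psi_0((t(a)x)^{-1})(m)+\Psi_0((t(a)x)^{-1})\circ\Psi_1(a)(\xi)\big).$$
   Context: A crossed module of Lie groups $(H_1,H_0,t,\Phi)$ consists of Lie groups $H_1,H_0$, a Lie group morphism $t:H_1\to H_0$, and a smooth action $\Phi:H_0\times H_1\to H_1$ of $H_0$ on $H_1$ by group automorphisms such that $t(\Phi_g(h))=g\,t(h)\,g^{-1}$ and $\Phi_{t(h)}(h')=hh'h^{-1}$ for all $g\in H_0$, $h,h'\in H_1$. A strict morphism from $(H_1,H_0,t,\Phi)$ to $(G_1,G_0,t,\Phi)$ is a pair $(F_1,F_0)$ of Lie group morphisms $F_i:H_i\to G_i$ with $F_0\circ t=t\circ F_1$ and $F_1(\Phi_x a)=\Phi_{F_0(x)}F_1(a)$. The crossed module of Lie groups $\mathrm{Aut}(\mathbb V)=(K_1,K_0,\int\delta,\Phi)$ is: $K_0=\{(B_0,B_1)\in GL(V_0)\times GL(V_1): B_0\circ\mathrm d=\mathrm d\circ B_1\}$; $K_1=\{M\in\mathrm{Hom}(V_0,V_1): I+\mathrm d\circ M\in GL(V_0)\text{ and } I+M\circ\mathrm d\in GL(V_1)\}$ with multiplication $M_1\cdot M_2=M_1+M_2+M_1\circ\mathrm d\circ M_2$ and identity $0$; $(\int\delta)(M)=(I+\mathrm d\circ M,\ I+M\circ\mathrm d)$; and $\Phi_{(B_0,B_1)}M=B_1\circ M\circ B_0^{-1}$. For $x\in H_0$, $\Psi_0(x)=(B_0,B_1)$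 acts on $V_0$ via $B_0$ and on $V_1$ via $B_1$; both actions are written $\Psi_0(x)(\cdot)$. For $a\in H_1$, $\Psi_1(a)\in \mathrm{Hom}(V_0,V_1)$. A strict Lie 2-group is a Lie groupoid whose manifold of arrows $C_1$ and manifold of objects $C_0$ are Lie groups (group multiplications denoted $\cdot_{\mathrm h}$, "horizontal multiplication") such that the source, target, identity-assigning map $C_0\to C_1$ and groupoid composition $C_1\times_{C_0}C_1\to C_1$ (denoted $\cdot_{\mathrm v}$, "vertical multiplication") are all Lie group morphisms. *)

theory Defs
  imports "HOL-Analysis.Analysis" "HOL-Algebra.Group"
begin

definition finite_dimensional :: "'e::real_vector set \<Rightarrow> bool" where
  "finite_dimensional S \<longleftrightarrow> (\<exists>B. finite B \<and> S \<subseteq> span B)"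

text \<open>
  Class \<open>C\<^sup>k\<close> for a map \<open>f\<close> on a relatively open subset \<open>U\<close> of a subspace \<open>E\<close> of a
  finite-dimensional normed space. The derivative \<open>f' x\<close> within \<open>U\<close> is determined only on \<open>E\<close>,
  so only directions \<open>v \<in> E\<close> occur; as \<open>E\<close> is finite-dimensional, asking that all
  \<open>x \<mapsto> f' x v\<close> are of class \<open>C\<^sup>k\<close> is the same as asking it for \<open>x \<mapsto> f' x\<close> restricted to \<open>E\<close>.
  The class \<open>euclidean_space\<close> is avoided because it excludes dimension zero.
\<close>

primrec Ck_on :: "nat \<Rightarrow> 'e::real_normed_vector set \<Rightarrow> 'e set \<Rightarrow> ('e \<Rightarrow> 'f::real_normed_vector) \<Rightarrow> bool"
where
  "Ck_on 0 E U f \<longleftrightarrow> continuous_on U f"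
| "Ck_on (Suc k) E U f \<longleftrightarrow>
     (\<exists>f'. (\<forall>x\<in>U. (f has_derivative f' x) (at x within U)) \<and>
           (\<forall>v\<in>E. Ck_on k E U (\<lambda>x. f' x v)))"

definition smooth_on :: "'e::real_normed_vector set \<Rightarrow> 'e set \<Rightarrow> ('e \<Rightarrow> 'f::real_normed_vector) \<Rightarrow> bool"
where
  "smooth_on E U f \<longleftrightarrow> (\<forall>k. Ck_on k E U f)"

record ('a, 'e) manifold =
  mtop  :: "'a topology"
  model :: "'e set"
  atlas :: "('a set \<times> ('a \<Rightarrow> 'e)) set"

definition coord_rep :: "('a \<Rightarrow> 'b) \<Rightarrow> 'a set \<times> ('a \<Rightarrow> 'e) \<Rightarrow> 'b set \<times> ('b \<Rightarrow> 'f) \<Rightarrow> 'e \<Rightarrow> 'f" where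
  "coord_rep f c d = snd d \<circ> f \<circ> inv_into (fst c) (snd c)"

definition coord_dom :: "('a \<Rightarrow> 'b) \<Rightarrow> 'a set \<times> ('a \<Rightarrow> 'e) \<Rightarrow> 'b set \<times> ('b \<Rightarrow> 'f) \<Rightarrow> 'e set" where
  "coord_dom f c d = snd c ` {p \<in> fst c. f p \<in> fst d}"

text \<open>The atlas is not required to be maximal; it stands for the smooth structure it generates.\<close>

definition smooth_manifold :: "('a, 'e::real_normed_vector) manifold \<Rightarrow> bool" where
  "smooth_manifold M \<longleftrightarrow>
     finite_dimensional (UNIV :: 'e set) \<and> subspace (model M) \<and>
     Hausdorff_space (mtop M) \<and> second_countable (mtop M) \<and>
     (\<Union>c\<in>atlas M. fst c) = topspace (mtop M) \<and>
     (\<forall>(U, \<phi>)\<in>atlas M.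
        openin (mtop M) U \<and>
        openin (top_of_set (model M)) (\<phi> ` U) \<and>
        homeomorphic_map (subtopology (mtop M) U) (top_of_set (\<phi> ` U)) \<phi>) \<and>
     (\<forall>c\<in>atlas M. \<forall>d\<in>atlas M. smooth_on (model M) (coord_dom id c d) (coord_rep id c d))"

definition smooth_map ::
  "('a, 'e::real_normed_vector) manifold \<Rightarrow> ('b, 'f::real_normed_vector) manifold \<Rightarrow> ('a \<Rightarrow> 'b) \<Rightarrow> bool"
where
  "smooth_map M N f \<longleftrightarrow>
     continuous_map (mtop M) (mtop N) f \<and>
     (\<forall>c\<in>atlas M. \<forall>d\<in>atlas N. smooth_on (model M) (coord_dom f c d) (coord_rep f c d))"

text \<open>
  \<open>D\<close> represents the differential of \<open>f\<close> at \<open>p\<close> in the charts \<open>c\<close>, \<open>d\<close>; it is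
  determined by \<open>f\<close> on the model space of the domain only.
\<close>

definition has_differential ::
  "('a \<Rightarrow> 'b) \<Rightarrow> 'a set \<times> ('a \<Rightarrow> 'e::real_normed_vector) \<Rightarrow> 'b set \<times> ('b \<Rightarrow> 'f::real_normed_vector) \<Rightarrow>
   'a \<Rightarrow> ('e \<Rightarrow> 'f) \<Rightarrow> bool"
where
  "has_differential f c d p D \<longleftrightarrow>
     (coord_rep f c d has_derivative D) (at (snd c p) within coord_dom f c d)"

definition submersion ::
  "('a, 'e::real_normed_vector) manifold \<Rightarrow> ('b, 'f::real_normed_vector) manifold \<Rightarrow> ('a \<Rightarrow> 'b) \<Rightarrow> bool"
where
  "submersion M N f \<longleftrightarrow> smooth_map M N f \<and>
     (\<forall>c\<in>atlas M. \<forall>d\<in>atlas N. \<forall>p\<in>fst c. f p \<in> fst d \<longrightarrow>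
        (\<exists>D. has_differential f c d p D \<and> D ` model M = model N))"

definition immersion ::
  "('a, 'e::real_normed_vector) manifold \<Rightarrow> ('b, 'f::real_normed_vector) manifold \<Rightarrow> ('a \<Rightarrow> 'b) \<Rightarrow> bool"
where
  "immersion M N f \<longleftrightarrow> smooth_map M N f \<and>
     (\<forall>c\<in>atlas M. \<forall>d\<in>atlas N. \<forall>p\<in>fst c. f p \<in> fst d \<longrightarrow>
        (\<exists>D. has_differential f c d p D \<and> inj_on D (model M)))"

definition embedded_submanifold ::
  "('a, 'e::real_normed_vector) manifold \<Rightarrow> ('a, 'f::real_normed_vector) manifold \<Rightarrow> bool"
where
  "embedded_submanifold P M \<longleftrightarrow> smooth_manifold P \<and>
     topspace (mtop P) \<subseteq> topspace (mtop M) \<and>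
     mtop P = subtopology (mtop M) (topspace (mtop P)) \<and>
     immersion P M id"

definition product_manifold :: "('a, 'e) manifold \<Rightarrow> ('b, 'f) manifold \<Rightarrow> ('a \<times> 'b, 'e \<times> 'f) manifold"
where
  "product_manifold M N =
     \<lparr>mtop = prod_topology (mtop M) (mtop N),
      model = model M \<times> model N,
      atlas = {(U \<times> V, map_prod \<phi> \<psi>) | U \<phi> V \<psi>. (U, \<phi>) \<in> atlas M \<and> (V, \<psi>) \<in> atlas N}\<rparr>"

text \<open>A relatively open subset \<open>U\<close> of a subspace \<open>E\<close>, with its inclusion as only chart.\<close>

definition open_manifold :: "'e::real_normed_vector set \<Rightarrow> 'e set \<Rightarrow> ('e, 'e) manifold" where
  "open_manifold E U = \<lparr>mtop = top_of_set U, model = E, atlas = {(U, id)}\<rparr>"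

abbreviation vector_manifold :: "('v::real_normed_vector, 'v) manifold" where
  "vector_manifold \<equiv> open_manifold UNIV UNIV"

record ('a, 'e) lie_grp = "'a monoid" +
  mfd :: "('a, 'e) manifold"

locale lie_group = group G for G :: "('a, 'e::real_normed_vector) lie_grp" (structure) +
  assumes manifold: "smooth_manifold (mfd G)"
    and carrier_eq: "carrier G = topspace (mtop (mfd G))"
    and smooth_mult: "smooth_map (product_manifold (mfd G) (mfd G)) (mfd G) (\<lambda>(x, y). x \<otimes> y)"
    and smooth_inv: "smooth_map (mfd G) (mfd G) (\<lambda>x. inv x)"

definition lie_morphism ::
  "('a, 'e::real_normed_vector) lie_grp \<Rightarrow> ('b, 'f::real_normed_vector) lie_grp \<Rightarrow> ('a \<Rightarrow> 'b) \<Rightarrow> bool"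
where
  "lie_morphism G H f \<longleftrightarrow> f \<in> hom G H \<and> smooth_map (mfd G) (mfd H) f"

record ('a1, 'e1, 'a0, 'e0) lie_xmod =
  X1  :: "('a1, 'e1) lie_grp"
  X0  :: "('a0, 'e0) lie_grp"
  bd  :: "'a1 \<Rightarrow> 'a0"
  act :: "'a0 \<Rightarrow> 'a1 \<Rightarrow> 'a1"

locale lie_crossed_module =
  fixes X :: "('a1, 'e1::real_normed_vector, 'a0, 'e0::real_normed_vector) lie_xmod"
  assumes X1: "lie_group (X1 X)"
    and X0: "lie_group (X0 X)"
    and bd: "lie_morphism (X1 X) (X0 X) (bd X)"
    and act_auto: "g \<in> carrier (X0 X) \<Longrightarrow> act X g \<in> iso (X1 X) (X1 X)"
    and act_one: "h \<in> carrier (X1 X) \<Longrightarrow> act X \<one>\<^bsub>X0 X\<^esub> h = h"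
    and act_mult: "\<lbrakk>g \<in> carrier (X0 X); g' \<in> carrier (X0 X); h \<in> carrier (X1 X)\<rbrakk>
      \<Longrightarrow> act X (g \<otimes>\<^bsub>X0 X\<^esub> g') h = act X g (act X g' h)"
    and act_smooth:
      "smooth_map (product_manifold (mfd (X0 X)) (mfd (X1 X))) (mfd (X1 X)) (\<lambda>(g, h). act X g h)"
    and bd_act: "\<lbrakk>g \<in> carrier (X0 X); h \<in> carrier (X1 X)\<rbrakk>
      \<Longrightarrow> bd X (act X g h) = g \<otimes>\<^bsub>X0 X\<^esub> bd X h \<otimes>\<^bsub>X0 X\<^esub> inv\<^bsub>X0 X\<^esub> g"
    and peiffer: "\<lbrakk>h \<in> carrier (X1 X); h' \<in> carrier (X1 X)\<rbrakk>
      \<Longrightarrow> act X (bd X h) h' = h \<otimes>\<^bsub>X1 X\<^esub> h' \<otimes>\<^bsub>X1 X\<^esub> inv\<^bsub>X1 X\<^esub> h"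

definition strict_xmod_morphism ::
  "('a1, 'e1::real_normed_vector, 'a0, 'e0::real_normed_vector) lie_xmod \<Rightarrow>
   ('b1, 'f1::real_normed_vector, 'b0, 'f0::real_normed_vector) lie_xmod \<Rightarrow>
   ('a1 \<Rightarrow> 'b1) \<Rightarrow> ('a0 \<Rightarrow> 'b0) \<Rightarrow> bool"
where
  "strict_xmod_morphism X Y F1 F0 \<longleftrightarrow>
     lie_morphism (X1 X) (X1 Y) F1 \<and> lie_morphism (X0 X) (X0 Y) F0 \<and>
     (\<forall>a\<in>carrier (X1 X). F0 (bd X a) = bd Y (F1 a)) \<and>
     (\<forall>x\<in>carrier (X0 X). \<forall>a\<in>carrier (X1 X). F1 (act X x a) = act Y (F0 x) (F1 a))"

text \<open>
  On finite-dimensional spaces every linear map is bounded, so \<open>Hom(V, W)\<close> is the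
  type of bounded linear maps.
\<close>

definition GL :: "('v::real_normed_vector \<Rightarrow>\<^sub>L 'v) monoid" where
  "GL = units_of \<lparr>carrier = UNIV, mult = (o\<^sub>L), one = id_blinfun\<rparr>"

text \<open>
  \<open>aut0\<close> is the set of invertible elements in the linear space of chain endomorphisms, \<open>aut1\<close>
  an open subset of \<open>Hom(V0, V1)\<close>; these open subsets carry the manifold structure.
\<close>

definition aut0 :: "('v1::real_normed_vector \<Rightarrow>\<^sub>L 'v0::real_normed_vector) \<Rightarrow>
  (('v0 \<Rightarrow>\<^sub>L 'v0) \<times> ('v1 \<Rightarrow>\<^sub>L 'v1), ('v0 \<Rightarrow>\<^sub>L 'v0) \<times> ('v1 \<Rightarrow>\<^sub>L 'v1)) lie_grp"
where
  "aut0 d =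
     (let K = {(B0, B1). B0 \<in> carrier GL \<and> B1 \<in> carrier GL \<and> B0 o\<^sub>L d = d o\<^sub>L B1} in
     \<lparr>carrier = K,
      mult = (\<lambda>(B0, B1) (C0, C1). (B0 o\<^sub>L C0, B1 o\<^sub>L C1)),
      one = (id_blinfun, id_blinfun),
      mfd = open_manifold {(B0, B1). B0 o\<^sub>L d = d o\<^sub>L B1} K\<rparr>)"

definition aut1 :: "('v1::real_normed_vector \<Rightarrow>\<^sub>L 'v0::real_normed_vector) \<Rightarrow>
  ('v0 \<Rightarrow>\<^sub>L 'v1, 'v0 \<Rightarrow>\<^sub>L 'v1) lie_grp"
where
  "aut1 d =
     (let K = {M. id_blinfun + (d o\<^sub>L M) \<in> carrier GL \<and> id_blinfun + (M o\<^sub>L d) \<in> carrier GL} in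
     \<lparr>carrier = K,
      mult = (\<lambda>M N. M + N + (M o\<^sub>L d o\<^sub>L N)),
      one = 0,
      mfd = open_manifold UNIV K\<rparr>)"

definition aut_xmod :: "('v1::real_normed_vector \<Rightarrow>\<^sub>L 'v0::real_normed_vector) \<Rightarrow>
  ('v0 \<Rightarrow>\<^sub>L 'v1, 'v0 \<Rightarrow>\<^sub>L 'v1,
   ('v0 \<Rightarrow>\<^sub>L 'v0) \<times> ('v1 \<Rightarrow>\<^sub>L 'v1), ('v0 \<Rightarrow>\<^sub>L 'v0) \<times> ('v1 \<Rightarrow>\<^sub>L 'v1)) lie_xmod"
where
  "aut_xmod d =
     \<lparr>X1 = aut1 d, X0 = aut0 d,
      bd = (\<lambda>M. (id_blinfun + (d o\<^sub>L M), id_blinfun + (M o\<^sub>L d))),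
      act = (\<lambda>(B0, B1) M. B1 o\<^sub>L M o\<^sub>L inv\<^bsub>GL\<^esub> B0)\<rparr>"

text \<open>
  The set of composable pairs \<open>(g, f)\<close> (first \<open>f\<close>, then \<open>g\<close>), as embedded submanifold of the
  square of the manifold of arrows. Such a structure is essentially unique.
\<close>

definition composable_manifold ::
  "('a, 'e::real_normed_vector) manifold \<Rightarrow> ('a \<Rightarrow> 'b) \<Rightarrow> ('a \<Rightarrow> 'b) \<Rightarrow>
   ('a \<times> 'a, 'e \<times> 'e) manifold \<Rightarrow> bool"
where
  "composable_manifold M s t P \<longleftrightarrow>
     embedded_submanifold P (product_manifold M M) \<and>
     topspace (mtop P) = {(g, f). g \<in> topspace (mtop M) \<and> f \<in> topspace (mtop M) \<and> s g = t f}"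

locale lie_groupoid =
  fixes M1 :: "('a, 'e::real_normed_vector) manifold"
    and M0 :: "('b, 'f::real_normed_vector) manifold"
    and s t :: "'a \<Rightarrow> 'b" and i :: "'b \<Rightarrow> 'a" and comp :: "'a \<Rightarrow> 'a \<Rightarrow> 'a"
  assumes manifold1: "smooth_manifold M1" and manifold0: "smooth_manifold M0"
    and s_submersion: "submersion M1 M0 s" and s_surj: "s ` topspace (mtop M1) = topspace (mtop M0)"
    and t_submersion: "submersion M1 M0 t" and t_surj: "t ` topspace (mtop M1) = topspace (mtop M0)"
    and i_smooth: "smooth_map M0 M1 i"
    and s_i: "x \<in> topspace (mtop M0) \<Longrightarrow> s (i x) = x"
    and t_i: "x \<in> topspace (mtop M0) \<Longrightarrow> t (i x) = x"
    and comp_smooth: "\<exists>P. composable_manifold M1 s t P \<and> smooth_map P M1 (\<lambda>(g, f). comp g f)"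
    and s_comp: "\<lbrakk>g \<in> topspace (mtop M1); f \<in> topspace (mtop M1); s g = t f\<rbrakk> \<Longrightarrow> s (comp g f) = s f"
    and t_comp: "\<lbrakk>g \<in> topspace (mtop M1); f \<in> topspace (mtop M1); s g = t f\<rbrakk> \<Longrightarrow> t (comp g f) = t g"
    and comp_assoc:
      "\<lbrakk>h \<in> topspace (mtop M1); g \<in> topspace (mtop M1); f \<in> topspace (mtop M1); s h = t g; s g = t f\<rbrakk>
       \<Longrightarrow> comp (comp h g) f = comp h (comp g f)"
    and comp_unit_right: "f \<in> topspace (mtop M1) \<Longrightarrow> comp f (i (s f)) = f"
    and comp_unit_left: "f \<in> topspace (mtop M1) \<Longrightarrow> comp (i (t f)) f = f"
    and inverse: "\<exists>j. smooth_map M1 M1 j \<and>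
      (\<forall>f\<in>topspace (mtop M1). s (j f) = t f \<and> t (j f) = s f \<and>
         comp (j f) f = i (s f) \<and> comp f (j f) = i (t f))"

text \<open>
  In a strict Lie 2-group the group multiplications of \<open>arrows\<close> and \<open>objects\<close> are the horizontal
  multiplications; \<open>vcomp g f\<close> is the vertical one and is meaningful only if \<open>src g = tgt f\<close>.
\<close>

record ('a, 'e, 'b, 'f) lie_2grp =
  arrows  :: "('a, 'e) lie_grp"
  objects :: "('b, 'f) lie_grp"
  src     :: "'a \<Rightarrow> 'b"
  tgt     :: "'a \<Rightarrow> 'b"
  ident   :: "'b \<Rightarrow> 'a"
  vcomp   :: "'a \<Rightarrow> 'a \<Rightarrow> 'a"

locale strict_lie_2group =
  fixes L :: "('a, 'e::real_normed_vector, 'b, 'f::real_normed_vector) lie_2grp"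
  assumes groupoid:
      "lie_groupoid (mfd (arrows L)) (mfd (objects L)) (src L) (tgt L) (ident L) (vcomp L)"
    and arrows: "lie_group (arrows L)"
    and objects: "lie_group (objects L)"
    and src: "lie_morphism (arrows L) (objects L) (src L)"
    and tgt: "lie_morphism (arrows L) (objects L) (tgt L)"
    and ident: "lie_morphism (objects L) (arrows L) (ident L)"
    and vcomp: "\<exists>P. lie_group P \<and>
      composable_manifold (mfd (arrows L)) (src L) (tgt L) (mfd P) \<and>
      mult P = mult (arrows L \<times>\<times> arrows L) \<and> one P = one (arrows L \<times>\<times> arrows L) \<and>
      lie_morphism P (arrows L) (\<lambda>(g, f). vcomp L g f)"

end

theory Submission
  imports Defs
begin

text \<open>
  The algebraic laws reduce to pointwise identities for the representation: \<open>\<Psi>0\<close> and \<open>\<Psi>1\<close>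
  are multiplicative, \<open>d\<close> intertwines the two components of \<open>\<Psi>0\<close>, \<open>\<Psi>0 (t a)\<close> acts as \<open>1 + d \<Psi>1 a\<close> and
  \<open>1 + \<Psi>1 a d\<close>, and \<open>\<Psi>1 (\<Phi>\<^sub>x a) \<circ> \<Psi>0 x = \<Psi>0 x \<circ> \<Psi>1 a\<close>.

  Smoothness is obtained by composing the given smooth maps, which needs a chain rule for maps
  between relatively open subsets of subspaces of finite-dimensional normed spaces. Source and target
  are submersions because smooth global sections pass through every arrow. A composable pair \<open>(g, f)\<close>
  is determined by \<open>f\<close> and the \<open>H1\<close>- and \<open>V1\<close>-components of \<open>g\<close>; this gives an embedding of a product
  manifold onto the set of composable pairs, with a smooth left inverse defined on all pairs of arrows.
  The left inverse makes the image an embedded submanifold, and reduces smoothness of maps into and out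
  of it to smoothness of maps between products.
\<close>

subsection \<open>Finite-dimensional normed spaces\<close>

text \<open>Two obstacles shape the analysis. The spaces are arbitrary normed spaces with a finite
  spanning set, so completeness, closedness of subspaces and boundedness of coordinates are built up
  one basis vector at a time. And \<open>Ck_on\<close> controls \<open>f' x v\<close> only for a
  fixed direction \<open>v\<close> of the model space, whereas the derivative of a composite
  evaluates \<open>f'\<close> in the direction \<open>g' x v\<close>, which varies with
  \<open>x\<close>. Closedness of the model space shows that this direction belongs to it; expanding
  the direction in a basis with bounded coordinate functionals then leaves only fixed directions.

  On the algebraic side, objects and arrows form semidirect products: a pair \<open>(x, a)\<close>
  acts on the sum of \<open>V0\<close> and \<open>V1\<close> by sending \<open>(\<eta>, n)\<close>
  to \<open>(\<Psi>0 x \<eta>, \<Psi>0 (t a x) n + \<Psi>1 a (\<Psi>0 x \<eta>))\<close>. The last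
  term makes the target map multiplicative, because \<open>\<Psi>0 (t a)\<close> acts on
  \<open>V0\<close> as \<open>1 + d \<Psi>1 a\<close>.\<close>

lemma second_countable_prod_topology:
  assumes "second_countable X" "second_countable Y"
  shows "second_countable (prod_topology X Y)"
proof -
  obtain A where A: "countable A" "\<forall>V\<in>A. openin X V"
    "\<forall>U x. openin X U \<and> x \<in> U \<longrightarrow> (\<exists>V\<in>A. x \<in> V \<and> V \<subseteq> U)"
    using assms(1) by (auto simp: second_countable_def)
  obtain B where B: "countable B" "\<forall>V\<in>B. openin Y V"
    "\<forall>U x. openin Y U \<and> x \<in> U \<longrightarrow> (\<exists>V\<in>B. x \<in> V \<and> V \<subseteq> U)"
    using assms(2) by (auto simp: second_countable_def)
  show ?thesis
    unfolding second_countable_def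
  proof (intro exI[of _ "(\<lambda>(a, b). a \<times> b) ` (A \<times> B)"] conjI allI impI)
    fix W p assume W: "openin (prod_topology X Y) W \<and> p \<in> W"
    obtain x y where p: "p = (x, y)" by force
    obtain U V where "openin X U" "openin Y V" "x \<in> U" "y \<in> V" "U \<times> V \<subseteq> W"
      using W p unfolding openin_prod_topology_alt by blast
    moreover obtain a where "a \<in> A" "x \<in> a" "a \<subseteq> U" using A(3) calculation by blast
    moreover obtain b where "b \<in> B" "y \<in> b" "b \<subseteq> V" using B(3) calculation by blast
    ultimately show "\<exists>S\<in>(\<lambda>(a, b). a \<times> b) ` (A \<times> B). p \<in> S \<and> S \<subseteq> W"
      using p by (intro bexI[of _ "a \<times> b"]) auto
  qed (use A B in \<open>auto simp: openin_prod_Times_iff\<close>)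
qed

lemma second_countable_euclideanreal: "second_countable (euclidean :: real topology)"
proof -
  obtain B :: "real set set" where B: "countable B" "topological_basis B"
    using ex_countable_basis by auto
  then show ?thesis
    unfolding second_countable_def
    by (intro exI[of _ B])
      (metis open_openin topological_basisE topological_basis_open)
qed

lemma complete_product:
  fixes A :: "'a::metric_space set" and B :: "'b::metric_space set"
  assumes "complete A" "complete B"
  shows "complete (A \<times> B)"
  unfolding complete_def
proof (intro allI impI, elim conjE)
  fix f :: "nat \<Rightarrow> 'a \<times> 'b"
  assume f: "\<forall>n. f n \<in> A \<times> B" "Cauchy f"
  have "\<forall>n. fst (f n) \<in> A" "\<forall>n. snd (f n) \<in> B" using f(1) by (auto simp: mem_Times_iff)
  moreover have "Cauchy (\<lambda>n. fst (f n))" "Cauchy (\<lambda>n. snd (f n))"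
    by (rule Cauchy_fst[OF f(2)], rule Cauchy_snd[OF f(2)])
  ultimately obtain a b where "a \<in> A" "(\<lambda>n. fst (f n)) \<longlonglongrightarrow> a"
    "b \<in> B" "(\<lambda>n. snd (f n)) \<longlonglongrightarrow> b"
    using assms unfolding complete_def by metis
  then have "(\<lambda>n. (fst (f n), snd (f n))) \<longlonglongrightarrow> (a, b)" "(a, b) \<in> A \<times> B"
    by (simp_all only: tendsto_Pair mem_Times_iff fst_conv snd_conv simp_thms)
  then show "\<exists>l\<in>A \<times> B. f \<longlonglongrightarrow> l" unfolding prod.collapse by blast
qed

text \<open>A complete subspace is closed, so \<open>a\<close> has positive distance
  \<open>\<delta>\<close> from it. Scaling bounds the coefficient \<open>c\<close> by the norm of
  the sum, and the triangle inequality then bounds \<open>x\<close>. This is what allows a span to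
  grow by one vector.\<close>

lemma span_insert_bounded_below:
  fixes a :: "'a::real_normed_vector"
  assumes "complete (span B)" "a \<notin> span B"
  obtains e where "e > 0" "\<And>c x. x \<in> span B \<Longrightarrow> e * norm (c, x) \<le> norm (c *\<^sub>R a + x)"
proof -
  define \<delta> where "\<delta> = infdist a (span B)"
  have \<delta>: "\<delta> > 0"
    unfolding \<delta>_def using assms complete_imp_closed span_zero
    by (intro infdist_pos_not_in_closed) auto
  have 1: "\<bar>c\<bar> * \<delta> \<le> norm (c *\<^sub>R a + x)" if "x \<in> span B" for c x
  proof (cases "c = 0")
    case False
    have "- (x /\<^sub>R c) \<in> span B" using that by (simp add: span_neg span_scale)
    then have "\<delta> \<le> dist a (- (x /\<^sub>R c))" unfolding \<delta>_def by (rule infdist_le)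
    also have "\<dots> = norm (a + x /\<^sub>R c)" by (simp add: dist_norm)
    finally have "\<bar>c\<bar> * \<delta> \<le> \<bar>c\<bar> * norm (a + x /\<^sub>R c)" by (simp add: mult_left_mono)
    also have "\<dots> = norm (c *\<^sub>R a + x)"
      using False by (simp flip: norm_scaleR add: scaleR_add_right)
    finally show ?thesis .
  qed simp
  \<comment> \<open>The summand \<open>1 / \<delta>\<close> comes from the bound on
    \<open>\<bar>c\<bar>\<close>; the other two come from \<open>norm x\<close>, estimated by the
    norm of the sum plus \<open>\<bar>c\<bar> * norm a\<close>.\<close>
  define K where "K = 1 / \<delta> + 1 + norm a / \<delta>"
  have K: "K > 0" unfolding K_def using \<delta> by (simp add: add_pos_nonneg)
  have 2: "norm (c, x) \<le> K * norm (c *\<^sub>R a + x)" if x: "x \<in> span B" for c x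
  proof -
    let ?N = "norm (c *\<^sub>R a + x)"
    have c: "\<bar>c\<bar> \<le> ?N / \<delta>" using 1[OF x, of c] \<delta> by (simp add: pos_le_divide_eq)
    have "norm x \<le> ?N + norm (c *\<^sub>R a)"
      by (metis add_diff_cancel_left' norm_triangle_ineq4)
    also have "\<dots> \<le> ?N + ?N / \<delta> * norm a" using mult_right_mono[OF c norm_ge_zero[of a]] by simp
    finally have "\<bar>c\<bar> + norm x \<le> K * ?N" using c unfolding K_def by (simp add: algebra_simps)
    moreover have "norm (c, x) \<le> \<bar>c\<bar> + norm x" using norm_Pair_le[of c x] by simp
    ultimately show ?thesis by linarith
  qed
  show thesis
    by (rule that[of "1 / K"]) (use K 2 in \<open>auto simp: field_simps\<close>)
qed

text \<open>One induction proves all three claims, because the step needs completeness of the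
  smaller span: it yields the lower bound that turns \<open>(c, x) \<mapsto> c a + x\<close> into a
  linear homeomorphism onto the larger span. Completeness and second countability are carried along
  it, and the same bound controls the coefficients.\<close>

lemma finite_span:
  fixes B :: "'a::real_normed_vector set"
  assumes "finite B" "independent B"
  shows complete_finite_span: "complete (span B)"
    and second_countable_finite_span: "second_countable (top_of_set (span B))"
    and finite_span_coefficients_bounded:
      "\<exists>C. \<forall>u. (\<Sum>b\<in>B. \<bar>u b\<bar>) \<le> C * norm (\<Sum>b\<in>B. u b *\<^sub>R b)"
proof -
  have "complete (span B) \<and> second_countable (top_of_set (span B)) \<and>
    (\<exists>C. \<forall>u. (\<Sum>b\<in>B. \<bar>u b\<bar>) \<le> C * norm (\<Sum>b\<in>B. u b *\<^sub>R b))"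
    using assms
  proof (induction B rule: finite_induct)
    case empty
    have "second_countable (top_of_set {0::'a})"
      unfolding second_countable_def by (intro exI[of _ "{{0}}"]) (auto simp: openin_subtopology)
    then show ?case by (simp add: complete_def lim_explicit)
  next
    case (insert a B)
    have ind: "independent B" and a: "a \<notin> span B"
      using insert by (auto simp: independent_insert)
    have IH: "complete (span B)" "second_countable (top_of_set (span B))"
      using insert.IH[OF ind] by auto
    obtain C where C: "\<And>u. (\<Sum>b\<in>B. \<bar>u b\<bar>) \<le> C * norm (\<Sum>b\<in>B. u b *\<^sub>R b)"
      using insert.IH[OF ind] by auto
    obtain e where e: "e > 0" "\<And>c x. x \<in> span B \<Longrightarrow> e * norm (c, x) \<le> norm (c *\<^sub>R a + x)"
      using span_insert_bounded_below[OF IH(1) a] by blast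
    define f where "f = (\<lambda>p::real \<times> 'a. fst p *\<^sub>R a + snd p)"
    let ?S = "(UNIV::real set) \<times> span B"
    have bl: "bounded_linear f" unfolding f_def
      by (intro bounded_linear_add bounded_linear_snd
          bounded_linear_compose[OF bounded_linear_scaleR_left bounded_linear_fst])
    have sub: "subspace ?S" by (simp add: subspace_Times)
    have fe: "\<forall>p\<in>?S. norm (f p) \<ge> e * norm p" using e(2) unfolding f_def by auto
    have "complete (UNIV::real set)" by (simp add: complete_UNIV)
    then have cS: "complete ?S" using IH(1) by (rule complete_product)
    have im: "f ` ?S = span (insert a B)"
    proof safe
      fix k x assume "x \<in> span B"
      then show "f (k, x) \<in> span (insert a B)"
        unfolding f_def by (auto simp: span_breakdown_eq intro!: exI[of _ k])
    next
      fix x assume "x \<in> span (insert a B)"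
      then obtain k where "x - k *\<^sub>R a \<in> span B" by (auto simp: span_breakdown_eq)
      then show "x \<in> f ` ?S" by (intro image_eqI[of _ _ "(k, x - k *\<^sub>R a)"]) (auto simp: f_def)
    qed
    have inj: "inj_on f ?S"
    proof (rule inj_onI)
      fix p q assume pq: "p \<in> ?S" "q \<in> ?S" "f p = f q"
      then have "p - q \<in> ?S" using sub by (meson subspace_diff)
      then have "e * norm (p - q) \<le> norm (f p - f q)"
        using fe bl by (metis bounded_linear.linear linear_diff)
      then show "p = q" using pq e(1) by (simp add: mult_le_0_iff)
    qed
    have cont_inv: "continuous_on (f ` ?S) (inv_into ?S f)"
      unfolding continuous_on_iff
    proof (intro ballI allI impI)
      fix y \<epsilon> :: real and x assume x: "x \<in> f ` ?S" and \<epsilon>: "0 < \<epsilon>"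
      show "\<exists>d>0. \<forall>x'\<in>f ` ?S. dist x' x < d \<longrightarrow> dist (inv_into ?S f x') (inv_into ?S f x) < \<epsilon>"
      proof (intro exI[of _ "e * \<epsilon>"] conjI ballI impI)
        fix x' assume x': "x' \<in> f ` ?S" "dist x' x < e * \<epsilon>"
        let ?p = "inv_into ?S f x'" and ?q = "inv_into ?S f x"
        have "?p - ?q \<in> ?S" using x x'(1) sub by (meson inv_into_into subspace_diff)
        then have "e * norm (?p - ?q) \<le> norm (f ?p - f ?q)"
          using fe bl by (metis bounded_linear.linear linear_diff)
        also have "\<dots> < e * \<epsilon>" using x x' by (simp add: f_inv_into_f dist_norm)
        finally show "dist ?p ?q < \<epsilon>" using e(1) by (simp add: dist_norm)
      qed (use e \<epsilon> in simp)
    qed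
    have "homeomorphic_maps (top_of_set ?S) (top_of_set (f ` ?S)) f (inv_into ?S f)"
      unfolding homeomorphic_maps_def
      using cont_inv bl inj
      by (auto simp: linear_continuous_on inv_into_into f_inv_into_f simp del: split_paired_All)
    then have "top_of_set ?S homeomorphic_space top_of_set (f ` ?S)"
      by (rule homeomorphic_maps_imp_homeomorphic_space)
    moreover have "second_countable (top_of_set ?S)"
      using second_countable_prod_topology[OF second_countable_euclideanreal IH(2)]
      by (metis prod_topology_subtopology_eu subtopology_UNIV)
    ultimately have sc: "second_countable (top_of_set (span (insert a B)))"
      using homeomorphic_space_second_countability im by metis
    \<comment> \<open>The sign of \<open>C\<close> is unknown, so \<open>\<bar>C\<bar>\<close>
      provides a factor that is monotone in the norm. The summand \<open>1\<close> accounts for the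
      coefficient of \<open>a\<close>, the division by \<open>e\<close> for the lower bound on the
      norm of the sum.\<close>
    have bd: "(\<Sum>b\<in>insert a B. \<bar>u b\<bar>) \<le> (1 + \<bar>C\<bar>) / e * norm (\<Sum>b\<in>insert a B. u b *\<^sub>R b)" for u
    proof -
      let ?s = "\<Sum>b\<in>B. u b *\<^sub>R b"
      have "?s \<in> span B" by (simp add: span_base span_scale span_sum)
      then have *: "e * norm (u a, ?s) \<le> norm (u a *\<^sub>R a + ?s)" by (rule e(2))
      have "\<bar>u a\<bar> \<le> norm (u a, ?s)" "norm ?s \<le> norm (u a, ?s)"
        using norm_fst_le[of "u a" ?s] norm_snd_le[of ?s "u a"] by simp_all
      moreover have "(\<Sum>b\<in>B. \<bar>u b\<bar>) \<le> \<bar>C\<bar> * norm ?s"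
        using C[of u] mult_right_mono[OF abs_ge_self[of C] norm_ge_zero[of ?s]] by linarith
      moreover have "\<bar>C\<bar> * norm ?s \<le> \<bar>C\<bar> * norm (u a, ?s)" using calculation by (simp add: mult_left_mono)
      ultimately have "\<bar>u a\<bar> + (\<Sum>b\<in>B. \<bar>u b\<bar>) \<le> (1 + \<bar>C\<bar>) * norm (u a, ?s)"
        by (simp add: algebra_simps)
      also have "\<dots> \<le> (1 + \<bar>C\<bar>) * (norm (u a *\<^sub>R a + ?s) / e)"
        using * e(1) by (intro mult_left_mono) (auto simp: field_simps)
      finally show ?thesis using insert.hyps by (simp add: field_simps)
    qed
    show ?case
      using complete_isometric_image[OF e(1) sub bl fe cS] sc bd unfolding im by blast
  qed
  then show "complete (span B)" "second_countable (top_of_set (span B))"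
    "\<exists>C. \<forall>u. (\<Sum>b\<in>B. \<bar>u b\<bar>) \<le> C * norm (\<Sum>b\<in>B. u b *\<^sub>R b)"
    by blast+
qed

text \<open>The functionals must be bounded on the whole space, not only on \<open>S\<close>. Hence
  a basis \<open>B\<close> of \<open>S\<close> is extended to a basis \<open>D\<close> of the space
  and \<open>c b\<close> is the coordinate with respect to \<open>D\<close>; on \<open>S\<close> it
  agrees with the coordinate with respect to \<open>B\<close>.\<close>

lemma finite_dimensional_subspace_basis:
  assumes "finite_dimensional (UNIV :: 'a::real_normed_vector set)" "subspace (S :: 'a set)"
  obtains B c where "finite B" "B \<subseteq> S" "\<And>b. bounded_linear (c b :: 'a \<Rightarrow> real)"
    "\<And>x. x \<in> S \<Longrightarrow> (\<Sum>b\<in>B. c b x *\<^sub>R b) = x"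
proof -
  obtain T :: "'a set" where T: "finite T" "UNIV \<subseteq> span T"
    using assms(1) by (auto simp: finite_dimensional_def)
  obtain B where B: "B \<subseteq> S" "independent B" "S \<subseteq> span B"
    using maximal_independent_subset_extend[of "{}" S] by (auto simp: independent_empty)
  obtain D where D: "B \<subseteq> D" "independent D" "UNIV \<subseteq> span D"
    using maximal_independent_subset_extend[OF subset_UNIV B(2)] by metis
  have fD: "finite D" using independent_span_bound[OF T(1) D(2)] T(2) by blast
  then have fB: "finite B" using D(1) finite_subset by blast
  define c where "c = (\<lambda>b x. representation D x b)"
  obtain C where C: "\<And>u. (\<Sum>b\<in>D. \<bar>u b\<bar>) \<le> C * norm (\<Sum>b\<in>D. u b *\<^sub>R b)"
    using finite_span_coefficients_bounded[OF fD D(2)] by blast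
  have sD: "span D = UNIV" using D(3) by blast
  have "bounded_linear (c b)" for b
  proof (rule bounded_linear_intro[where K = C])
    fix x y r
    show "c b (x + y) = c b x + c b y" "c b (r *\<^sub>R x) = r *\<^sub>R c b x"
      unfolding c_def using D(2) sD by (auto simp: representation_add representation_scale)
    have "\<bar>c b x\<bar> \<le> (\<Sum>b\<in>D. \<bar>c b x\<bar>)"
    proof (cases "b \<in> D")
      case True
      then show ?thesis using fD by (intro member_le_sum) auto
    next
      case False
      then have "c b x = 0" unfolding c_def using representation_ne_zero by blast
      then show ?thesis by (simp add: sum_nonneg)
    qed
    also have "\<dots> \<le> C * norm (\<Sum>b\<in>D. c b x *\<^sub>R b)" by (rule C)
    also have "(\<Sum>b\<in>D. c b x *\<^sub>R b) = x"
      unfolding c_def using D(2) sD fD by (intro sum_representation_eq) auto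
    finally show "norm (c b x) \<le> norm x * C" by (simp add: mult.commute)
  qed
  moreover have "(\<Sum>b\<in>B. c b x *\<^sub>R b) = x" if "x \<in> S" for x
  proof -
    have "x \<in> span B" using that B(3) by blast
    then show ?thesis
      unfolding c_def representation_extend[OF D(2) \<open>x \<in> span B\<close> D(1)]
      using B(2) fB by (intro sum_representation_eq) auto
  qed
  ultimately show thesis using that fB B(1) by blast
qed

text \<open>This keeps derivatives of maps into a model space inside that model space.\<close>

lemma finite_dimensional_subspace_closed:
  assumes "finite_dimensional (UNIV :: 'a::real_normed_vector set)" "subspace (S :: 'a set)"
  shows "closed S"
proof -
  obtain T :: "'a set" where T: "finite T" "UNIV \<subseteq> span T"
    using assms(1) by (auto simp: finite_dimensional_def)
  obtain B where B: "B \<subseteq> S" "independent B" "S \<subseteq> span B"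
    using maximal_independent_subset_extend[of "{}" S] by (auto simp: independent_empty)
  have "finite B" using independent_span_bound[OF T(1) B(2)] T(2) by blast
  moreover have "span B = S" using B assms(2) by (metis span_minimal subset_antisym)
  ultimately show ?thesis using complete_finite_span[of B] B(2) complete_imp_closed by metis
qed

lemma second_countable_finite_dimensional:
  assumes "finite_dimensional (UNIV :: 'a::real_normed_vector set)"
  shows "second_countable (euclidean :: 'a topology)"
proof -
  obtain T :: "'a set" where T: "finite T" "UNIV \<subseteq> span T"
    using assms(1) by (auto simp: finite_dimensional_def)
  obtain B :: "'a set" where B: "independent B" "UNIV \<subseteq> span B"
    using maximal_independent_subset_extend[of "{}" "UNIV::'a set"] by (auto simp: independent_empty)
  have "finite B" using independent_span_bound[OF T(1) B(1)] T(2) by blast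
  then show ?thesis
    using second_countable_finite_span[of B] B by (simp add: top.extremum_unique)
qed

lemma finite_dimensional_Times:
  assumes "finite_dimensional (UNIV :: 'a::real_normed_vector set)"
    "finite_dimensional (UNIV :: 'b::real_normed_vector set)"
  shows "finite_dimensional (UNIV :: ('a \<times> 'b) set)"
proof -
  obtain S :: "'a set" and T :: "'b set" where "finite S" "UNIV \<subseteq> span S" "finite T" "UNIV \<subseteq> span T"
    using assms by (auto simp: finite_dimensional_def)
  moreover have "(x, y) \<in> span ((\<lambda>x. (x, 0)) ` S \<union> Pair 0 ` T)" if "x \<in> span S" "y \<in> span T" for x y
  proof -
    have "linear (\<lambda>x::'a. (x, 0::'b))" "linear (Pair (0::'a) :: 'b \<Rightarrow> _)"
      by (auto intro!: linearI)
    then have "span ((\<lambda>x. (x, 0::'b)) ` S) = (\<lambda>x. (x, 0)) ` span S"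
      "span (Pair (0::'a) ` T) = Pair 0 ` span T"
      by (simp_all add: linear_span_image)
    then have "(x, 0) \<in> span ((\<lambda>x. (x, 0::'b)) ` S)" "(0, y) \<in> span (Pair (0::'a) ` T)"
      using that by auto
    then have "(x, 0) + (0, y) \<in> span ((\<lambda>x. (x, 0)) ` S \<union> Pair 0 ` T)"
      by (intro span_add) (meson in_mono span_mono sup_ge1 sup_ge2)+
    then show ?thesis by simp
  qed
  ultimately show ?thesis unfolding finite_dimensional_def
    by (intro exI[of _ "(\<lambda>x. (x, 0)) ` S \<union> Pair 0 ` T"]) auto
qed

subsection \<open>Calculus on relatively open subsets of a subspace\<close>

text \<open>Derivatives on a piece of a relatively open cover thereby become derivatives on the
  whole set.\<close>

lemma at_within_openin:
  assumes "openin (top_of_set E) V" "V \<subseteq> U" "U \<subseteq> E" "x \<in> V"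
  shows "at x within V = at x within U"
proof -
  obtain O' where "open O'" "V = E \<inter> O'" using assms(1) by (auto simp: openin_open)
  then show ?thesis using assms by (intro at_within_nhd[of x O']) auto
qed

text \<open>The line through \<open>x\<close> in direction \<open>v \<in> E\<close> stays in
  \<open>U\<close> for all small parameters, because \<open>U\<close> is relatively open in
  \<open>E\<close>. Restricting to it trades a derivative within \<open>U\<close> for an ordinary
  one in a real variable.\<close>

lemma has_derivative_imp_directional:
  assumes f: "(f has_derivative f') (at x within U)" and x: "x \<in> U"
    and U: "openin (top_of_set E) U" and E: "subspace E" and v: "v \<in> E"
  shows "((\<lambda>h. f (x + h *\<^sub>R v)) has_vector_derivative f' v) (at 0)"
proof -
  obtain O' where O': "open O'" "U = E \<inter> O'" using U by (auto simp: openin_open)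
  define T where "T = (\<lambda>h::real. x + h *\<^sub>R v) -` O'"
  have T: "open T" unfolding T_def by (intro open_vimage O' continuous_intros)
  have T0: "0 \<in> T" using x O' by (auto simp: T_def)
  have im: "(\<lambda>h. x + h *\<^sub>R v) ` T \<subseteq> U"
    using O' x E v by (auto simp: T_def subspace_add subspace_scale)
  have "((\<lambda>h. f (x + h *\<^sub>R v)) has_derivative (\<lambda>h. f' (h *\<^sub>R v))) (at 0 within T)"
  proof (rule has_derivative_in_compose[where g = f and g' = f' and f' = "\<lambda>h. h *\<^sub>R v"])
    show "((\<lambda>h. x + h *\<^sub>R v) has_derivative (\<lambda>h. h *\<^sub>R v)) (at 0 within T)"
      by (auto intro!: derivative_eq_intros)
    show "(f has_derivative f') (at (x + 0 *\<^sub>R v) within (\<lambda>h. x + h *\<^sub>R v) ` T)"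
      using has_derivative_subset[OF f im] by simp
  qed
  then show ?thesis
    unfolding has_vector_derivative_def at_within_open[OF T0 T]
    by (simp only: linear_scale[OF has_derivative_linear[OF f]])
qed

text \<open>Uniqueness can be expected only for \<open>v \<in> E\<close>: a derivative within
  \<open>U\<close> is arbitrary in directions transversal to \<open>E\<close>.\<close>

lemma has_derivative_unique_on:
  assumes "(f has_derivative f') (at x within U)" "(f has_derivative f'') (at x within U)"
    and "x \<in> U" "openin (top_of_set E) U" "subspace E" "v \<in> E"
  shows "f' v = f'' v"
  using has_derivative_imp_directional[OF assms(1,3-6)] has_derivative_imp_directional[OF assms(2-6)]
  by (rule vector_derivative_unique_at)

text \<open>The value \<open>f' v\<close> is a limit of difference quotients, which lie in
  \<open>F\<close> as soon as the line stays in \<open>U\<close>.\<close>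

lemma has_derivative_in_closed_subspace:
  assumes f: "(f has_derivative f') (at x within U)" and x: "x \<in> U"
    and U: "openin (top_of_set E) U" and E: "subspace E" and v: "v \<in> E"
    and F: "closed F" "subspace F" and im: "f ` U \<subseteq> F"
  shows "f' v \<in> F"
proof -
  obtain O' where O': "open O'" "U = E \<inter> O'" using U by (auto simp: openin_open)
  define T where "T = (\<lambda>h::real. x + h *\<^sub>R v) -` O'"
  have T: "open T" unfolding T_def by (intro open_vimage O' continuous_intros)
  have T0: "0 \<in> T" using x O' by (auto simp: T_def)
  have "((\<lambda>h. f (x + h *\<^sub>R v)) has_derivative (\<lambda>h. h *\<^sub>R f' v)) (at 0)"
    using has_derivative_imp_directional[OF f x U E v] by (simp add: has_vector_derivative_def)
  then have "((\<lambda>h. norm (f (x + h *\<^sub>R v) - f x - h *\<^sub>R f' v) / \<bar>h\<bar>) \<longlongrightarrow> 0) (at 0)"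
    by (simp add: has_derivative_at)
  \<comment> \<open>Difference quotients lie in \<open>F\<close>, while the remainder already
    involves \<open>f' v\<close>; so the remainder estimate is turned into convergence of the
    quotients.\<close>
  moreover have "norm (f (x + h *\<^sub>R v) - f x - h *\<^sub>R f' v) / \<bar>h\<bar>
      = norm ((f (x + h *\<^sub>R v) - f x) /\<^sub>R h - f' v)" if "h \<noteq> 0" for h
  proof -
    have "f (x + h *\<^sub>R v) - f x - h *\<^sub>R f' v = h *\<^sub>R ((f (x + h *\<^sub>R v) - f x) /\<^sub>R h - f' v)"
      using that by (simp add: algebra_simps)
    then show ?thesis using that by simp
  qed
  then have "\<forall>\<^sub>F h in at 0. norm (f (x + h *\<^sub>R v) - f x - h *\<^sub>R f' v) / \<bar>h\<bar>
      = norm ((f (x + h *\<^sub>R v) - f x) /\<^sub>R h - f' v)"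
    by (simp add: eventually_at_filter)
  ultimately have "((\<lambda>h. norm ((f (x + h *\<^sub>R v) - f x) /\<^sub>R h - f' v)) \<longlongrightarrow> 0) (at 0)"
    by (rule Lim_transform_eventually)
  then have lim: "((\<lambda>h. (f (x + h *\<^sub>R v) - f x) /\<^sub>R h) \<longlongrightarrow> f' v) (at 0)"
    by (rule LIM_zero_cancel[OF tendsto_norm_zero_cancel])
  have "\<forall>\<^sub>F h in at 0. h \<in> T" using T T0 by (simp add: eventually_at_in_open')
  then have ev: "\<forall>\<^sub>F h in at 0. (f (x + h *\<^sub>R v) - f x) /\<^sub>R h \<in> F"
  proof eventually_elim
    case (elim h)
    then have "x + h *\<^sub>R v \<in> U" using O' x E v by (auto simp: T_def subspace_add subspace_scale)
    then show ?case using im x F(2) by (intro subspace_scale subspace_diff) auto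
  qed
  show ?thesis by (rule Lim_in_closed_set[OF F(1) ev _ lim]) simp
qed

section \<open>Closure properties of the class C^k and the chain rule\<close>

lemma Ck_on_subset:
  assumes "Ck_on k E U f" "V \<subseteq> U" shows "Ck_on k E V f"
  using assms
proof (induction k arbitrary: f)
  case (Suc k)
  then obtain f' where "\<forall>x\<in>U. (f has_derivative f' x) (at x within U)"
    "\<forall>v\<in>E. Ck_on k E U (\<lambda>x. f' x v)" by auto
  then have "\<forall>x\<in>V. (f has_derivative f' x) (at x within V)" "\<forall>v\<in>E. Ck_on k E V (\<lambda>x. f' x v)"
    using Suc.prems(2) Suc.IH by (blast intro: has_derivative_subset)+
  then show ?case by auto
qed (auto intro: continuous_on_subset)

lemma Ck_on_cong:
  assumes "Ck_on k E U f" "\<And>x. x \<in> U \<Longrightarrow> g x = f x" shows "Ck_on k E U g"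
  using assms by (cases k) (auto cong: continuous_on_cong intro: has_derivative_transform)

text \<open>The neighbourhoods come with unrelated derivatives \<open>f' x\<close>, but
  \<open>Ck_on\<close> asks for a single one. The diagonal \<open>y \<mapsto> f' y y\<close> serves:
  in directions of \<open>E\<close> it agrees with \<open>f' x\<close> on all of \<open>V x\<close>
  by uniqueness, so the induction hypothesis applies to it.\<close>

lemma Ck_on_local:
  assumes E: "subspace E" and U: "U \<subseteq> E"
    and "\<And>x. x \<in> U \<Longrightarrow> \<exists>V. openin (top_of_set E) V \<and> x \<in> V \<and> V \<subseteq> U \<and> Ck_on k E V f"
  shows "Ck_on k E U f"
  using assms(3)
proof (induction k arbitrary: f)
  case 0
  show ?case
    using 0 at_within_openin[OF _ _ U] unfolding Ck_on.simps continuous_on_eq_continuous_within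
    by (metis subsetD)
next
  case (Suc k)
  have "\<forall>x\<in>U. \<exists>V f'. openin (top_of_set E) V \<and> x \<in> V \<and> V \<subseteq> U \<and>
      (\<forall>y\<in>V. (f has_derivative f' y) (at y within V)) \<and> (\<forall>v\<in>E. Ck_on k E V (\<lambda>y. f' y v))"
  proof
    fix x assume "x \<in> U"
    then obtain V where V: "openin (top_of_set E) V" "x \<in> V" "V \<subseteq> U" "Ck_on (Suc k) E V f"
      using Suc.prems by metis
    then show "\<exists>V f'. openin (top_of_set E) V \<and> x \<in> V \<and> V \<subseteq> U \<and>
      (\<forall>y\<in>V. (f has_derivative f' y) (at y within V)) \<and> (\<forall>v\<in>E. Ck_on k E V (\<lambda>y. f' y v))"
      unfolding Ck_on.simps by metis
  qed
  then obtain V f' where *: "\<forall>x\<in>U. openin (top_of_set E) (V x) \<and> x \<in> V x \<and> V x \<subseteq> U \<and>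
      (\<forall>y\<in>V x. (f has_derivative f' x y) (at y within V x)) \<and> (\<forall>v\<in>E. Ck_on k E (V x) (\<lambda>y. f' x y v))"
    unfolding bchoice_iff by (elim exE)
  have V: "openin (top_of_set E) (V x)" "x \<in> V x" "V x \<subseteq> U" if "x \<in> U" for x
    using * that by auto
  have V': "(f has_derivative f' x y) (at y within V x)" if "x \<in> U" "y \<in> V x" for x y
    using * that by auto
  have V'': "Ck_on k E (V x) (\<lambda>y. f' x y v)" if "x \<in> U" "v \<in> E" for x v
    using * that by auto
  have f: "(f has_derivative f' x y) (at y within U)" if "x \<in> U" "y \<in> V x" for x y
    using V'[OF that] at_within_openin[OF V(1)[OF that(1)] V(3)[OF that(1)] U that(2)] by simp
  have openU: "openin (top_of_set E) U"
    using V by (subst openin_subopen) blast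
  have eq: "f' y y v = f' x y v" if "x \<in> U" "y \<in> V x" "v \<in> E" for x y v
  proof -
    have "y \<in> U" using V(3) that by blast
    then show ?thesis
      using has_derivative_unique_on[OF f[of y y] f[OF that(1,2)] _ openU E that(3)] V(2) by blast
  qed
  have "Ck_on k E U (\<lambda>y. f' y y v)" if v: "v \<in> E" for v
  proof (rule Suc.IH)
    fix x assume x: "x \<in> U"
    have "Ck_on k E (V x) (\<lambda>y. f' y y v)"
      by (rule Ck_on_cong[OF V''[OF x v]]) (rule eq[OF x _ v])
    then show "\<exists>V. openin (top_of_set E) V \<and> x \<in> V \<and> V \<subseteq> U \<and> Ck_on k E V (\<lambda>y. f' y y v)"
      using V(1-3)[OF x] by blast
  qed
  then show ?case
    unfolding Ck_on.simps using f V(2) by (intro exI[of _ "\<lambda>y. f' y y"]) simp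
qed

lemma Ck_on_SucD: "Ck_on (Suc k) E U f \<Longrightarrow> Ck_on k E U f"
proof (induction k arbitrary: f)
  case 0
  then show ?case by (auto intro: has_derivative_continuous_on)
next
  case (Suc k)
  then show ?case unfolding Ck_on.simps(2)[of "Suc k"] Ck_on.simps(2)[of k] by blast
qed

lemma Ck_on_const: "Ck_on k E U (\<lambda>_. c)"
proof (induction k arbitrary: c)
  case (Suc k)
  then show ?case
    unfolding Ck_on.simps by (intro exI[of _ "\<lambda>x v. 0"]) simp
qed simp

lemma Ck_on_bounded_linear:
  assumes "bounded_linear L" "Ck_on k E U f" shows "Ck_on k E U (\<lambda>x. L (f x))"
  using assms(2)
proof (induction k arbitrary: f)
  case 0
  then show ?case using bounded_linear.continuous_on[OF assms(1)] by simp
next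
  case (Suc k)
  then obtain f' where "\<forall>x\<in>U. (f has_derivative f' x) (at x within U)"
    "\<forall>v\<in>E. Ck_on k E U (\<lambda>x. f' x v)" by auto
  then show ?case
    unfolding Ck_on.simps
    by (intro exI[of _ "\<lambda>x v. L (f' x v)"])
      (simp add: bounded_linear.has_derivative[OF assms(1)] Suc.IH)
qed

lemma Ck_on_ident: "Ck_on k E U (\<lambda>x. x)"
proof (cases k)
  case (Suc n)
  then show ?thesis
    unfolding Suc Ck_on.simps
    by (intro exI[of _ "\<lambda>x v. v"]) (simp add: Ck_on_const)
qed simp

lemma Ck_on_add:
  assumes "Ck_on k E U f" "Ck_on k E U g" shows "Ck_on k E U (\<lambda>x. f x + g x)"
  using assms
proof (induction k arbitrary: f g)
  case 0
  then show ?case by (simp add: continuous_on_add)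
next
  case (Suc k)
  then obtain f' g' where "\<forall>x\<in>U. (f has_derivative f' x) (at x within U)"
    "\<forall>v\<in>E. Ck_on k E U (\<lambda>x. f' x v)" "\<forall>x\<in>U. (g has_derivative g' x) (at x within U)"
    "\<forall>v\<in>E. Ck_on k E U (\<lambda>x. g' x v)" by auto
  then show ?case
    unfolding Ck_on.simps
    by (intro exI[of _ "\<lambda>x v. f' x v + g' x v"]) (simp add: has_derivative_add Suc.IH)
qed

lemma Ck_on_sum:
  "finite I \<Longrightarrow> (\<And>i. i \<in> I \<Longrightarrow> Ck_on k E U (f i)) \<Longrightarrow> Ck_on k E U (\<lambda>x. \<Sum>i\<in>I. f i x)"
  by (induction I rule: finite_induct) (auto intro: Ck_on_const Ck_on_add)

lemma Ck_on_Pair: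
  assumes "Ck_on k E U f" "Ck_on k E U g" shows "Ck_on k E U (\<lambda>x. (f x, g x))"
  using assms
proof (induction k arbitrary: f g)
  case 0
  then show ?case by (simp add: continuous_on_Pair)
next
  case (Suc k)
  then obtain f' g' where "\<forall>x\<in>U. (f has_derivative f' x) (at x within U)"
    "\<forall>v\<in>E. Ck_on k E U (\<lambda>x. f' x v)" "\<forall>x\<in>U. (g has_derivative g' x) (at x within U)"
    "\<forall>v\<in>E. Ck_on k E U (\<lambda>x. g' x v)" by auto
  then show ?case
    unfolding Ck_on.simps
    by (intro exI[of _ "\<lambda>x v. (f' x v, g' x v)"]) (simp add: has_derivative_Pair Suc.IH)
qed

text \<open>The product rule contains \<open>f\<close> and \<open>g\<close> themselves next to their
  derivatives, so they are needed one level lower as well.\<close>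

lemma Ck_on_bilinear:
  assumes "bounded_bilinear B" "Ck_on k E U f" "Ck_on k E U g"
  shows "Ck_on k E U (\<lambda>x. B (f x) (g x))"
  using assms(2,3)
proof (induction k arbitrary: f g)
  case 0
  then show ?case using bounded_bilinear.continuous_on[OF assms(1)] by simp
next
  case (Suc k)
  then obtain f' g' where *: "\<forall>x\<in>U. (f has_derivative f' x) (at x within U)"
    "\<forall>v\<in>E. Ck_on k E U (\<lambda>x. f' x v)" "\<forall>x\<in>U. (g has_derivative g' x) (at x within U)"
    "\<forall>v\<in>E. Ck_on k E U (\<lambda>x. g' x v)" by auto
  moreover have "Ck_on k E U f" "Ck_on k E U g" using Suc.prems Ck_on_SucD by blast+
  ultimately show ?case
    unfolding Ck_on.simps
    by (intro exI[of _ "\<lambda>x v. B (f x) (g' x v) + B (f' x v) (g x)"])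
      (simp add: bounded_bilinear.FDERIV[OF assms(1)] Suc.IH Ck_on_add)
qed

text \<open>In \<open>f' (g x) (g' x v)\<close> both the base point and the direction depend on
  \<open>x\<close>. Writing the direction in a basis of \<open>F\<close> gives a finite sum of
  products of a coordinate of \<open>g' x v\<close> with \<open>f' (g x) b\<close> for fixed
  \<open>b\<close>, and the induction hypothesis covers the second factor. The finite dimension of
  the intermediate space enters here.\<close>

lemma Ck_on_compose:
  fixes g :: "'e::real_normed_vector \<Rightarrow> 'f::real_normed_vector"
  assumes fin: "finite_dimensional (UNIV :: 'f set)"
    and E: "subspace E" "openin (top_of_set E) U" and F: "subspace F" "V \<subseteq> F"
    and "Ck_on k F V f" "Ck_on k E U g" "g ` U \<subseteq> V"
  shows "Ck_on k E U (\<lambda>x. f (g x))"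
  using assms(6-8)
proof (induction k arbitrary: f)
  case 0
  then show ?case by (auto intro: continuous_on_compose2)
next
  case (Suc k)
  obtain f' where f': "\<forall>y\<in>V. (f has_derivative f' y) (at y within V)"
    "\<forall>w\<in>F. Ck_on k F V (\<lambda>y. f' y w)" using Suc.prems by auto
  obtain g' where g': "\<forall>x\<in>U. (g has_derivative g' x) (at x within U)"
    "\<forall>v\<in>E. Ck_on k E U (\<lambda>x. g' x v)" using Suc.prems by auto
  obtain B c where B: "finite B" "B \<subseteq> F" "\<And>b. bounded_linear (c b :: 'f \<Rightarrow> real)"
    "\<And>x. x \<in> F \<Longrightarrow> (\<Sum>b\<in>B. c b x *\<^sub>R b) = x"
    by (rule finite_dimensional_subspace_basis[OF fin F(1)], rule that)
  have "((\<lambda>x. f (g x)) has_derivative (\<lambda>v. f' (g x) (g' x v))) (at x within U)" if "x \<in> U" for x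
    by (rule has_derivative_in_compose2[OF _ Suc.prems(3) that]) (use f'(1) g'(1) that in blast)+
  moreover have "Ck_on k E U (\<lambda>x. f' (g x) (g' x v))" if v: "v \<in> E" for v
  proof (rule Ck_on_cong)
    show "Ck_on k E U (\<lambda>x. \<Sum>b\<in>B. c b (g' x v) *\<^sub>R f' (g x) b)"
    proof (intro Ck_on_sum B Ck_on_bilinear[OF bounded_bilinear_scaleR] Ck_on_bounded_linear[OF B(3)])
      show "Ck_on k E U (\<lambda>x. g' x v)" using g' v by blast
      fix b assume "b \<in> B"
      then show "Ck_on k E U (\<lambda>x. f' (g x) b)"
        using f'(2) B(2) Suc.prems(3) Ck_on_SucD[OF Suc.prems(2)] by (intro Suc.IH) auto
    qed
    fix x assume x: "x \<in> U"
    \<comment> \<open>The basis expansion is valid only on \<open>F\<close>; since \<open>g\<close>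
      maps \<open>U\<close> into \<open>F\<close>, its derivatives in directions of \<open>E\<close>
      stay there.\<close>
    have "g' x v \<in> F"
      using has_derivative_in_closed_subspace[OF g'(1)[rule_format, OF x] x E(2,1) v
          finite_dimensional_subspace_closed[OF fin F(1)] F(1) order_trans[OF Suc.prems(3) F(2)]] .
    then have "f' (g x) (g' x v) = f' (g x) (\<Sum>b\<in>B. c b (g' x v) *\<^sub>R b)" using B(4) by simp
    also have "\<dots> = (\<Sum>b\<in>B. c b (g' x v) *\<^sub>R f' (g x) b)"
    proof -
      have "g x \<in> V" using x Suc.prems(3) by blast
      then have "linear (f' (g x))" using f'(1) has_derivative_linear by blast
      then show ?thesis by (simp add: linear_sum linear_scale)
    qed
    finally show "f' (g x) (g' x v) = (\<Sum>b\<in>B. c b (g' x v) *\<^sub>R f' (g x) b)" .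
  qed
  ultimately show ?case
    unfolding Ck_on.simps by (intro exI[of _ "\<lambda>x v. f' (g x) (g' x v)"]) simp
qed

lemma smooth_on_subset: "smooth_on E U f \<Longrightarrow> V \<subseteq> U \<Longrightarrow> smooth_on E V f"
  using Ck_on_subset unfolding smooth_on_def by blast

lemma smooth_on_cong: "smooth_on E U f \<Longrightarrow> (\<And>x. x \<in> U \<Longrightarrow> g x = f x) \<Longrightarrow> smooth_on E U g"
  using Ck_on_cong unfolding smooth_on_def by blast

lemma smooth_on_local:
  assumes "subspace E" "U \<subseteq> E"
    and "\<And>x. x \<in> U \<Longrightarrow> \<exists>V. openin (top_of_set E) V \<and> x \<in> V \<and> V \<subseteq> U \<and> smooth_on E V f"
  shows "smooth_on E U f"
  unfolding smooth_on_def
proof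
  show "Ck_on k E U f" for k
    using assms(3) unfolding smooth_on_def by (intro Ck_on_local[OF assms(1,2)]) blast
qed

lemma smooth_on_const: "smooth_on E U (\<lambda>_. c)"
  by (simp add: smooth_on_def Ck_on_const)

lemma smooth_on_ident: "smooth_on E U (\<lambda>x. x)"
  by (simp add: smooth_on_def Ck_on_ident)

lemma smooth_on_bounded_linear:
  "bounded_linear L \<Longrightarrow> smooth_on E U f \<Longrightarrow> smooth_on E U (\<lambda>x. L (f x))"
  by (simp add: smooth_on_def Ck_on_bounded_linear)

lemma smooth_on_Pair:
  "smooth_on E U f \<Longrightarrow> smooth_on E U g \<Longrightarrow> smooth_on E U (\<lambda>x. (f x, g x))"
  by (simp add: smooth_on_def Ck_on_Pair)

lemma smooth_on_add:
  "smooth_on E U f \<Longrightarrow> smooth_on E U g \<Longrightarrow> smooth_on E U (\<lambda>x. f x + g x)"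
  by (simp add: smooth_on_def Ck_on_add)

lemma smooth_on_bilinear:
  "bounded_bilinear B \<Longrightarrow> smooth_on E U f \<Longrightarrow> smooth_on E U g \<Longrightarrow> smooth_on E U (\<lambda>x. B (f x) (g x))"
  by (simp add: smooth_on_def Ck_on_bilinear)

lemma smooth_on_compose:
  fixes g :: "'e::real_normed_vector \<Rightarrow> 'f::real_normed_vector"
  assumes "finite_dimensional (UNIV :: 'f set)"
    and "subspace E" "openin (top_of_set E) U" "subspace F" "V \<subseteq> F"
    and "smooth_on F V f" "smooth_on E U g" "g ` U \<subseteq> V"
  shows "smooth_on E U (\<lambda>x. f (g x))"
  using Ck_on_compose[OF assms(1-5) _ _ assms(8)] assms(6,7) unfolding smooth_on_def by blast

subsection \<open>Smooth maps between manifolds\<close>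

lemma manifoldD:
  assumes "smooth_manifold (M :: ('a, 'e::real_normed_vector) manifold)"
  shows "finite_dimensional (UNIV :: 'e set)" "subspace (model M)"
    "Hausdorff_space (mtop M)" "second_countable (mtop M)"
    "(\<Union>c\<in>atlas M. fst c) = topspace (mtop M)"
  using assms unfolding smooth_manifold_def by auto

lemma chartD:
  assumes "smooth_manifold M" "c \<in> atlas M"
  shows "openin (mtop M) (fst c)" "openin (top_of_set (model M)) (snd c ` fst c)"
    "homeomorphic_map (subtopology (mtop M) (fst c)) (top_of_set (snd c ` fst c)) (snd c)"
proof -
  have "\<forall>(U, \<phi>)\<in>atlas M. openin (mtop M) U \<and> openin (top_of_set (model M)) (\<phi> ` U) \<and>
        homeomorphic_map (subtopology (mtop M) U) (top_of_set (\<phi> ` U)) \<phi>"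
    using assms(1) unfolding smooth_manifold_def by blast
  then show "openin (mtop M) (fst c)" "openin (top_of_set (model M)) (snd c ` fst c)"
    "homeomorphic_map (subtopology (mtop M) (fst c)) (top_of_set (snd c ` fst c)) (snd c)"
    using assms(2) by (auto simp: split_beta)
qed

lemma manifold_transition:
  "smooth_manifold M \<Longrightarrow> c \<in> atlas M \<Longrightarrow> d \<in> atlas M \<Longrightarrow>
    smooth_on (model M) (coord_dom id c d) (coord_rep id c d)"
  unfolding smooth_manifold_def by blast

lemma chart_subset: "smooth_manifold M \<Longrightarrow> c \<in> atlas M \<Longrightarrow> fst c \<subseteq> topspace (mtop M)"
  using chartD(1) openin_subset by blast

lemma chart_inj:
  assumes "smooth_manifold M" "c \<in> atlas M" shows "inj_on (snd c) (fst c)"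
  using homeomorphic_imp_injective_map[OF chartD(3)[OF assms]] chart_subset[OF assms]
  by (simp add: Int_absorb1)

lemma chart_inv:
  "smooth_manifold M \<Longrightarrow> c \<in> atlas M \<Longrightarrow> p \<in> fst c \<Longrightarrow> inv_into (fst c) (snd c) (snd c p) = p"
  by (simp add: chart_inj)

lemma chart_image_subset:
  "smooth_manifold M \<Longrightarrow> c \<in> atlas M \<Longrightarrow> snd c ` fst c \<subseteq> model M"
  using chartD(2) openin_imp_subset by blast

lemma chart_image_openin:
  assumes M: "smooth_manifold M" "c \<in> atlas M" and W: "openin (mtop M) W" "W \<subseteq> fst c"
  shows "openin (top_of_set (model M)) (snd c ` W)"
proof -
  have "openin (subtopology (mtop M) (fst c)) W"
    using W chartD(1)[OF M] by (simp add: openin_open_subtopology)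
  then have "openin (top_of_set (snd c ` fst c)) (snd c ` W)"
    using homeomorphic_imp_open_map[OF chartD(3)[OF M]] by (simp add: open_map_def)
  then show ?thesis using chartD(2)[OF M] by (rule openin_trans)
qed

lemma chart_covers:
  assumes "smooth_manifold M" "p \<in> topspace (mtop M)"
  obtains c where "c \<in> atlas M" "p \<in> fst c"
  using manifoldD(5)[OF assms(1)] assms(2) by blast

lemma openin_coord_preimage:
  assumes M: "smooth_manifold M" "c \<in> atlas M" and "openin (mtop N) (fst d)"
    and f: "continuous_map (mtop M) (mtop N) f"
  shows "openin (mtop M) {p \<in> fst c. f p \<in> fst d}"
proof -
  have "openin (mtop M) {p \<in> topspace (mtop M). f p \<in> fst d}"
    by (rule openin_continuous_map_preimage[OF f assms(3)])
  moreover have "{p \<in> fst c. f p \<in> fst d} = fst c \<inter> {p \<in> topspace (mtop M). f p \<in> fst d}"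
    using chart_subset[OF M] by blast
  ultimately show ?thesis using chartD(1)[OF M] by (simp add: openin_Int)
qed

lemma openin_coord_dom:
  assumes "smooth_manifold M" "c \<in> atlas M" "smooth_manifold N" "d \<in> atlas N"
    and "continuous_map (mtop M) (mtop N) f"
  shows "openin (top_of_set (model M)) (coord_dom f c d)"
  unfolding coord_dom_def
  by (intro chart_image_openin[OF assms(1,2)] openin_coord_preimage[OF assms(1,2) chartD(1)[OF assms(3,4)] assms(5)]) blast

lemma coord_rep_chart:
  assumes "smooth_manifold M" "c \<in> atlas M" "p \<in> fst c"
  shows "coord_rep f c d (snd c p) = snd d (f p)"
  by (simp add: coord_rep_def chart_inv[OF assms])

lemma smooth_mapD:
  assumes "smooth_map M N f"
  shows "continuous_map (mtop M) (mtop N) f"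
    and "c \<in> atlas M \<Longrightarrow> d \<in> atlas N \<Longrightarrow> smooth_on (model M) (coord_dom f c d) (coord_rep f c d)"
  using assms unfolding smooth_map_def by auto

lemma smooth_map_in_topspace:
  "smooth_map M N f \<Longrightarrow> p \<in> topspace (mtop M) \<Longrightarrow> f p \<in> topspace (mtop N)"
  using smooth_mapD(1) continuous_map_funspace by fastforce

text \<open>A composite passes through an intermediate chart that depends on the point, so its
  coordinate expression can be handled only near one point at a time.\<close>

lemma smooth_map_localI:
  assumes M: "smooth_manifold M" and f: "continuous_map (mtop M) (mtop N) f"
    and loc: "\<And>c d p. c \<in> atlas M \<Longrightarrow> d \<in> atlas N \<Longrightarrow> p \<in> fst c \<Longrightarrow> f p \<in> fst d \<Longrightarrow>
      \<exists>W. openin (mtop M) W \<and> p \<in> W \<and> W \<subseteq> fst c \<and> f ` W \<subseteq> fst d \<and>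
        smooth_on (model M) (snd c ` W) (coord_rep f c d)"
  shows "smooth_map M N f"
  unfolding smooth_map_def
proof (intro conjI f ballI)
  fix c d assume c: "c \<in> atlas M" and d: "d \<in> atlas N"
  show "smooth_on (model M) (coord_dom f c d) (coord_rep f c d)"
  proof (rule smooth_on_local[OF manifoldD(2)[OF M]])
    show "coord_dom f c d \<subseteq> model M"
      using chart_image_subset[OF M c] by (auto simp: coord_dom_def)
    fix x assume "x \<in> coord_dom f c d"
    then obtain p where p: "p \<in> fst c" "f p \<in> fst d" "x = snd c p" by (auto simp: coord_dom_def)
    then obtain W where W: "openin (mtop M) W" "p \<in> W" "W \<subseteq> fst c" "f ` W \<subseteq> fst d"
        "smooth_on (model M) (snd c ` W) (coord_rep f c d)"
      using loc[OF c d p(1,2)] by blast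
    show "\<exists>V. openin (top_of_set (model M)) V \<and> x \<in> V \<and> V \<subseteq> coord_dom f c d \<and>
        smooth_on (model M) V (coord_rep f c d)"
    proof (intro exI[of _ "snd c ` W"] conjI)
      show "snd c ` W \<subseteq> coord_dom f c d" using W(3,4) by (auto simp: coord_dom_def)
    qed (use W p chart_image_openin[OF M c] in auto)
  qed
qed

lemma smooth_map_cong:
  assumes M: "smooth_manifold M" and f: "smooth_map M N f"
    and eq: "\<And>p. p \<in> topspace (mtop M) \<Longrightarrow> g p = f p"
  shows "smooth_map M N g"
  unfolding smooth_map_def
proof (intro conjI ballI)
  show "continuous_map (mtop M) (mtop N) g"
    using smooth_mapD(1)[OF f] eq by (auto intro: continuous_map_eq)
  fix c d assume c: "c \<in> atlas M" and d: "d \<in> atlas N"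
  have eqc: "g p = f p" if "p \<in> fst c" for p using that chart_subset[OF M c] eq by blast
  then have dom: "coord_dom g c d = coord_dom f c d" unfolding coord_dom_def by auto
  show "smooth_on (model M) (coord_dom g c d) (coord_rep g c d)"
    unfolding dom
  proof (rule smooth_on_cong[OF smooth_mapD(2)[OF f c d]])
    fix x assume "x \<in> coord_dom f c d"
    then obtain p where "p \<in> fst c" "x = snd c p" by (auto simp: coord_dom_def)
    then show "coord_rep g c d x = coord_rep f c d x" using eqc by (simp add: coord_rep_chart[OF M c])
  qed
qed

text \<open>Composition uses the model of the intermediate \<open>N\<close> in the chain rule, but
  from \<open>K\<close> only that preimages of chart domains are open. In this form the statement
  also applies when \<open>K\<close> is a space of operators, as for \<open>\<Psi>0\<close> and
  \<open>\<Psi>1\<close>.\<close>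

lemma smooth_map_compose_into_open_charts:
  assumes M: "smooth_manifold M" and N: "smooth_manifold N"
    and K: "\<And>d. d \<in> atlas K \<Longrightarrow> openin (mtop K) (fst d)"
    and f: "smooth_map M N f" and g: "smooth_map N K g"
  shows "smooth_map M K (\<lambda>p. g (f p))"
proof (rule smooth_map_localI[OF M])
  show cont: "continuous_map (mtop M) (mtop K) (\<lambda>p. g (f p))"
    using continuous_map_compose[OF smooth_mapD(1)[OF f] smooth_mapD(1)[OF g]] by (simp add: o_def)
  fix c d p assume c: "c \<in> atlas M" and d: "d \<in> atlas K" and p: "p \<in> fst c" "g (f p) \<in> fst d"
  have "f p \<in> topspace (mtop N)" using smooth_map_in_topspace[OF f] chart_subset[OF M c] p by blast
  then obtain e where e: "e \<in> atlas N" "f p \<in> fst e" by (rule chart_covers[OF N])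
  define W where "W = {q \<in> fst c. f q \<in> fst e} \<inter> {q \<in> fst c. g (f q) \<in> fst d}"
  have W: "openin (mtop M) W"
    unfolding W_def using openin_coord_preimage[OF M c chartD(1)[OF N e(1)] smooth_mapD(1)[OF f]]
      openin_coord_preimage[OF M c K[OF d] cont] by (rule openin_Int)
  have Wc: "W \<subseteq> fst c" unfolding W_def by blast
  have "smooth_on (model M) (snd c ` W) (\<lambda>x. coord_rep g e d (coord_rep f c e x))"
  proof (rule smooth_on_compose[OF manifoldD(1)[OF N] manifoldD(2)[OF M] chart_image_openin[OF M c W Wc]
        manifoldD(2)[OF N] _ smooth_mapD(2)[OF g e(1) d]])
    show "coord_dom g e d \<subseteq> model N"
      using chart_image_subset[OF N e(1)] by (auto simp: coord_dom_def)
    show "smooth_on (model M) (snd c ` W) (coord_rep f c e)"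
      by (rule smooth_on_subset[OF smooth_mapD(2)[OF f c e(1)]]) (auto simp: coord_dom_def W_def)
    show "coord_rep f c e ` snd c ` W \<subseteq> coord_dom g e d"
    proof (intro image_subsetI, elim imageE)
      fix x q assume q: "x = snd c q" "q \<in> W"
      then have "coord_rep f c e x = snd e (f q)" "f q \<in> fst e" "g (f q) \<in> fst d"
        using coord_rep_chart[OF M c, of q f e] by (auto simp: W_def)
      then show "coord_rep f c e x \<in> coord_dom g e d" by (simp add: coord_dom_def)
    qed
  qed
  then have "smooth_on (model M) (snd c ` W) (coord_rep (\<lambda>p. g (f p)) c d)"
  proof (rule smooth_on_cong)
    fix x assume "x \<in> snd c ` W"
    then obtain q where q: "x = snd c q" "q \<in> fst c" "f q \<in> fst e" by (auto simp: W_def)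
    then show "coord_rep (\<lambda>p. g (f p)) c d x = coord_rep g e d (coord_rep f c e x)"
      by (simp add: coord_rep_chart[OF M c] coord_rep_chart[OF N e(1)])
  qed
  then show "\<exists>W. openin (mtop M) W \<and> p \<in> W \<and> W \<subseteq> fst c \<and> (\<lambda>p. g (f p)) ` W \<subseteq> fst d \<and>
      smooth_on (model M) (snd c ` W) (coord_rep (\<lambda>p. g (f p)) c d)"
    using W Wc e(2) p by (intro exI[of _ W]) (auto simp: W_def)
qed

lemma smooth_map_compose:
  assumes "smooth_manifold M" "smooth_manifold N" "smooth_manifold K" "smooth_map M N f" "smooth_map N K g"
  shows "smooth_map M K (\<lambda>p. g (f p))"
  using smooth_map_compose_into_open_charts[OF assms(1,2) chartD(1)[OF assms(3)] assms(4,5)] by simp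

text \<open>As the atlas need not be maximal, this is the compatibility of its charts.\<close>

lemma smooth_map_ident: "smooth_manifold M \<Longrightarrow> smooth_map M M (\<lambda>p. p)"
  using manifold_transition[of M] unfolding smooth_map_def id_def by simp

lemma smooth_map_const:
  assumes "q \<in> topspace (mtop N)" shows "smooth_map M N (\<lambda>_. q)"
  unfolding smooth_map_def using assms by (simp add: coord_rep_def o_def smooth_on_const)

section \<open>Products of manifolds\<close>

lemma model_product [simp]: "model (product_manifold M N) = model M \<times> model N"
  and mtop_product [simp]: "mtop (product_manifold M N) = prod_topology (mtop M) (mtop N)"
  by (simp_all add: product_manifold_def)

lemma atlas_product:
  "c \<in> atlas (product_manifold M N) \<longleftrightarrow>
    (\<exists>a\<in>atlas M. \<exists>b\<in>atlas N. c = (fst a \<times> fst b, map_prod (snd a) (snd b)))"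
  by (auto simp: product_manifold_def) force+

lemma inv_into_map_prod:
  assumes "inj_on f A" "inj_on g B" "p \<in> A" "q \<in> B"
  shows "inv_into (A \<times> B) (map_prod f g) (f p, g q) = (p, q)"
  using inv_into_f_f[OF map_prod_inj_on[OF assms(1,2)], of "(p, q)"] assms(3,4) by simp

lemma smooth_on_fst:
  fixes f :: "'e::real_normed_vector \<Rightarrow> 'g::real_normed_vector" and F :: "'f::real_normed_vector set"
  assumes fin: "finite_dimensional (UNIV :: 'e set)" and "subspace E" "subspace F"
    and "openin (top_of_set E) U" "openin (top_of_set F) V" "smooth_on E U f"
  shows "smooth_on (E \<times> F) (U \<times> V) (\<lambda>x. f (fst x))"
proof (rule smooth_on_compose[OF fin _ _ assms(2) openin_imp_subset[OF assms(4)] assms(6)])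
  show "openin (top_of_set (E \<times> F)) (U \<times> V)"
    using assms by (simp add: openin_Times)
qed (use assms in \<open>auto simp: subspace_Times intro: smooth_on_bounded_linear[OF bounded_linear_fst smooth_on_ident]\<close>)

lemma smooth_on_snd:
  fixes f :: "'f::real_normed_vector \<Rightarrow> 'g::real_normed_vector" and E :: "'e::real_normed_vector set"
  assumes fin: "finite_dimensional (UNIV :: 'f set)" and "subspace E" "subspace F"
    and "openin (top_of_set E) U" "openin (top_of_set F) V" "smooth_on F V f"
  shows "smooth_on (E \<times> F) (U \<times> V) (\<lambda>x. f (snd x))"
proof (rule smooth_on_compose[OF fin _ _ assms(3) openin_imp_subset[OF assms(5)] assms(6)])
  show "openin (top_of_set (E \<times> F)) (U \<times> V)"
    using assms by (simp add: openin_Times)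
qed (use assms in \<open>auto simp: subspace_Times intro: smooth_on_bounded_linear[OF bounded_linear_snd smooth_on_ident]\<close>)

lemma smooth_manifold_product:
  assumes M: "smooth_manifold (M :: ('a, 'e::real_normed_vector) manifold)"
    and N: "smooth_manifold (N :: ('b, 'f::real_normed_vector) manifold)"
  shows "smooth_manifold (product_manifold M N)"
  unfolding smooth_manifold_def
proof (intro conjI)
  let ?P = "product_manifold M N"
  show "finite_dimensional (UNIV :: ('e \<times> 'f) set)"
    by (rule finite_dimensional_Times[OF manifoldD(1)[OF M] manifoldD(1)[OF N]])
  show "subspace (model ?P)"
    using manifoldD(2)[OF M] manifoldD(2)[OF N] by (simp add: subspace_Times)
  show "Hausdorff_space (mtop ?P)"
    using manifoldD(3)[OF M] manifoldD(3)[OF N] by (simp add: Hausdorff_space_prod_topology)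
  show "second_countable (mtop ?P)"
    using manifoldD(4)[OF M] manifoldD(4)[OF N] by (simp add: second_countable_prod_topology)
  show "(\<Union>c\<in>atlas ?P. fst c) = topspace (mtop ?P)"
    unfolding mtop_product topspace_prod_topology
      manifoldD(5)[OF M, symmetric] manifoldD(5)[OF N, symmetric]
    by (fastforce simp: atlas_product)
  show "\<forall>(U, \<phi>)\<in>atlas ?P. openin (mtop ?P) U \<and> openin (top_of_set (model ?P)) (\<phi> ` U) \<and>
      homeomorphic_map (subtopology (mtop ?P) U) (top_of_set (\<phi> ` U)) \<phi>"
  proof safe
    fix U \<phi> assume "(U, \<phi>) \<in> atlas ?P"
    then obtain a b where a: "a \<in> atlas M" and b: "b \<in> atlas N"
      and U: "U = fst a \<times> fst b" and \<phi>: "\<phi> = map_prod (snd a) (snd b)"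
      by (auto simp: atlas_product)
    have im: "\<phi> ` U = snd a ` fst a \<times> snd b ` fst b"
      unfolding U \<phi> by (rule map_prod_surj_on[OF refl refl])
    show "openin (mtop ?P) U"
      unfolding U using chartD(1)[OF M a] chartD(1)[OF N b] by (simp add: openin_prod_Times_iff)
    show "openin (top_of_set (model ?P)) (\<phi> ` U)"
      unfolding im using chartD(2)[OF M a] chartD(2)[OF N b] by (simp add: openin_Times)
    obtain a' where a': "homeomorphic_maps (subtopology (mtop M) (fst a)) (top_of_set (snd a ` fst a)) (snd a) a'"
      using chartD(3)[OF M a] by (auto simp: homeomorphic_map_maps)
    obtain b' where b': "homeomorphic_maps (subtopology (mtop N) (fst b)) (top_of_set (snd b ` fst b)) (snd b) b'"
      using chartD(3)[OF N b] by (auto simp: homeomorphic_map_maps)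
    have "homeomorphic_maps
        (prod_topology (subtopology (mtop M) (fst a)) (subtopology (mtop N) (fst b)))
        (prod_topology (top_of_set (snd a ` fst a)) (top_of_set (snd b ` fst b)))
        (\<lambda>(x, y). (snd a x, snd b y)) (\<lambda>(x, y). (a' x, b' y))"
      unfolding homeomorphic_maps_prod using a' b' by blast
    then show "homeomorphic_map (subtopology (mtop ?P) U) (top_of_set (\<phi> ` U)) \<phi>"
      unfolding homeomorphic_map_maps im unfolding U \<phi> map_prod_def
      by (auto simp: subtopology_Times)
  qed
  show "\<forall>c\<in>atlas ?P. \<forall>d\<in>atlas ?P. smooth_on (model ?P) (coord_dom id c d) (coord_rep id c d)"
  proof (intro ballI)
    fix c d assume "c \<in> atlas ?P" "d \<in> atlas ?P"
    then obtain a b a' b' where a: "a \<in> atlas M" "a' \<in> atlas M" and b: "b \<in> atlas N" "b' \<in> atlas N"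
      and c: "c = (fst a \<times> fst b, map_prod (snd a) (snd b))"
      and d: "d = (fst a' \<times> fst b', map_prod (snd a') (snd b'))"
      by (auto simp: atlas_product)
    \<comment> \<open>A point lies in both product charts iff each component does, so the transition
      map can be treated one factor at a time.\<close>
    have dom: "coord_dom id c d = coord_dom id a a' \<times> coord_dom id b b'"
      unfolding c d coord_dom_def by (auto simp: image_iff)
    have "continuous_map (mtop M) (mtop M) id" "continuous_map (mtop N) (mtop N) id" by auto
    note o = openin_coord_dom[OF M a(1) M a(2) this(1)] openin_coord_dom[OF N b(1) N b(2) this(2)]
    have "smooth_on (model ?P) (coord_dom id c d)
        (\<lambda>x. (coord_rep id a a' (fst x), coord_rep id b b' (snd x)))"
      unfolding dom model_product
      using manifoldD(1,2)[OF M] manifoldD(1,2)[OF N] o manifold_transition[OF M a] manifold_transition[OF N b]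
      by (intro smooth_on_Pair smooth_on_fst smooth_on_snd)
    then show "smooth_on (model ?P) (coord_dom id c d) (coord_rep id c d)"
    proof (rule smooth_on_cong)
      fix x assume "x \<in> coord_dom id c d"
      then obtain p q where x: "x = (snd a p, snd b q)" and pq: "p \<in> fst a" "q \<in> fst b"
        by (auto simp: coord_dom_def c)
      show "coord_rep id c d x = (coord_rep id a a' (fst x), coord_rep id b b' (snd x))"
        using pq coord_rep_chart[OF M a(1) pq(1), of id a'] coord_rep_chart[OF N b(1) pq(2), of id b']
          inv_into_map_prod[OF chart_inj[OF M a(1)] chart_inj[OF N b(1)] pq]
        by (simp add: x) (simp add: coord_rep_def c d)
    qed
  qed
qed

text \<open>In product charts the projection is a transition map of \<open>M\<close> after
  \<open>fst\<close>, so compatibility of charts gives smoothness.\<close>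

lemma smooth_map_fst:
  assumes M: "smooth_manifold M" and N: "smooth_manifold N"
  shows "smooth_map (product_manifold M N) M fst"
  unfolding smooth_map_def
proof (intro conjI ballI)
  show "continuous_map (mtop (product_manifold M N)) (mtop M) fst" by (simp add: continuous_map_fst)
  fix c d assume "c \<in> atlas (product_manifold M N)" and d: "d \<in> atlas M"
  then obtain a b where a: "a \<in> atlas M" and b: "b \<in> atlas N"
    and c: "c = (fst a \<times> fst b, map_prod (snd a) (snd b))" by (auto simp: atlas_product)
  have dom: "coord_dom fst c d = coord_dom id a d \<times> snd b ` fst b"
    unfolding c coord_dom_def by (auto simp: image_iff)
  have "smooth_on (model M \<times> model N) (coord_dom fst c d) (\<lambda>x. coord_rep id a d (fst x))"
    unfolding dom
    by (intro smooth_on_fst[OF manifoldD(1)[OF M] manifoldD(2)[OF M] manifoldD(2)[OF N]]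
        openin_coord_dom[OF M a M d] chartD(2)[OF N b] manifold_transition[OF M a d]) simp
  then have "smooth_on (model M \<times> model N) (coord_dom fst c d) (coord_rep fst c d)"
  proof (rule smooth_on_cong)
    fix x assume "x \<in> coord_dom fst c d"
    then obtain p q where x: "x = (snd a p, snd b q)" and pq: "p \<in> fst a" "q \<in> fst b"
      by (auto simp: coord_dom_def c)
    show "coord_rep fst c d x = coord_rep id a d (fst x)"
      using coord_rep_chart[OF M a pq(1), of id d]
        inv_into_map_prod[OF chart_inj[OF M a] chart_inj[OF N b] pq]
      by (simp add: x) (simp add: coord_rep_def c)
  qed
  then show "smooth_on (model (product_manifold M N)) (coord_dom fst c d) (coord_rep fst c d)" by simp
qed

lemma smooth_map_snd:
  assumes M: "smooth_manifold M" and N: "smooth_manifold N"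
  shows "smooth_map (product_manifold M N) N snd"
  unfolding smooth_map_def
proof (intro conjI ballI)
  show "continuous_map (mtop (product_manifold M N)) (mtop N) snd" by (simp add: continuous_map_snd)
  fix c d assume "c \<in> atlas (product_manifold M N)" and d: "d \<in> atlas N"
  then obtain a b where a: "a \<in> atlas M" and b: "b \<in> atlas N"
    and c: "c = (fst a \<times> fst b, map_prod (snd a) (snd b))" by (auto simp: atlas_product)
  have dom: "coord_dom snd c d = snd a ` fst a \<times> coord_dom id b d"
    unfolding c coord_dom_def by (auto simp: image_iff)
  have "smooth_on (model M \<times> model N) (coord_dom snd c d) (\<lambda>x. coord_rep id b d (snd x))"
    unfolding dom
    by (intro smooth_on_snd[OF manifoldD(1)[OF N] manifoldD(2)[OF M] manifoldD(2)[OF N]]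
        openin_coord_dom[OF N b N d] chartD(2)[OF M a] manifold_transition[OF N b d]) simp
  then have "smooth_on (model M \<times> model N) (coord_dom snd c d) (coord_rep snd c d)"
  proof (rule smooth_on_cong)
    fix x assume "x \<in> coord_dom snd c d"
    then obtain p q where x: "x = (snd a p, snd b q)" and pq: "p \<in> fst a" "q \<in> fst b"
      by (auto simp: coord_dom_def c)
    show "coord_rep snd c d x = coord_rep id b d (snd x)"
      using coord_rep_chart[OF N b pq(2), of id d]
        inv_into_map_prod[OF chart_inj[OF M a] chart_inj[OF N b] pq]
      by (simp add: x) (simp add: coord_rep_def c)
  qed
  then show "smooth_on (model (product_manifold M N)) (coord_dom snd c d) (coord_rep snd c d)" by simp
qed

lemma smooth_map_Pair:
  assumes f: "smooth_map M N f" and g: "smooth_map M K g"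
  shows "smooth_map M (product_manifold N K) (\<lambda>p. (f p, g p))"
  unfolding smooth_map_def
proof (intro conjI ballI)
  show "continuous_map (mtop M) (mtop (product_manifold N K)) (\<lambda>p. (f p, g p))"
    using smooth_mapD(1)[OF f] smooth_mapD(1)[OF g] by (simp add: continuous_map_pairedI)
  fix c d assume c: "c \<in> atlas M" and "d \<in> atlas (product_manifold N K)"
  then obtain a b where a: "a \<in> atlas N" and b: "b \<in> atlas K"
    and d: "d = (fst a \<times> fst b, map_prod (snd a) (snd b))" by (auto simp: atlas_product)
  have "coord_dom (\<lambda>p. (f p, g p)) c d \<subseteq> coord_dom f c a"
    "coord_dom (\<lambda>p. (f p, g p)) c d \<subseteq> coord_dom g c b"
    unfolding coord_dom_def d by auto
  then have "smooth_on (model M) (coord_dom (\<lambda>p. (f p, g p)) c d) (\<lambda>x. (coord_rep f c a x, coord_rep g c b x))"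
    by (intro smooth_on_Pair smooth_on_subset[OF smooth_mapD(2)[OF f c a]]
        smooth_on_subset[OF smooth_mapD(2)[OF g c b]])
  then show "smooth_on (model M) (coord_dom (\<lambda>p. (f p, g p)) c d) (coord_rep (\<lambda>p. (f p, g p)) c d)"
    by (rule smooth_on_cong) (simp add: coord_rep_def d)
qed

section \<open>Smooth maps into vector spaces\<close>

lemma open_manifold_simps [simp]:
  "mtop (open_manifold E U) = top_of_set U" "model (open_manifold E U) = E"
  "atlas (open_manifold E U) = {(U, id)}"
  by (simp_all add: open_manifold_def)

lemma smooth_manifold_vector:
  assumes "finite_dimensional (UNIV :: 'v::real_normed_vector set)"
  shows "smooth_manifold (vector_manifold :: ('v, 'v) manifold)"
  unfolding smooth_manifold_def
  using assms second_countable_finite_dimensional[OF assms]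
  by (simp add: coord_rep_def coord_dom_def homeomorphic_map_id[unfolded id_def] id_def o_def smooth_on_ident)

text \<open>The identity is a single global chart, so coordinates enter only on the side of
  \<open>M\<close>, and pointwise operations on \<open>f\<close> are pointwise operations on its
  coordinate expression.\<close>

lemma smooth_map_vector_iff:
  "smooth_map M (vector_manifold :: ('v::real_normed_vector, 'v) manifold) f \<longleftrightarrow>
    continuous_map (mtop M) euclidean f \<and>
    (\<forall>c\<in>atlas M. smooth_on (model M) (snd c ` fst c) (\<lambda>x. f (inv_into (fst c) (snd c) x)))"
  by (simp add: smooth_map_def coord_dom_def coord_rep_def o_def)

text \<open>The representation takes values in an open part \<open>U\<close> of a linear space
  \<open>E\<close> of operators, whereas evaluation and projections are defined on the full space.
  Only the model of the source enters \<open>smooth_on\<close>, so \<open>E\<close> can be exchanged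
  for \<open>UNIV\<close>.\<close>

lemma smooth_map_into_open_imp_vector:
  assumes M: "smooth_manifold M" and f: "smooth_map M (open_manifold E U) f"
  shows "smooth_map M vector_manifold f"
  unfolding smooth_map_vector_iff
proof (intro conjI ballI)
  have cont: "continuous_map (mtop M) (top_of_set U) f" using smooth_mapD(1)[OF f] by simp
  then show "continuous_map (mtop M) euclidean f"
    by (rule continuous_map_into_fulltopology)
  fix c assume c: "c \<in> atlas M"
  have "smooth_on (model M) (coord_dom f c (U, id)) (coord_rep f c (U, id))"
    using smooth_mapD(2)[OF f c] by simp
  moreover have "f p \<in> U" if "p \<in> fst c" for p
    using continuous_map_image_subset_topspace[OF cont] that chart_subset[OF M c] by auto
  then have "coord_dom f c (U, id) = snd c ` fst c" unfolding coord_dom_def by auto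
  ultimately show "smooth_on (model M) (snd c ` fst c) (\<lambda>x. f (inv_into (fst c) (snd c) x))"
    by (simp add: coord_rep_def o_def)
qed

lemma continuous_map_bounded_bilinear:
  assumes "bounded_bilinear B" "continuous_map X euclidean f" "continuous_map X euclidean g"
  shows "continuous_map X euclidean (\<lambda>x. B (f x) (g x))"
proof -
  have "continuous_map X (prod_topology euclidean euclidean) (\<lambda>x. (f x, g x))"
    using assms(2,3) by (rule continuous_map_pairedI)
  then have "continuous_map X euclidean (\<lambda>x. (f x, g x))" by simp
  moreover have "continuous_map euclidean euclidean (\<lambda>p. B (fst p) (snd p))"
    using bounded_bilinear.continuous_on[OF assms(1) continuous_on_fst[OF continuous_on_id]
        continuous_on_snd[OF continuous_on_id]] by simp
  ultimately have "continuous_map X euclidean ((\<lambda>p. B (fst p) (snd p)) \<circ> (\<lambda>x. (f x, g x)))"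
    by (rule continuous_map_compose)
  then show ?thesis by (simp add: o_def)
qed

lemma smooth_map_bilinear:
  assumes "bounded_bilinear B" "smooth_map M vector_manifold f" "smooth_map M vector_manifold g"
  shows "smooth_map M vector_manifold (\<lambda>p. B (f p) (g p))"
  using assms(2,3) unfolding smooth_map_vector_iff
  by (intro conjI ballI continuous_map_bounded_bilinear[OF assms(1)] smooth_on_bilinear[OF assms(1)]) auto

lemma smooth_map_bounded_linear:
  assumes "bounded_linear L" "smooth_map M vector_manifold f"
  shows "smooth_map M vector_manifold (\<lambda>p. L (f p))"
proof -
  have "continuous_map euclidean euclidean L"
    using linear_continuous_on[OF assms(1)] by simp
  then have "continuous_map (mtop M) euclidean (\<lambda>p. L (f p))"
    using assms(2) continuous_map_compose[of "mtop M" euclidean f euclidean L]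
    unfolding smooth_map_vector_iff o_def by blast
  then show ?thesis
    using assms(2) unfolding smooth_map_vector_iff
    by (intro conjI ballI smooth_on_bounded_linear[OF assms(1)]) auto
qed

lemma smooth_map_add:
  assumes "smooth_map M vector_manifold f" "smooth_map M vector_manifold g"
  shows "smooth_map M vector_manifold (\<lambda>p. f p + g p)"
  using assms unfolding smooth_map_vector_iff
  by (simp add: smooth_on_add continuous_map_add)

subsection \<open>Immersions and submersions\<close>

lemma smooth_map_differential:
  assumes M: "smooth_manifold M" and f: "smooth_map M N f"
    and c: "c \<in> atlas M" and d: "d \<in> atlas N" and p: "p \<in> fst c" "f p \<in> fst d"
  obtains D where "has_differential f c d p D"
proof -
  have "Ck_on (Suc 0) (model M) (coord_dom f c d) (coord_rep f c d)"
    using smooth_mapD(2)[OF f c d] unfolding smooth_on_def by blast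
  then obtain f' where "\<forall>x\<in>coord_dom f c d. (coord_rep f c d has_derivative f' x) (at x within coord_dom f c d)"
    by auto
  moreover have "snd c p \<in> coord_dom f c d" using p by (auto simp: coord_dom_def)
  ultimately show thesis using that unfolding has_differential_def by blast
qed

lemma differential_in_model:
  assumes M: "smooth_manifold M" and N: "smooth_manifold N" and f: "smooth_map M N f"
    and c: "c \<in> atlas M" and d: "d \<in> atlas N" and p: "p \<in> fst c" "f p \<in> fst d"
    and D: "has_differential f c d p D" and v: "v \<in> model M"
  shows "D v \<in> model N"
proof (rule has_derivative_in_closed_subspace[OF D[unfolded has_differential_def] _
      openin_coord_dom[OF M c N d smooth_mapD(1)[OF f]] manifoldD(2)[OF M] v
      finite_dimensional_subspace_closed[OF manifoldD(1,2)[OF N]] manifoldD(2)[OF N]])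
  show "snd c p \<in> coord_dom f c d" using p by (auto simp: coord_dom_def)
  show "coord_rep f c d ` coord_dom f c d \<subseteq> model N"
    using chart_image_subset[OF N d] coord_rep_chart[OF M c, of _ f d] by (auto simp: coord_dom_def)
qed

text \<open>By the chain rule \<open>D'\<close> after \<open>D\<close> is a derivative of the
  identity, and derivatives are unique in directions of the model space. Elsewhere \<open>D\<close>
  is arbitrary, hence the restriction on \<open>v\<close>.\<close>

lemma differential_left_inverse:
  assumes M: "smooth_manifold M" and N: "smooth_manifold N" and f: "smooth_map M N f"
    and gf: "\<And>q. q \<in> topspace (mtop M) \<Longrightarrow> g (f q) = q"
    and c: "c \<in> atlas M" and d: "d \<in> atlas N" and p: "p \<in> fst c" "f p \<in> fst d"
    and D: "has_differential f c d p D" and D': "has_differential g d c (f p) D'"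
    and v: "v \<in> model M"
  shows "D' (D v) = v"
proof -
  let ?U = "coord_dom f c d"
  have U: "openin (top_of_set (model M)) ?U"
    by (rule openin_coord_dom[OF M c N d smooth_mapD(1)[OF f]])
  have x: "snd c p \<in> ?U" using p by (auto simp: coord_dom_def)
  have gf': "g (f q) = q" if "q \<in> fst c" for q using that gf chart_subset[OF M c] by blast
  \<comment> \<open>Since \<open>g\<close> returns to the starting point, the coordinate expression
    of \<open>f\<close> lands in the domain on which the one of \<open>g\<close> is
    differentiated.\<close>
  have im: "coord_rep f c d ` ?U \<subseteq> coord_dom g d c"
  proof (intro image_subsetI)
    fix x assume "x \<in> ?U"
    then obtain q where q: "q \<in> fst c" "f q \<in> fst d" "x = snd c q" by (auto simp: coord_dom_def)
    then show "coord_rep f c d x \<in> coord_dom g d c"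
      using gf'[OF q(1)] coord_rep_chart[OF M c q(1), of f d] by (auto simp: coord_dom_def)
  qed
  have "(coord_rep g d c has_derivative D') (at (coord_rep f c d (snd c p)) within coord_dom g d c)"
    using D' coord_rep_chart[OF M c p(1), of f d] by (simp add: has_differential_def)
  then have "((\<lambda>x. coord_rep g d c (coord_rep f c d x)) has_derivative (\<lambda>v. D' (D v)))
      (at (snd c p) within ?U)"
    by (rule has_derivative_in_compose[OF D[unfolded has_differential_def] has_derivative_subset[OF _ im]])
  then have "((\<lambda>x. x) has_derivative (\<lambda>v. D' (D v))) (at (snd c p) within ?U)"
  proof (rule has_derivative_transform[OF x, rotated])
    fix x assume "x \<in> ?U"
    then obtain q where q: "q \<in> fst c" "f q \<in> fst d" "x = snd c q" by (auto simp: coord_dom_def)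
    then show "x = coord_rep g d c (coord_rep f c d x)"
      using gf'[OF q(1)] coord_rep_chart[OF M c q(1), of f d] coord_rep_chart[OF N d q(2), of g c] by simp
  qed
  then show ?thesis
    by (rule has_derivative_unique_on[OF _ has_derivative_ident x U manifoldD(2)[OF M] v])
qed

lemma immersionI:
  assumes M: "smooth_manifold M" and N: "smooth_manifold N" and f: "smooth_map M N f"
    and g: "smooth_map N M g" and gf: "\<And>q. q \<in> topspace (mtop M) \<Longrightarrow> g (f q) = q"
  shows "immersion M N f"
  unfolding immersion_def
proof (intro conjI f ballI impI)
  fix c d p assume c: "c \<in> atlas M" and d: "d \<in> atlas N" and p: "p \<in> fst c" "f p \<in> fst d"
  obtain D where D: "has_differential f c d p D" by (rule smooth_map_differential[OF M f c d p])
  have "g (f p) \<in> fst c" using gf p(1) chart_subset[OF M c] by auto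
  then obtain D' where D': "has_differential g d c (f p) D'"
    by (rule smooth_map_differential[OF N g d c p(2)])
  have "inj_on D (model M)"
    by (rule inj_on_inverseI[of _ D']) (rule differential_left_inverse[OF M N f gf c d p D D'])
  then show "\<exists>D. has_differential f c d p D \<and> inj_on D (model M)" using D by blast
qed

text \<open>The section has to pass through \<open>p\<close> itself: its differential is taken at
  \<open>f p\<close> and must start a composition with \<open>D\<close>, which is taken at
  \<open>p\<close>. It is then a right inverse of \<open>D\<close> on the model space.\<close>

lemma submersionI:
  assumes M: "smooth_manifold M" and N: "smooth_manifold N" and f: "smooth_map M N f"
    and sec: "\<And>p. p \<in> topspace (mtop M) \<Longrightarrow>
      \<exists>\<sigma>. smooth_map N M \<sigma> \<and> \<sigma> (f p) = p \<and> (\<forall>q\<in>topspace (mtop N). f (\<sigma> q) = q)"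
  shows "submersion M N f"
  unfolding submersion_def
proof (intro conjI f ballI impI)
  fix c d p assume c: "c \<in> atlas M" and d: "d \<in> atlas N" and p: "p \<in> fst c" "f p \<in> fst d"
  have "p \<in> topspace (mtop M)" using chart_subset[OF M c] p by blast
  then obtain \<sigma> where \<sigma>: "smooth_map N M \<sigma>" "\<sigma> (f p) = p" "\<And>q. q \<in> topspace (mtop N) \<Longrightarrow> f (\<sigma> q) = q"
    using sec by blast
  have \<sigma>p: "\<sigma> (f p) \<in> fst c" using \<sigma>(2) p(1) by simp
  obtain D where D: "has_differential f c d p D" by (rule smooth_map_differential[OF M f c d p])
  obtain D' where D': "has_differential \<sigma> d c (f p) D'"
    by (rule smooth_map_differential[OF N \<sigma>(1) d c p(2) \<sigma>p])
  have D2: "has_differential f c d (\<sigma> (f p)) D" using D \<sigma>(2) by simp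
  have "D ` model M = model N"
  proof
    show "D ` model M \<subseteq> model N" using differential_in_model[OF M N f c d p D] by blast
    show "model N \<subseteq> D ` model M"
    proof
      fix w assume w: "w \<in> model N"
      have "D (D' w) = w" by (rule differential_left_inverse[OF N M \<sigma>(1) \<sigma>(3) d c p(2) \<sigma>p D' D2 w])
      moreover have "D' w \<in> model M" by (rule differential_in_model[OF N M \<sigma>(1) d c p(2) \<sigma>p D' w])
      ultimately show "w \<in> D ` model M" by force
    qed
  qed
  then show "\<exists>D. has_differential f c d p D \<and> D ` model M = model N" using D by blast
qed

subsection \<open>The image of a manifold under an embedding with a smooth left inverse\<close>

text \<open>\<open>composable_manifold\<close> asks for a submanifold whose charts have values in
  the model type of the ambient manifold. The linear maps \<open>j\<close> and \<open>k\<close> move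
  the charts of \<open>Q\<close> into that type and back; they are independent of the differentials
  of \<open>\<iota>\<close> and \<open>\<rho>\<close>.\<close>

locale retractable_embedding =
  fixes Q :: "('q, 'e::real_normed_vector) manifold" and N :: "('a, 'f::real_normed_vector) manifold"
    and \<iota> :: "'q \<Rightarrow> 'a" and \<rho> :: "'a \<Rightarrow> 'q" and j :: "'e \<Rightarrow> 'f" and k :: "'f \<Rightarrow> 'e"
  assumes Q: "smooth_manifold Q" and N: "smooth_manifold N"
    and \<iota>: "smooth_map Q N \<iota>" and \<rho>: "smooth_map N Q \<rho>"
    and \<rho>_\<iota>: "\<And>q. q \<in> topspace (mtop Q) \<Longrightarrow> \<rho> (\<iota> q) = q"
    and j: "bounded_linear j" and k: "bounded_linear k" and k_j: "\<And>x. k (j x) = x"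
begin

text \<open>\<open>\<rho>\<close> stands in for the inverse of \<open>\<iota>\<close>: it is
  continuous on all of \<open>N\<close>, so the charts of the image inherit continuity from
  it.\<close>

definition image_chart :: "'q set \<times> ('q \<Rightarrow> 'e) \<Rightarrow> 'a set \<times> ('a \<Rightarrow> 'f)" where
  "image_chart c = (\<iota> ` fst c, \<lambda>p. j (snd c (\<rho> p)))"

definition image_manifold :: "('a, 'f) manifold" where
  "image_manifold = \<lparr>mtop = subtopology (mtop N) (\<iota> ` topspace (mtop Q)),
     model = j ` model Q, atlas = image_chart ` atlas Q\<rparr>"

lemma image_manifold_simps [simp]:
  "mtop image_manifold = subtopology (mtop N) (\<iota> ` topspace (mtop Q))"
  "model image_manifold = j ` model Q" "atlas image_manifold = image_chart ` atlas Q"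
  by (simp_all add: image_manifold_def)

lemma \<iota>_in: "q \<in> topspace (mtop Q) \<Longrightarrow> \<iota> q \<in> topspace (mtop N)"
  by (rule smooth_map_in_topspace[OF \<iota>])

lemma topspace_image [simp]: "topspace (mtop image_manifold) = \<iota> ` topspace (mtop Q)"
  using \<iota>_in by auto

lemma \<rho>_\<iota>_chart: "c \<in> atlas Q \<Longrightarrow> q \<in> fst c \<Longrightarrow> \<rho> (\<iota> q) = q"
  using \<rho>_\<iota> chart_subset[OF Q] by blast

lemma homeomorphic_map_j: "homeomorphic_map (top_of_set W) (top_of_set (j ` W)) j"
  unfolding homeomorphic_map_maps homeomorphic_maps_def
  using linear_continuous_on[OF j] linear_continuous_on[OF k] k_j
  by (intro exI[of _ k]) auto

lemma openin_j: "openin (top_of_set E) U \<Longrightarrow> openin (top_of_set (j ` E)) (j ` U)"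
  using homeomorphic_imp_open_map[OF homeomorphic_map_j] by (auto simp: open_map_def)

lemma subspace_j: "subspace E \<Longrightarrow> subspace (j ` E)"
  using j by (simp add: bounded_linear.linear linear_subspace_image)

lemma smooth_on_j_image:
  assumes E: "subspace E" and U: "openin (top_of_set E) U" and f: "smooth_on E U f"
  shows "smooth_on (j ` E) (j ` U) (\<lambda>y. f (k y))"
proof (rule smooth_on_compose[OF manifoldD(1)[OF Q] subspace_j[OF E] openin_j[OF U] E
      openin_imp_subset[OF U] f])
  show "smooth_on (j ` E) (j ` U) k" by (rule smooth_on_bounded_linear[OF k smooth_on_ident])
qed (auto simp: k_j)

lemma image_chart_image:
  assumes "c \<in> atlas Q"
  shows "snd (image_chart c) ` fst (image_chart c) = j ` snd c ` fst c"
  using \<rho>_\<iota>_chart[OF assms] by (auto simp: image_chart_def image_image)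

lemma homeomorphic_map_\<rho>:
  assumes "U \<subseteq> topspace (mtop Q)"
  shows "homeomorphic_map (subtopology (mtop N) (\<iota> ` U)) (subtopology (mtop Q) U) \<rho>"
  unfolding homeomorphic_map_maps homeomorphic_maps_def
proof (intro exI[of _ \<iota>] conjI ballI)
  show "continuous_map (subtopology (mtop N) (\<iota> ` U)) (subtopology (mtop Q) U) \<rho>"
    using \<rho>_\<iota> assms
    by (intro continuous_map_into_subtopology continuous_map_from_subtopology smooth_mapD(1)[OF \<rho>]) auto
  show "continuous_map (subtopology (mtop Q) U) (subtopology (mtop N) (\<iota> ` U)) \<iota>"
    using assms
    by (intro continuous_map_into_subtopology continuous_map_from_subtopology smooth_mapD(1)[OF \<iota>]) auto
qed (use \<rho>_\<iota> assms in auto)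

lemma image_chart_\<iota>:
  assumes "c \<in> atlas Q" "q \<in> fst c" shows "snd (image_chart c) (\<iota> q) = j (snd c q)"
  by (simp add: image_chart_def \<rho>_\<iota>_chart[OF assms])

lemma image_chart_inj:
  assumes c: "c \<in> atlas Q" shows "inj_on (snd (image_chart c)) (fst (image_chart c))"
proof (rule inj_onI)
  fix x y assume "x \<in> fst (image_chart c)" "y \<in> fst (image_chart c)"
    and eq: "snd (image_chart c) x = snd (image_chart c) y"
  then obtain p q where pq: "p \<in> fst c" "q \<in> fst c" "x = \<iota> p" "y = \<iota> q"
    by (auto simp: image_chart_def)
  have "k (j (snd c p)) = k (j (snd c q))"
    using eq unfolding pq(3,4) image_chart_\<iota>[OF c pq(1)] image_chart_\<iota>[OF c pq(2)] by (rule arg_cong)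
  then have "p = q" unfolding k_j using inj_onD[OF chart_inj[OF Q c] _ pq(1,2)] by simp
  then show "x = y" unfolding pq(3,4) by (rule arg_cong)
qed

lemma coord_rep_image_chart:
  assumes c: "c \<in> atlas Q" and q: "q \<in> fst c"
  shows "coord_rep f (image_chart c) d (j (snd c q)) = snd d (f (\<iota> q))"
proof -
  have "\<iota> q \<in> fst (image_chart c)" using q by (simp add: image_chart_def)
  then have "inv_into (fst (image_chart c)) (snd (image_chart c)) (snd (image_chart c) (\<iota> q)) = \<iota> q"
    by (rule inv_into_f_f[OF image_chart_inj[OF c]])
  then show ?thesis unfolding image_chart_\<iota>[OF c q] by (simp add: coord_rep_def)
qed

lemma coord_dom_image_chart:
  assumes c: "c \<in> atlas Q"
  shows "coord_dom f (image_chart c) d = j ` snd c ` {q \<in> fst c. f (\<iota> q) \<in> fst d}"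
proof -
  have "{p \<in> \<iota> ` fst c. f p \<in> fst d} = \<iota> ` {q \<in> fst c. f (\<iota> q) \<in> fst d}" by auto
  then show ?thesis
    using \<rho>_\<iota>_chart[OF c] by (simp add: coord_dom_def image_chart_def image_image)
qed

lemma \<iota>_in_image_chart:
  assumes "c \<in> atlas Q" "d \<in> atlas Q" "q \<in> fst c"
  shows "\<iota> q \<in> fst (image_chart d) \<longleftrightarrow> q \<in> fst d"
proof
  assume "\<iota> q \<in> fst (image_chart d)"
  then obtain r where r: "r \<in> fst d" "\<iota> q = \<iota> r" by (auto simp: image_chart_def)
  then have "\<rho> (\<iota> q) = \<rho> (\<iota> r)" by simp
  then show "q \<in> fst d"
    using r(1) by (simp only: \<rho>_\<iota>_chart[OF assms(1,3)] \<rho>_\<iota>_chart[OF assms(2) r(1)])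
qed (simp add: image_chart_def)

lemma openin_transition_dom:
  "c \<in> atlas Q \<Longrightarrow> d \<in> atlas Q \<Longrightarrow> openin (top_of_set (model Q)) (coord_dom id c d)"
  by (rule openin_coord_dom[OF Q _ Q]) auto

lemma coord_rep_id_j:
  assumes c: "c \<in> atlas Q" and d: "d \<in> atlas Q"
  shows "smooth_on (j ` model Q) (j ` coord_dom id c d) (\<lambda>y. coord_rep id c d (k y))"
  by (rule smooth_on_j_image[OF manifoldD(2)[OF Q] openin_transition_dom[OF c d] manifold_transition[OF Q c d]])

lemma smooth_manifold_image: "smooth_manifold image_manifold"
  unfolding smooth_manifold_def
proof (intro conjI)
  show "finite_dimensional (UNIV :: 'f set)" by (rule manifoldD(1)[OF N])
  show "subspace (model image_manifold)" using subspace_j[OF manifoldD(2)[OF Q]] by simp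
  show "Hausdorff_space (mtop image_manifold)"
    using manifoldD(3)[OF N] by (simp add: Hausdorff_space_subtopology)
  show "second_countable (mtop image_manifold)"
    using manifoldD(4)[OF N] by (simp add: second_countable_subtopology)
  show "(\<Union>c\<in>atlas image_manifold. fst c) = topspace (mtop image_manifold)"
    unfolding topspace_image manifoldD(5)[OF Q, symmetric] by (auto simp: image_chart_def)
  show "\<forall>(U, \<phi>)\<in>atlas image_manifold. openin (mtop image_manifold) U \<and>
      openin (top_of_set (model image_manifold)) (\<phi> ` U) \<and>
      homeomorphic_map (subtopology (mtop image_manifold) U) (top_of_set (\<phi> ` U)) \<phi>"
  proof safe
    fix U \<phi> assume "(U, \<phi>) \<in> atlas image_manifold"
    then obtain c where c: "c \<in> atlas Q" and U\<phi>: "image_chart c = (U, \<phi>)" by auto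
    then have U: "U = \<iota> ` fst c" and \<phi>: "\<phi> = j \<circ> snd c \<circ> \<rho>" by (auto simp: image_chart_def)
    have sub: "fst c \<subseteq> topspace (mtop Q)" by (rule chart_subset[OF Q c])
    have im: "\<phi> ` U = j ` snd c ` fst c" using image_chart_image[OF c] U\<phi> by simp
    \<comment> \<open>Within the image, \<open>U\<close> is the set of points that
      \<open>\<rho>\<close> sends into \<open>fst c\<close>, so continuity of \<open>\<rho>\<close>
      makes it open.\<close>
    have "openin (mtop image_manifold) {p \<in> topspace (mtop image_manifold). \<rho> p \<in> fst c}"
      using chartD(1)[OF Q c]
      by (intro openin_continuous_map_preimage[of _ "mtop Q"])
        (simp_all add: continuous_map_from_subtopology smooth_mapD(1)[OF \<rho>])
    moreover have "{p \<in> topspace (mtop image_manifold). \<rho> p \<in> fst c} = U"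
      unfolding topspace_image U using \<rho>_\<iota> sub by force
    ultimately show "openin (mtop image_manifold) U" by simp
    show "openin (top_of_set (model image_manifold)) (\<phi> ` U)"
      unfolding im using openin_j[OF chartD(2)[OF Q c]] by simp
    have "subtopology (mtop image_manifold) U = subtopology (mtop N) (\<iota> ` fst c)"
      unfolding U image_manifold_simps subtopology_subtopology
      using image_mono[OF sub, of \<iota>] by (simp add: Int_absorb1)
    then show "homeomorphic_map (subtopology (mtop image_manifold) U) (top_of_set (\<phi> ` U)) \<phi>"
      unfolding im unfolding \<phi>
      using homeomorphic_map_compose[OF homeomorphic_map_compose[OF homeomorphic_map_\<rho>[OF sub]
            chartD(3)[OF Q c]] homeomorphic_map_j] by (simp add: o_assoc)
  qed
  show "\<forall>c\<in>atlas image_manifold. \<forall>d\<in>atlas image_manifold.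
      smooth_on (model image_manifold) (coord_dom id c d) (coord_rep id c d)"
  proof safe
    fix U \<phi> V \<psi> assume "(U, \<phi>) \<in> atlas image_manifold" "(V, \<psi>) \<in> atlas image_manifold"
    then obtain c d where c: "c \<in> atlas Q" "(U, \<phi>) = image_chart c"
      and d: "d \<in> atlas Q" "(V, \<psi>) = image_chart d" by auto
    have dom: "coord_dom id (image_chart c) (image_chart d) = j ` coord_dom id c d"
      unfolding coord_dom_image_chart[OF c(1)] using \<iota>_in_image_chart[OF c(1) d(1)]
      by (auto simp: coord_dom_def)
    \<comment> \<open>The transition maps are those of \<open>Q\<close> conjugated by
      \<open>j\<close> and \<open>k\<close>.\<close>
    have "smooth_on (j ` model Q) (j ` coord_dom id c d) (\<lambda>y. j (coord_rep id c d (k y)))"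
      by (rule smooth_on_bounded_linear[OF j coord_rep_id_j[OF c(1) d(1)]])
    then show "smooth_on (model image_manifold) (coord_dom id (U, \<phi>) (V, \<psi>)) (coord_rep id (U, \<phi>) (V, \<psi>))"
      unfolding c(2) d(2) dom image_manifold_simps
    proof (rule smooth_on_cong)
      fix y assume "y \<in> j ` coord_dom id c d"
      then obtain q where q: "q \<in> fst c" "q \<in> fst d" "y = j (snd c q)" by (auto simp: coord_dom_def)
      show "coord_rep id (image_chart c) (image_chart d) y = j (coord_rep id c d (k y))"
        unfolding q(3) k_j coord_rep_image_chart[OF c(1) q(1)] coord_rep_chart[OF Q c(1) q(1)] id_apply
        by (rule image_chart_\<iota>[OF d(1) q(2)])
    qed
  qed
qed

lemma smooth_map_\<iota>_image: "smooth_map Q image_manifold \<iota>"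
  unfolding smooth_map_def
proof (intro conjI ballI)
  show "continuous_map (mtop Q) (mtop image_manifold) \<iota>"
    using smooth_mapD(1)[OF \<iota>] by (simp add: continuous_map_into_subtopology)
  fix c d' assume c: "c \<in> atlas Q" and "d' \<in> atlas image_manifold"
  then obtain d where d: "d \<in> atlas Q" and d': "d' = image_chart d" by auto
  have dom: "coord_dom \<iota> c d' = coord_dom id c d"
    unfolding d' coord_dom_def using \<iota>_in_image_chart[OF c d] by auto
  show "smooth_on (model Q) (coord_dom \<iota> c d') (coord_rep \<iota> c d')"
    unfolding dom
  proof (rule smooth_on_cong[OF smooth_on_bounded_linear[OF j manifold_transition[OF Q c d]]])
    fix x assume "x \<in> coord_dom id c d"
    then obtain q where q: "q \<in> fst c" "q \<in> fst d" "x = snd c q" by (auto simp: coord_dom_def)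
    show "coord_rep \<iota> c d' x = j (coord_rep id c d x)"
      unfolding q(3) d' coord_rep_chart[OF Q c q(1)] id_apply by (rule image_chart_\<iota>[OF d q(2)])
  qed
qed

lemma smooth_map_\<rho>_image: "smooth_map image_manifold Q \<rho>"
  unfolding smooth_map_def
proof (intro conjI ballI)
  show "continuous_map (mtop image_manifold) (mtop Q) \<rho>"
    using smooth_mapD(1)[OF \<rho>] by (simp add: continuous_map_from_subtopology)
  fix c' d assume "c' \<in> atlas image_manifold" and d: "d \<in> atlas Q"
  then obtain c where c: "c \<in> atlas Q" and c': "c' = image_chart c" by auto
  have dom: "coord_dom \<rho> c' d = j ` coord_dom id c d"
    unfolding c' coord_dom_image_chart[OF c] using \<rho>_\<iota>_chart[OF c] by (auto simp: coord_dom_def)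
  show "smooth_on (model image_manifold) (coord_dom \<rho> c' d) (coord_rep \<rho> c' d)"
    unfolding dom image_manifold_simps
  proof (rule smooth_on_cong[OF coord_rep_id_j[OF c d]])
    fix y assume "y \<in> j ` coord_dom id c d"
    then obtain q where q: "q \<in> fst c" "y = j (snd c q)" by (auto simp: coord_dom_def)
    show "coord_rep \<rho> c' d y = coord_rep id c d (k y)"
      unfolding q(2) c' k_j coord_rep_image_chart[OF c q(1)] coord_rep_chart[OF Q c q(1)]
        \<rho>_\<iota>_chart[OF c q(1)] by simp
  qed
qed

text \<open>On the image the inclusion coincides with \<open>\<iota>\<close> after
  \<open>\<rho>\<close>, a composite through \<open>Q\<close>.\<close>

lemma smooth_map_inclusion: "smooth_map image_manifold N (\<lambda>p. p)"
  by (rule smooth_map_cong[OF smooth_manifold_image smooth_map_compose[OF smooth_manifold_image Q N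
        smooth_map_\<rho>_image \<iota>]]) (auto simp: \<rho>_\<iota>)

lemma smooth_map_retraction: "smooth_map N image_manifold (\<lambda>p. \<iota> (\<rho> p))"
  by (rule smooth_map_compose[OF N Q smooth_manifold_image \<rho> smooth_map_\<iota>_image])

text \<open>Following \<open>f\<close> by the retraction
  \<open>p \<mapsto> \<iota> (\<rho> p)\<close> changes nothing, and the retraction is smooth from
  \<open>N\<close> into the image. So smoothness into the submanifold can be checked in the ambient
  manifold.\<close>

lemma smooth_map_into_image:
  assumes R: "smooth_manifold R" and f: "smooth_map R N f"
    and im: "\<And>p. p \<in> topspace (mtop R) \<Longrightarrow> f p \<in> \<iota> ` topspace (mtop Q)"
  shows "smooth_map R image_manifold f"
proof (rule smooth_map_cong[OF R smooth_map_compose[OF R N smooth_manifold_image f smooth_map_retraction]])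
  show "f p = \<iota> (\<rho> (f p))" if "p \<in> topspace (mtop R)" for p
    using im[OF that] \<rho>_\<iota> by auto
qed

text \<open>The retraction is a smooth left inverse of the inclusion, which is therefore an
  immersion.\<close>

lemma embedded_submanifold_image: "embedded_submanifold image_manifold N"
  unfolding embedded_submanifold_def
proof (intro conjI smooth_manifold_image)
  show "topspace (mtop image_manifold) \<subseteq> topspace (mtop N)" using \<iota>_in by auto
  show "mtop image_manifold = subtopology (mtop N) (topspace (mtop image_manifold))"
    unfolding topspace_image by simp
  have "immersion image_manifold N (\<lambda>p. p)"
    by (rule immersionI[OF smooth_manifold_image N smooth_map_inclusion smooth_map_retraction])
      (auto simp: \<rho>_\<iota>)
  then show "immersion image_manifold N id" by (simp add: id_def)
qed

end

subsection \<open>The 2-group of a represented crossed module\<close>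

lemma smooth_map_Pair_compose:
  assumes "smooth_manifold R" "smooth_manifold M" "smooth_manifold N" "smooth_manifold K"
    and "smooth_map (product_manifold M N) K (\<lambda>(x, y). h x y)" "smooth_map R M f" "smooth_map R N g"
  shows "smooth_map R K (\<lambda>p. h (f p) (g p))"
  using smooth_map_compose[OF assms(1) smooth_manifold_product[OF assms(2,3)] assms(4)
      smooth_map_Pair[OF assms(6,7)] assms(5)] by simp

lemma smooth_map_product_components:
  assumes "smooth_manifold R" "smooth_manifold M" "smooth_manifold N"
    and "smooth_map R (product_manifold M N) f"
  shows "smooth_map R M (\<lambda>p. fst (f p))" "smooth_map R N (\<lambda>p. snd (f p))"
  using smooth_map_compose[OF assms(1) smooth_manifold_product[OF assms(2,3)] assms(2) assms(4)
      smooth_map_fst[OF assms(2,3)]]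
    smooth_map_compose[OF assms(1) smooth_manifold_product[OF assms(2,3)] assms(3) assms(4)
      smooth_map_snd[OF assms(2,3)]] by simp_all

lemma group_GL: "group (GL :: ('v::real_normed_vector \<Rightarrow>\<^sub>L 'v) monoid)"
  unfolding GL_def
  by (rule monoid.units_group, rule monoidI) (auto intro: blinfun_eqI)

lemma GL_simps [simp]: "x \<otimes>\<^bsub>GL\<^esub> y = x o\<^sub>L y" "\<one>\<^bsub>GL\<^esub> = id_blinfun"
  by (simp_all add: GL_def units_of_mult units_of_one)

locale represented_crossed_module =
  fixes H :: "('h1, 'e1::real_normed_vector, 'h0, 'e0::real_normed_vector) lie_xmod"
    and d :: "'v1::real_normed_vector \<Rightarrow>\<^sub>L 'v0::real_normed_vector"
    and \<Psi>1 :: "'h1 \<Rightarrow> 'v0 \<Rightarrow>\<^sub>L 'v1"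
    and \<Psi>0 :: "'h0 \<Rightarrow> ('v0 \<Rightarrow>\<^sub>L 'v0) \<times> ('v1 \<Rightarrow>\<^sub>L 'v1)"
  assumes fin0: "finite_dimensional (UNIV :: 'v0 set)"
    and fin1: "finite_dimensional (UNIV :: 'v1 set)"
    and xmod: "lie_crossed_module H"
    and \<Psi>: "strict_xmod_morphism H (aut_xmod d) \<Psi>1 \<Psi>0"
begin

abbreviation "H0 \<equiv> X0 H"
abbreviation "H1 \<equiv> X1 H"
abbreviation "t \<equiv> bd H"
abbreviation "\<Phi> \<equiv> act H"
abbreviation "A0 x \<equiv> blinfun_apply (fst (\<Psi>0 x))"
abbreviation "A1 x \<equiv> blinfun_apply (snd (\<Psi>0 x))"
abbreviation "N a \<equiv> blinfun_apply (\<Psi>1 a)"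

sublocale xm: lie_crossed_module H by (rule xmod)
sublocale H0: lie_group H0 by (rule xm.X0)
sublocale H1: lie_group H1 by (rule xm.X1)

section \<open>Laws of the crossed module and pointwise identities of the representation\<close>

lemma t_hom: "t \<in> hom H1 H0" and t_smooth: "smooth_map (mfd H1) (mfd H0) t"
  using xm.bd by (auto simp: lie_morphism_def)

lemma t_closed [simp]: "a \<in> carrier H1 \<Longrightarrow> t a \<in> carrier H0"
  using t_hom by (rule hom_in_carrier)

lemma t_mult: "a \<in> carrier H1 \<Longrightarrow> b \<in> carrier H1 \<Longrightarrow> t (a \<otimes>\<^bsub>H1\<^esub> b) = t a \<otimes>\<^bsub>H0\<^esub> t b"
  using t_hom by (rule hom_mult)

lemma t_one [simp]: "t \<one>\<^bsub>H1\<^esub> = \<one>\<^bsub>H0\<^esub>"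
  using t_hom H1.is_group H0.is_group by (rule hom_one)

lemma t_inv: "a \<in> carrier H1 \<Longrightarrow> t (inv\<^bsub>H1\<^esub> a) = inv\<^bsub>H0\<^esub> (t a)"
  using group_hom.hom_inv[of H1 H0 t] t_hom H1.is_group H0.is_group
  by (simp add: group_hom_def group_hom_axioms_def)

lemma \<Phi>_hom: "x \<in> carrier H0 \<Longrightarrow> \<Phi> x \<in> hom H1 H1"
  using xm.act_auto by (simp add: iso_def)

lemma \<Phi>_closed [simp]: "x \<in> carrier H0 \<Longrightarrow> a \<in> carrier H1 \<Longrightarrow> \<Phi> x a \<in> carrier H1"
  by (rule hom_in_carrier[OF \<Phi>_hom])

lemma \<Phi>_mult:
  "x \<in> carrier H0 \<Longrightarrow> a \<in> carrier H1 \<Longrightarrow> b \<in> carrier H1 \<Longrightarrow> \<Phi> x (a \<otimes>\<^bsub>H1\<^esub> b) = \<Phi> x a \<otimes>\<^bsub>H1\<^esub> \<Phi> x b"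
  by (rule hom_mult[OF \<Phi>_hom])

lemma \<Phi>_one [simp]: "x \<in> carrier H0 \<Longrightarrow> \<Phi> x \<one>\<^bsub>H1\<^esub> = \<one>\<^bsub>H1\<^esub>"
  by (rule hom_one[OF \<Phi>_hom H1.is_group H1.is_group])

lemma H0_cancel:
  assumes "x \<in> carrier H0" "y \<in> carrier H0"
  shows "inv\<^bsub>H0\<^esub> x \<otimes>\<^bsub>H0\<^esub> (x \<otimes>\<^bsub>H0\<^esub> y) = y" "x \<otimes>\<^bsub>H0\<^esub> (inv\<^bsub>H0\<^esub> x \<otimes>\<^bsub>H0\<^esub> y) = y"
  using assms by (simp_all flip: H0.m_assoc)

text \<open>By equivariance \<open>t (\<Phi> x b)\<close> is the conjugate of \<open>t b\<close> by
  \<open>x\<close>, whose trailing inverse cancels against \<open>x\<close>. Both associativity on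
  arrows and multiplicativity of the target rest on this.\<close>

lemma target_mult:
  assumes "x \<in> carrier H0" "y \<in> carrier H0" "a \<in> carrier H1" "b \<in> carrier H1"
  shows "t (a \<otimes>\<^bsub>H1\<^esub> \<Phi> x b) \<otimes>\<^bsub>H0\<^esub> (x \<otimes>\<^bsub>H0\<^esub> y) = (t a \<otimes>\<^bsub>H0\<^esub> x) \<otimes>\<^bsub>H0\<^esub> (t b \<otimes>\<^bsub>H0\<^esub> y)"
  using assms by (simp add: t_mult xm.bd_act H0.m_assoc H0_cancel)

text \<open>The Peiffer identity turns the action of \<open>t a\<close> into conjugation by
  \<open>a\<close>, and the final \<open>a\<close> cancels the inverse. This is the
  \<open>H1\<close> part of the interchange law.\<close>

lemma \<Phi>_target:
  assumes "x \<in> carrier H0" "a \<in> carrier H1" "b \<in> carrier H1"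
  shows "\<Phi> (t a \<otimes>\<^bsub>H0\<^esub> x) b \<otimes>\<^bsub>H1\<^esub> a = a \<otimes>\<^bsub>H1\<^esub> \<Phi> x b"
  using assms by (simp add: xm.act_mult xm.peiffer H1.m_assoc)

lemma \<Psi>0_closed:
  assumes "x \<in> carrier H0"
  shows "fst (\<Psi>0 x) \<in> carrier GL" "snd (\<Psi>0 x) \<in> carrier GL" "fst (\<Psi>0 x) o\<^sub>L d = d o\<^sub>L snd (\<Psi>0 x)"
proof -
  have "\<Psi>0 \<in> hom H0 (aut0 d)" using \<Psi> by (simp add: strict_xmod_morphism_def lie_morphism_def aut_xmod_def)
  then have "\<Psi>0 x \<in> carrier (aut0 d)" using assms by (rule hom_in_carrier)
  then show "fst (\<Psi>0 x) \<in> carrier GL" "snd (\<Psi>0 x) \<in> carrier GL" "fst (\<Psi>0 x) o\<^sub>L d = d o\<^sub>L snd (\<Psi>0 x)"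
    by (auto simp: aut0_def Let_def)
qed

lemma \<Psi>0_mult:
  assumes "x \<in> carrier H0" "y \<in> carrier H0"
  shows "fst (\<Psi>0 (x \<otimes>\<^bsub>H0\<^esub> y)) = fst (\<Psi>0 x) o\<^sub>L fst (\<Psi>0 y)"
    "snd (\<Psi>0 (x \<otimes>\<^bsub>H0\<^esub> y)) = snd (\<Psi>0 x) o\<^sub>L snd (\<Psi>0 y)"
proof -
  have "\<Psi>0 \<in> hom H0 (aut0 d)" using \<Psi> by (simp add: strict_xmod_morphism_def lie_morphism_def aut_xmod_def)
  then have "\<Psi>0 (x \<otimes>\<^bsub>H0\<^esub> y) = \<Psi>0 x \<otimes>\<^bsub>aut0 d\<^esub> \<Psi>0 y" using assms by (rule hom_mult)
  then show "fst (\<Psi>0 (x \<otimes>\<^bsub>H0\<^esub> y)) = fst (\<Psi>0 x) o\<^sub>L fst (\<Psi>0 y)"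
    "snd (\<Psi>0 (x \<otimes>\<^bsub>H0\<^esub> y)) = snd (\<Psi>0 x) o\<^sub>L snd (\<Psi>0 y)"
    by (simp_all add: aut0_def Let_def split_beta)
qed

text \<open>The two components are idempotents in the group \<open>GL\<close>, hence identities.
  Arguing in \<open>GL\<close> avoids establishing a group structure on
  \<open>aut0 d\<close>.\<close>

lemma \<Psi>0_one: "fst (\<Psi>0 \<one>\<^bsub>H0\<^esub>) = id_blinfun" "snd (\<Psi>0 \<one>\<^bsub>H0\<^esub>) = id_blinfun"
proof -
  have "fst (\<Psi>0 \<one>\<^bsub>H0\<^esub>) o\<^sub>L fst (\<Psi>0 \<one>\<^bsub>H0\<^esub>) = fst (\<Psi>0 \<one>\<^bsub>H0\<^esub>)"
    "snd (\<Psi>0 \<one>\<^bsub>H0\<^esub>) o\<^sub>L snd (\<Psi>0 \<one>\<^bsub>H0\<^esub>) = snd (\<Psi>0 \<one>\<^bsub>H0\<^esub>)"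
    using \<Psi>0_mult[of "\<one>\<^bsub>H0\<^esub>" "\<one>\<^bsub>H0\<^esub>"] by simp_all
  then show "fst (\<Psi>0 \<one>\<^bsub>H0\<^esub>) = id_blinfun" "snd (\<Psi>0 \<one>\<^bsub>H0\<^esub>) = id_blinfun"
    using group.l_cancel_one[OF group_GL] \<Psi>0_closed[of "\<one>\<^bsub>H0\<^esub>"] by auto
qed

lemma A_one [simp]: "A0 \<one>\<^bsub>H0\<^esub> v = v" "A1 \<one>\<^bsub>H0\<^esub> n = n"
  by (simp_all add: \<Psi>0_one)

lemma A_mult:
  assumes "x \<in> carrier H0" "y \<in> carrier H0"
  shows "A0 (x \<otimes>\<^bsub>H0\<^esub> y) v = A0 x (A0 y v)" "A1 (x \<otimes>\<^bsub>H0\<^esub> y) n = A1 x (A1 y n)"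
  by (simp_all add: \<Psi>0_mult[OF assms])

lemma d_A1: "x \<in> carrier H0 \<Longrightarrow> d (A1 x n) = A0 x (d n)"
  using arg_cong[OF \<Psi>0_closed(3)[of x], of "\<lambda>B. blinfun_apply B n"] by simp

lemma \<Psi>0_t:
  assumes "a \<in> carrier H1"
  shows "A0 (t a) v = v + d (N a v)" "A1 (t a) n = n + N a (d n)"
proof -
  have "\<Psi>0 (t a) = (id_blinfun + (d o\<^sub>L \<Psi>1 a), id_blinfun + (\<Psi>1 a o\<^sub>L d))"
    using \<Psi> assms by (simp add: strict_xmod_morphism_def aut_xmod_def)
  then show "A0 (t a) v = v + d (N a v)" "A1 (t a) n = n + N a (d n)"
    by (simp_all add: blinfun.add_left)
qed

lemma N_mult:
  assumes "a \<in> carrier H1" "b \<in> carrier H1"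
  shows "N (a \<otimes>\<^bsub>H1\<^esub> b) v = N a v + N b v + N a (d (N b v))"
proof -
  have "\<Psi>1 \<in> hom H1 (aut1 d)" using \<Psi> by (simp add: strict_xmod_morphism_def lie_morphism_def aut_xmod_def)
  then have "\<Psi>1 (a \<otimes>\<^bsub>H1\<^esub> b) = \<Psi>1 a \<otimes>\<^bsub>aut1 d\<^esub> \<Psi>1 b" using assms by (rule hom_mult)
  then show ?thesis by (simp add: aut1_def Let_def blinfun.add_left)
qed

lemma N_one [simp]: "N \<one>\<^bsub>H1\<^esub> v = 0"
proof -
  have "d (N \<one>\<^bsub>H1\<^esub> v) = 0" using \<Psi>0_t(1)[of "\<one>\<^bsub>H1\<^esub>" v] by simp
  then show ?thesis using N_mult[of "\<one>\<^bsub>H1\<^esub>" "\<one>\<^bsub>H1\<^esub>" v] by (simp add: blinfun.zero_right)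
qed

text \<open>With \<open>A0 x v\<close> as argument, the inverse operator in the action on
  \<open>aut1 d\<close> cancels, so no inverse operator occurs in later calculations.\<close>

lemma N_\<Phi>:
  assumes "x \<in> carrier H0" "a \<in> carrier H1"
  shows "N (\<Phi> x a) (A0 x v) = A1 x (N a v)"
proof -
  have "\<Psi>1 (\<Phi> x a) = snd (\<Psi>0 x) o\<^sub>L \<Psi>1 a o\<^sub>L inv\<^bsub>GL\<^esub> (fst (\<Psi>0 x))"
    using \<Psi> assms by (simp add: strict_xmod_morphism_def aut_xmod_def split_beta)
  moreover have "inv\<^bsub>GL\<^esub> (fst (\<Psi>0 x)) o\<^sub>L fst (\<Psi>0 x) = id_blinfun"
    using group.l_inv[OF group_GL \<Psi>0_closed(1)[OF assms(1)]] by simp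
  then have "blinfun_apply (inv\<^bsub>GL\<^esub> (fst (\<Psi>0 x))) (A0 x v) = v"
    by (simp flip: blinfun_apply_blinfun_compose)
  ultimately show ?thesis by simp
qed

section \<open>The groups of objects and arrows, and the interchange law\<close>

lemmas blin = blinfun.add_right blinfun.minus_right blinfun.zero_right blinfun.diff_right

text \<open>The semidirect product of \<open>H0\<close> with the vector group \<open>V0\<close>, on
  which \<open>x\<close> acts by \<open>A0 x\<close>.\<close>

definition objs :: "('h0 \<times> 'v0, 'e0 \<times> 'v0) lie_grp" where
  "objs = \<lparr>carrier = carrier H0 \<times> UNIV,
    mult = (\<lambda>(x, \<xi>) (y, \<eta>). (x \<otimes>\<^bsub>H0\<^esub> y, \<xi> + A0 x \<eta>)),
    one = (\<one>\<^bsub>H0\<^esub>, 0),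
    mfd = product_manifold (mfd H0) vector_manifold\<rparr>"

definition arrs :: "('h0 \<times> 'h1 \<times> 'v0 \<times> 'v1, 'e0 \<times> 'e1 \<times> 'v0 \<times> 'v1) lie_grp" where
  "arrs = \<lparr>carrier = carrier H0 \<times> carrier H1 \<times> UNIV \<times> UNIV,
    mult = (\<lambda>(x, a, \<xi>, m) (y, b, \<eta>, n). (x \<otimes>\<^bsub>H0\<^esub> y, a \<otimes>\<^bsub>H1\<^esub> \<Phi> x b, \<xi> + A0 x \<eta>,
      m + A1 (t a \<otimes>\<^bsub>H0\<^esub> x) n + N a (A0 x \<eta>))),
    one = (\<one>\<^bsub>H0\<^esub>, \<one>\<^bsub>H1\<^esub>, 0, 0),
    mfd = product_manifold (mfd H0)
      (product_manifold (mfd H1) (product_manifold vector_manifold vector_manifold))\<rparr>"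

definition source :: "'h0 \<times> 'h1 \<times> 'v0 \<times> 'v1 \<Rightarrow> 'h0 \<times> 'v0" where
  "source = (\<lambda>(x, a, \<xi>, m). (x, \<xi>))"

definition target :: "'h0 \<times> 'h1 \<times> 'v0 \<times> 'v1 \<Rightarrow> 'h0 \<times> 'v0" where
  "target = (\<lambda>(x, a, \<xi>, m). (t a \<otimes>\<^bsub>H0\<^esub> x, \<xi> + d m))"

definition unit_arrow :: "'h0 \<times> 'v0 \<Rightarrow> 'h0 \<times> 'h1 \<times> 'v0 \<times> 'v1" where
  "unit_arrow = (\<lambda>(x, \<xi>). (x, \<one>\<^bsub>H1\<^esub>, \<xi>, 0))"

definition vertical :: "'h0 \<times> 'h1 \<times> 'v0 \<times> 'v1 \<Rightarrow> 'h0 \<times> 'h1 \<times> 'v0 \<times> 'v1 \<Rightarrow> 'h0 \<times> 'h1 \<times> 'v0 \<times> 'v1" where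
  "vertical = (\<lambda>(y, b, \<eta>, n) (x, a, \<xi>, m). (x, b \<otimes>\<^bsub>H1\<^esub> a, \<xi>, m + n))"

lemma objs_simps [simp]:
  "(x, \<xi>) \<in> carrier objs \<longleftrightarrow> x \<in> carrier H0"
  "(x, \<xi>) \<otimes>\<^bsub>objs\<^esub> (y, \<eta>) = (x \<otimes>\<^bsub>H0\<^esub> y, \<xi> + A0 x \<eta>)"
  "\<one>\<^bsub>objs\<^esub> = (\<one>\<^bsub>H0\<^esub>, 0)" "mfd objs = product_manifold (mfd H0) vector_manifold"
  by (simp_all add: objs_def)

lemma arrs_simps [simp]:
  "(x, a, \<xi>, m) \<in> carrier arrs \<longleftrightarrow> x \<in> carrier H0 \<and> a \<in> carrier H1"
  "(x, a, \<xi>, m) \<otimes>\<^bsub>arrs\<^esub> (y, b, \<eta>, n) = (x \<otimes>\<^bsub>H0\<^esub> y, a \<otimes>\<^bsub>H1\<^esub> \<Phi> x b, \<xi> + A0 x \<eta>,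
      m + A1 (t a \<otimes>\<^bsub>H0\<^esub> x) n + N a (A0 x \<eta>))"
  "\<one>\<^bsub>arrs\<^esub> = (\<one>\<^bsub>H0\<^esub>, \<one>\<^bsub>H1\<^esub>, 0, 0)"
  "mfd arrs = product_manifold (mfd H0)
      (product_manifold (mfd H1) (product_manifold vector_manifold vector_manifold))"
  by (simp_all add: arrs_def)

lemma structure_simps [simp]:
  "source (x, a, \<xi>, m) = (x, \<xi>)" "target (x, a, \<xi>, m) = (t a \<otimes>\<^bsub>H0\<^esub> x, \<xi> + d m)"
  "unit_arrow (x, \<xi>) = (x, \<one>\<^bsub>H1\<^esub>, \<xi>, 0)"
  "vertical (y, b, \<eta>, n) (x, a, \<xi>, m) = (x, b \<otimes>\<^bsub>H1\<^esub> a, \<xi>, m + n)"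
  by (simp_all add: source_def target_def unit_arrow_def vertical_def)

lemma group_objs: "group objs"
proof (rule groupI)
  fix p assume "p \<in> carrier objs"
  then obtain x \<xi> where p: "p = (x, \<xi>)" "x \<in> carrier H0" by (cases p) auto
  show "\<exists>q\<in>carrier objs. q \<otimes>\<^bsub>objs\<^esub> p = \<one>\<^bsub>objs\<^esub>"
    by (rule bexI[of _ "(inv\<^bsub>H0\<^esub> x, - A0 (inv\<^bsub>H0\<^esub> x) \<xi>)"]) (use p in \<open>simp_all\<close>)
qed (auto simp: H0.m_assoc A_mult blin algebra_simps)

lemma inv_objs:
  assumes "x \<in> carrier H0"
  shows "inv\<^bsub>objs\<^esub> (x, \<xi>) = (inv\<^bsub>H0\<^esub> x, - A0 (inv\<^bsub>H0\<^esub> x) \<xi>)"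
  by (rule group.inv_equality[OF group_objs]) (use assms in simp_all)

lemma arrs_left_inverse:
  assumes x: "x \<in> carrier H0" and a: "a \<in> carrier H1"
  shows "(inv\<^bsub>H0\<^esub> x, \<Phi> (inv\<^bsub>H0\<^esub> x) (inv\<^bsub>H1\<^esub> a), - A0 (inv\<^bsub>H0\<^esub> x) \<xi>,
      - A1 (inv\<^bsub>H0\<^esub> (t a \<otimes>\<^bsub>H0\<^esub> x)) m + A1 (inv\<^bsub>H0\<^esub> (t a \<otimes>\<^bsub>H0\<^esub> x)) (N a \<xi>))
    \<otimes>\<^bsub>arrs\<^esub> (x, a, \<xi>, m) = \<one>\<^bsub>arrs\<^esub>"
proof -
  have 1: "\<Phi> (inv\<^bsub>H0\<^esub> x) (inv\<^bsub>H1\<^esub> a) \<otimes>\<^bsub>H1\<^esub> \<Phi> (inv\<^bsub>H0\<^esub> x) a = \<one>\<^bsub>H1\<^esub>"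
    using x a by (simp flip: \<Phi>_mult)
  \<comment> \<open>The claimed inverse acts on \<open>V1\<close> through the inverse of the
    \<open>H0\<close> component of the target, which explains the operator in its last
    component.\<close>
  have 2: "t (\<Phi> (inv\<^bsub>H0\<^esub> x) (inv\<^bsub>H1\<^esub> a)) \<otimes>\<^bsub>H0\<^esub> inv\<^bsub>H0\<^esub> x = inv\<^bsub>H0\<^esub> (t a \<otimes>\<^bsub>H0\<^esub> x)"
    using x a by (simp add: xm.bd_act t_inv H0.inv_mult_group H0.m_assoc)
  have "N (inv\<^bsub>H1\<^esub> a) \<xi> + A1 (t (inv\<^bsub>H1\<^esub> a)) (N a \<xi>) = 0"
    using N_mult[of "inv\<^bsub>H1\<^esub> a" a \<xi>] a by (simp add: \<Psi>0_t add.assoc)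
  then have "A1 (inv\<^bsub>H0\<^esub> x) (N (inv\<^bsub>H1\<^esub> a) \<xi> + A1 (t (inv\<^bsub>H1\<^esub> a)) (N a \<xi>)) = 0"
    by (simp add: blin)
  then have 3: "A1 (inv\<^bsub>H0\<^esub> (t a \<otimes>\<^bsub>H0\<^esub> x)) (N a \<xi>) + N (\<Phi> (inv\<^bsub>H0\<^esub> x) (inv\<^bsub>H1\<^esub> a)) (A0 (inv\<^bsub>H0\<^esub> x) \<xi>) = 0"
    using x a by (simp add: N_\<Phi> H0.inv_mult_group A_mult t_inv blin add.commute)
  show ?thesis using x a 3 by (simp add: 1 2)
qed

lemma group_arrs: "group arrs"
proof (rule groupI)
  fix p assume "p \<in> carrier arrs"
  then obtain x a \<xi> m where p: "p = (x, a, \<xi>, m)" and x: "x \<in> carrier H0" and a: "a \<in> carrier H1"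
    by (cases p) auto
  show "\<exists>q\<in>carrier arrs. q \<otimes>\<^bsub>arrs\<^esub> p = \<one>\<^bsub>arrs\<^esub>"
    unfolding p using x a by (intro bexI, rule arrs_left_inverse) simp_all
next
  fix p q r assume "p \<in> carrier arrs" "q \<in> carrier arrs" "r \<in> carrier arrs"
  then obtain x a \<xi> m y b \<eta> n z c \<zeta> l where p: "p = (x, a, \<xi>, m)" "q = (y, b, \<eta>, n)" "r = (z, c, \<zeta>, l)"
    and x: "x \<in> carrier H0" "y \<in> carrier H0" "z \<in> carrier H0"
    and a: "a \<in> carrier H1" "b \<in> carrier H1" "c \<in> carrier H1"
    by (cases p, cases q, cases r) auto
  \<comment> \<open>This is the off-diagonal block of the statement that the pairs
    \<open>(x, a)\<close> act: after \<open>N_\<Phi>\<close>, the linear and quadratic terms in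
    \<open>b\<close> combine to \<open>A1 (t a)\<close> by \<open>\<Psi>0_t\<close>.\<close>
  have 1: "N (a \<otimes>\<^bsub>H1\<^esub> \<Phi> x b) (A0 (x \<otimes>\<^bsub>H0\<^esub> y) \<zeta>)
      = N a (A0 x (A0 y \<zeta>)) + A1 (t a \<otimes>\<^bsub>H0\<^esub> x) (N b (A0 y \<zeta>))"
    using x a by (simp add: N_mult A_mult N_\<Phi> \<Psi>0_t add.assoc)
  show "p \<otimes>\<^bsub>arrs\<^esub> q \<otimes>\<^bsub>arrs\<^esub> r = p \<otimes>\<^bsub>arrs\<^esub> (q \<otimes>\<^bsub>arrs\<^esub> r)"
    unfolding p arrs_simps target_mult[OF x(1,2) a(1,2)] 1
    using x a by (simp add: H0.m_assoc H1.m_assoc \<Phi>_mult xm.act_mult A_mult blin algebra_simps)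
qed (auto simp: xm.act_one)

lemma inv_arrs:
  assumes "x \<in> carrier H0" "a \<in> carrier H1"
  shows "inv\<^bsub>arrs\<^esub> (x, a, \<xi>, m) = (inv\<^bsub>H0\<^esub> x, \<Phi> (inv\<^bsub>H0\<^esub> x) (inv\<^bsub>H1\<^esub> a), - A0 (inv\<^bsub>H0\<^esub> x) \<xi>,
      - A1 (inv\<^bsub>H0\<^esub> (t a \<otimes>\<^bsub>H0\<^esub> x)) m + A1 (inv\<^bsub>H0\<^esub> (t a \<otimes>\<^bsub>H0\<^esub> x)) (N a \<xi>))"
  by (rule group.inv_equality[OF group_arrs arrs_left_inverse[OF assms]]) (use assms in simp_all)

lemma source_hom: "source \<in> hom arrs objs"
  by (rule homI) auto

lemma target_hom: "target \<in> hom arrs objs"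
proof (rule homI)
  fix p q assume "p \<in> carrier arrs" "q \<in> carrier arrs"
  then obtain x a \<xi> m y b \<eta> n where p: "p = (x, a, \<xi>, m)" "q = (y, b, \<eta>, n)"
    and x: "x \<in> carrier H0" "y \<in> carrier H0" and a: "a \<in> carrier H1" "b \<in> carrier H1"
    by (cases p, cases q) auto
  show "target (p \<otimes>\<^bsub>arrs\<^esub> q) = target p \<otimes>\<^bsub>objs\<^esub> target q"
    unfolding p arrs_simps structure_simps objs_simps target_mult[OF x a]
    using x a by (simp add: d_A1 A_mult \<Psi>0_t blin algebra_simps)
qed auto

lemma unit_arrow_hom: "unit_arrow \<in> hom objs arrs"
  by (rule homI) auto

lemma vertical_interchange:
  assumes "g \<in> carrier arrs" "f \<in> carrier arrs" "g' \<in> carrier arrs" "f' \<in> carrier arrs"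
    and "source g = target f" "source g' = target f'"
  shows "vertical (g \<otimes>\<^bsub>arrs\<^esub> g') (f \<otimes>\<^bsub>arrs\<^esub> f') = vertical g f \<otimes>\<^bsub>arrs\<^esub> vertical g' f'"
proof -
  obtain x a \<xi> m y b \<eta> n where f: "f = (x, a, \<xi>, m)" "f' = (y, b, \<eta>, n)"
    and x: "x \<in> carrier H0" "y \<in> carrier H0" and a: "a \<in> carrier H1" "b \<in> carrier H1"
    using assms by (cases f, cases f') auto
  \<comment> \<open>Composability fixes the \<open>H0\<close> and \<open>V0\<close> components of
    \<open>g\<close> and \<open>g'\<close>.\<close>
  obtain a' m' b' n' where g: "g = (t a \<otimes>\<^bsub>H0\<^esub> x, a', \<xi> + d m, m')" "g' = (t b \<otimes>\<^bsub>H0\<^esub> y, b', \<eta> + d n, n')"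
    and a': "a' \<in> carrier H1" "b' \<in> carrier H1"
    using assms f by (cases g, cases g') auto
  have 1: "a' \<otimes>\<^bsub>H1\<^esub> \<Phi> (t a \<otimes>\<^bsub>H0\<^esub> x) b' \<otimes>\<^bsub>H1\<^esub> (a \<otimes>\<^bsub>H1\<^esub> \<Phi> x b)
      = a' \<otimes>\<^bsub>H1\<^esub> a \<otimes>\<^bsub>H1\<^esub> \<Phi> x (b' \<otimes>\<^bsub>H1\<^esub> b)"
  proof -
    have "\<Phi> (t a \<otimes>\<^bsub>H0\<^esub> x) b' \<otimes>\<^bsub>H1\<^esub> (a \<otimes>\<^bsub>H1\<^esub> \<Phi> x b) = a \<otimes>\<^bsub>H1\<^esub> \<Phi> x b' \<otimes>\<^bsub>H1\<^esub> \<Phi> x b"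
      using \<Phi>_target[OF x(1) a(1) a'(2)] x a a' by (simp flip: H1.m_assoc)
    then show ?thesis using x a a' by (simp add: H1.m_assoc \<Phi>_mult)
  qed
  have 2: "m + A1 (t a \<otimes>\<^bsub>H0\<^esub> x) n + N a (A0 x \<eta>)
      + (m' + A1 (t a' \<otimes>\<^bsub>H0\<^esub> (t a \<otimes>\<^bsub>H0\<^esub> x)) n' + N a' (A0 (t a \<otimes>\<^bsub>H0\<^esub> x) (\<eta> + d n)))
    = m + m' + A1 (t (a' \<otimes>\<^bsub>H1\<^esub> a) \<otimes>\<^bsub>H0\<^esub> x) (n + n') + N (a' \<otimes>\<^bsub>H1\<^esub> a) (A0 x \<eta>)"
  proof -
    let ?s = "t a \<otimes>\<^bsub>H0\<^esub> x"
    have s: "?s \<in> carrier H0" using x a by simp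
    have "t (a' \<otimes>\<^bsub>H1\<^esub> a) \<otimes>\<^bsub>H0\<^esub> x = t a' \<otimes>\<^bsub>H0\<^esub> ?s" using x a a' by (simp add: t_mult H0.m_assoc)
    moreover have "A1 (t a' \<otimes>\<^bsub>H0\<^esub> ?s) n = A1 ?s n + N a' (A0 ?s (d n))"
      using s a' by (simp add: A_mult(2)[of "t a'"] \<Psi>0_t d_A1)
    moreover have "N (a' \<otimes>\<^bsub>H1\<^esub> a) (A0 x \<eta>) = N a (A0 x \<eta>) + N a' (A0 ?s \<eta>)"
      using x a a' by (simp add: N_mult A_mult \<Psi>0_t blin)
    ultimately show ?thesis by (simp add: blin)
  qed
  show ?thesis
    unfolding f g arrs_simps structure_simps 1 2 by simp
qed

section \<open>Smoothness of the structure maps\<close>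

abbreviation "M0 \<equiv> mfd H0"
abbreviation "M1 \<equiv> mfd H1"
abbreviation "VV0 \<equiv> (vector_manifold :: ('v0, 'v0) manifold)"
abbreviation "VV1 \<equiv> (vector_manifold :: ('v1, 'v1) manifold)"
abbreviation "MO \<equiv> product_manifold M0 VV0"
abbreviation "MA \<equiv> product_manifold M0 (product_manifold M1 (product_manifold VV0 VV1))"

lemmas manifolds [intro!, simp] =
  H0.manifold H1.manifold smooth_manifold_vector[OF fin0] smooth_manifold_vector[OF fin1]
  smooth_manifold_product

lemma carrier_simps [simp]:
  "topspace (mtop M0) = carrier H0" "topspace (mtop M1) = carrier H1"
  using H0.carrier_eq H1.carrier_eq by simp_all

lemma carrier_mfd: "carrier objs = topspace (mtop MO)" "carrier arrs = topspace (mtop MA)"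
  by (simp_all add: objs_def arrs_def)

lemma smooth_mult0:
  "smooth_manifold R \<Longrightarrow> smooth_map R M0 f \<Longrightarrow> smooth_map R M0 g \<Longrightarrow>
    smooth_map R M0 (\<lambda>p. f p \<otimes>\<^bsub>H0\<^esub> g p)"
  by (rule smooth_map_Pair_compose[OF _ _ _ _ H0.smooth_mult]) simp_all

lemma smooth_mult1:
  "smooth_manifold R \<Longrightarrow> smooth_map R M1 f \<Longrightarrow> smooth_map R M1 g \<Longrightarrow>
    smooth_map R M1 (\<lambda>p. f p \<otimes>\<^bsub>H1\<^esub> g p)"
  by (rule smooth_map_Pair_compose[OF _ _ _ _ H1.smooth_mult]) simp_all

lemma smooth_act:
  "smooth_manifold R \<Longrightarrow> smooth_map R M0 f \<Longrightarrow> smooth_map R M1 g \<Longrightarrow>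
    smooth_map R M1 (\<lambda>p. \<Phi> (f p) (g p))"
  by (rule smooth_map_Pair_compose[OF _ _ _ _ xm.act_smooth]) simp_all

lemma smooth_inv0:
  "smooth_manifold R \<Longrightarrow> smooth_map R M0 f \<Longrightarrow> smooth_map R M0 (\<lambda>p. inv\<^bsub>H0\<^esub> (f p))"
  by (rule smooth_map_compose[OF _ _ _ _ H0.smooth_inv]) simp_all

lemma smooth_inv1:
  "smooth_manifold R \<Longrightarrow> smooth_map R M1 f \<Longrightarrow> smooth_map R M1 (\<lambda>p. inv\<^bsub>H1\<^esub> (f p))"
  by (rule smooth_map_compose[OF _ _ _ _ H1.smooth_inv]) simp_all

lemma smooth_t:
  "smooth_manifold R \<Longrightarrow> smooth_map R M1 f \<Longrightarrow> smooth_map R M0 (\<lambda>p. t (f p))"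
  by (rule smooth_map_compose[OF _ _ _ _ t_smooth]) simp_all

lemma smooth_map_vector_compose:
  assumes "smooth_manifold R" "smooth_manifold M" "smooth_map R M f" "smooth_map M vector_manifold B"
  shows "smooth_map R vector_manifold (\<lambda>p. B (f p))"
  by (rule smooth_map_compose_into_open_charts[OF assms(1,2) _ assms(3,4)]) simp

lemma smooth_\<Psi>0: "smooth_map M0 vector_manifold \<Psi>0"
proof -
  have "smooth_map M0 (mfd (aut0 d)) \<Psi>0"
    using \<Psi> by (simp add: strict_xmod_morphism_def lie_morphism_def aut_xmod_def)
  then show ?thesis
    unfolding aut0_def Let_def by (simp add: smooth_map_into_open_imp_vector[OF H0.manifold])
qed

lemma smooth_\<Psi>1: "smooth_map M1 vector_manifold \<Psi>1"
proof -
  have "smooth_map M1 (mfd (aut1 d)) \<Psi>1"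
    using \<Psi> by (simp add: strict_xmod_morphism_def lie_morphism_def aut_xmod_def)
  then show ?thesis
    unfolding aut1_def Let_def by (simp add: smooth_map_into_open_imp_vector[OF H1.manifold])
qed

text \<open>Evaluation of an operator at a vector is bounded bilinear, so smoothness of the
  operator-valued map suffices.\<close>

lemma smooth_A0:
  assumes "smooth_manifold R" "smooth_map R M0 f" "smooth_map R VV0 g"
  shows "smooth_map R VV0 (\<lambda>p. A0 (f p) (g p))"
  by (rule smooth_map_bilinear[OF bounded_bilinear_blinfun_apply
        smooth_map_bounded_linear[OF bounded_linear_fst
          smooth_map_vector_compose[OF assms(1) H0.manifold assms(2) smooth_\<Psi>0]] assms(3)])

lemma smooth_A1:
  assumes "smooth_manifold R" "smooth_map R M0 f" "smooth_map R VV1 g"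
  shows "smooth_map R VV1 (\<lambda>p. A1 (f p) (g p))"
  by (rule smooth_map_bilinear[OF bounded_bilinear_blinfun_apply
        smooth_map_bounded_linear[OF bounded_linear_snd
          smooth_map_vector_compose[OF assms(1) H0.manifold assms(2) smooth_\<Psi>0]] assms(3)])

lemma smooth_N:
  assumes "smooth_manifold R" "smooth_map R M1 f" "smooth_map R VV0 g"
  shows "smooth_map R VV1 (\<lambda>p. N (f p) (g p))"
  by (rule smooth_map_bilinear[OF bounded_bilinear_blinfun_apply
        smooth_map_vector_compose[OF assms(1) H1.manifold assms(2) smooth_\<Psi>1] assms(3)])

lemma smooth_d: "smooth_map R VV1 f \<Longrightarrow> smooth_map R VV0 (\<lambda>p. d (f p))"
  by (rule smooth_map_bounded_linear[OF blinfun.bounded_linear_right])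

lemma smooth_minus0: "smooth_map R VV0 f \<Longrightarrow> smooth_map R VV0 (\<lambda>p. - f p)"
  by (rule smooth_map_bounded_linear[OF bounded_linear_minus[OF bounded_linear_ident]])

lemma smooth_minus1: "smooth_map R VV1 f \<Longrightarrow> smooth_map R VV1 (\<lambda>p. - f p)"
  by (rule smooth_map_bounded_linear[OF bounded_linear_minus[OF bounded_linear_ident]])

lemma smooth_constants:
  "smooth_map R M1 (\<lambda>_. \<one>\<^bsub>H1\<^esub>)" "smooth_map R VV0 (\<lambda>_. \<xi>)" "smooth_map R VV1 (\<lambda>_. m)"
  "a \<in> carrier H1 \<Longrightarrow> smooth_map R M1 (\<lambda>_. a)"
  by (simp_all add: smooth_map_const)

text \<open>Closure rules for backward application: once a structure map is written with projections
  instead of pattern matching, its smoothness follows along its syntax.\<close>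

lemmas smooth_ops = smooth_mult0 smooth_mult1 smooth_act smooth_inv0 smooth_inv1 smooth_t
  smooth_A0 smooth_A1 smooth_N smooth_d smooth_minus0 smooth_minus1 smooth_constants
  smooth_map_add smooth_map_Pair

lemma smooth_object_components:
  assumes "smooth_manifold R" "smooth_map R MO f"
  shows "smooth_map R M0 (\<lambda>p. fst (f p))" "smooth_map R VV0 (\<lambda>p. snd (f p))"
  using smooth_map_product_components[OF assms(1) _ _ assms(2)] by simp_all

lemma smooth_arrow_components:
  assumes R: "smooth_manifold R" and f: "smooth_map R MA f"
  shows "smooth_map R M0 (\<lambda>p. fst (f p))" "smooth_map R M1 (\<lambda>p. fst (snd (f p)))"
    "smooth_map R VV0 (\<lambda>p. fst (snd (snd (f p))))" "smooth_map R VV1 (\<lambda>p. snd (snd (snd (f p))))"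
proof -
  have M: "smooth_manifold (product_manifold M1 (product_manifold VV0 VV1))"
    "smooth_manifold (product_manifold VV0 VV1)" "smooth_manifold VV0" "smooth_manifold VV1" by simp_all
  note 1 = smooth_map_product_components[OF R H0.manifold M(1) f]
  note 2 = smooth_map_product_components[OF R H1.manifold M(2) 1(2)]
  note 3 = smooth_map_product_components[OF R M(3,4) 2(2)]
  show "smooth_map R M0 (\<lambda>p. fst (f p))" "smooth_map R M1 (\<lambda>p. fst (snd (f p)))"
    "smooth_map R VV0 (\<lambda>p. fst (snd (snd (f p))))" "smooth_map R VV1 (\<lambda>p. snd (snd (snd (f p))))"
    by (rule 1 2 3)+
qed

lemma MA_manifold: "smooth_manifold MA" and MO_manifold: "smooth_manifold MO"
  by simp_all

lemmas arrow_components = smooth_arrow_components[OF MA_manifold smooth_map_ident[OF MA_manifold]]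
lemmas object_components = smooth_object_components[OF MO_manifold smooth_map_ident[OF MO_manifold]]

lemma smooth_source: "smooth_map MA MO source"
proof -
  have eq: "source = (\<lambda>p. (fst p, fst (snd (snd p))))" by (simp add: fun_eq_iff source_def)
  show ?thesis unfolding eq
    by (intro smooth_ops arrow_components)
qed

lemma smooth_target: "smooth_map MA MO target"
proof -
  have eq: "target = (\<lambda>p. (t (fst (snd p)) \<otimes>\<^bsub>H0\<^esub> fst p, fst (snd (snd p)) + d (snd (snd (snd p)))))"
    by (simp add: fun_eq_iff target_def)
  show ?thesis unfolding eq
    by (intro smooth_ops arrow_components MA_manifold)
qed

lemma smooth_unit_arrow: "smooth_map MO MA unit_arrow"
proof -
  have eq: "unit_arrow = (\<lambda>p. (fst p, \<one>\<^bsub>H1\<^esub>, snd p, 0))" by (simp add: fun_eq_iff unit_arrow_def)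
  show ?thesis unfolding eq
    by (intro smooth_ops object_components)
qed

lemma smooth_vertical:
  assumes R: "smooth_manifold R" and g: "smooth_map R MA g" and f: "smooth_map R MA f"
  shows "smooth_map R MA (\<lambda>p. vertical (g p) (f p))"
proof -
  have eq: "(\<lambda>p. vertical (g p) (f p)) = (\<lambda>p. (fst (f p), fst (snd (g p)) \<otimes>\<^bsub>H1\<^esub> fst (snd (f p)),
      fst (snd (snd (f p))), snd (snd (snd (f p))) + snd (snd (snd (g p)))))"
    by (simp add: fun_eq_iff vertical_def split_beta)
  show ?thesis unfolding eq
    by (intro smooth_ops smooth_arrow_components[OF R f] smooth_arrow_components[OF R g] R)
qed

lemma smooth_arrs_mult:
  assumes R: "smooth_manifold R" and f: "smooth_map R MA f" and g: "smooth_map R MA g"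
  shows "smooth_map R MA (\<lambda>p. f p \<otimes>\<^bsub>arrs\<^esub> g p)"
proof -
  have eq: "(\<lambda>p. f p \<otimes>\<^bsub>arrs\<^esub> g p) = (\<lambda>p. (fst (f p) \<otimes>\<^bsub>H0\<^esub> fst (g p),
      fst (snd (f p)) \<otimes>\<^bsub>H1\<^esub> \<Phi> (fst (f p)) (fst (snd (g p))),
      fst (snd (snd (f p))) + A0 (fst (f p)) (fst (snd (snd (g p)))),
      snd (snd (snd (f p))) + A1 (t (fst (snd (f p))) \<otimes>\<^bsub>H0\<^esub> fst (f p)) (snd (snd (snd (g p))))
        + N (fst (snd (f p))) (A0 (fst (f p)) (fst (snd (snd (g p)))))))"
    by (simp add: fun_eq_iff arrs_def split_beta)
  show ?thesis unfolding eq
    by (intro smooth_ops smooth_arrow_components[OF R f] smooth_arrow_components[OF R g] R)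
qed

text \<open>The explicit formula describes the inverse only on the carrier, so it is transferred by
  agreement on the points of the manifold.\<close>

lemma smooth_arrs_inv:
  assumes R: "smooth_manifold R" and f: "smooth_map R MA f"
  shows "smooth_map R MA (\<lambda>p. inv\<^bsub>arrs\<^esub> (f p))"
proof (rule smooth_map_cong[OF R])
  show "smooth_map R MA (\<lambda>p. (inv\<^bsub>H0\<^esub> fst (f p),
      \<Phi> (inv\<^bsub>H0\<^esub> fst (f p)) (inv\<^bsub>H1\<^esub> fst (snd (f p))),
      - A0 (inv\<^bsub>H0\<^esub> fst (f p)) (fst (snd (snd (f p)))),
      - A1 (inv\<^bsub>H0\<^esub> (t (fst (snd (f p))) \<otimes>\<^bsub>H0\<^esub> fst (f p))) (snd (snd (snd (f p))))
      + A1 (inv\<^bsub>H0\<^esub> (t (fst (snd (f p))) \<otimes>\<^bsub>H0\<^esub> fst (f p))) (N (fst (snd (f p))) (fst (snd (snd (f p)))))))"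
    by (intro smooth_ops smooth_arrow_components[OF R f] R)
  fix p assume "p \<in> topspace (mtop R)"
  then have "f p \<in> carrier arrs" using smooth_map_in_topspace[OF f] by (simp only: carrier_mfd)
  then obtain x a \<xi> m where "f p = (x, a, \<xi>, m)" "x \<in> carrier H0" "a \<in> carrier H1"
    by (cases "f p") auto
  then show "inv\<^bsub>arrs\<^esub> f p = (inv\<^bsub>H0\<^esub> fst (f p),
      \<Phi> (inv\<^bsub>H0\<^esub> fst (f p)) (inv\<^bsub>H1\<^esub> fst (snd (f p))),
      - A0 (inv\<^bsub>H0\<^esub> fst (f p)) (fst (snd (snd (f p)))),
      - A1 (inv\<^bsub>H0\<^esub> (t (fst (snd (f p))) \<otimes>\<^bsub>H0\<^esub> fst (f p))) (snd (snd (snd (f p))))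
      + A1 (inv\<^bsub>H0\<^esub> (t (fst (snd (f p))) \<otimes>\<^bsub>H0\<^esub> fst (f p))) (N (fst (snd (f p))) (fst (snd (snd (f p))))))"
    by (simp add: inv_arrs)
qed

lemma lie_group_arrs: "lie_group arrs"
proof (rule lie_group.intro[OF group_arrs lie_group_axioms.intro])
  have MM: "smooth_manifold (product_manifold MA MA)" by simp
  have "smooth_map (product_manifold MA MA) MA (\<lambda>r. fst r \<otimes>\<^bsub>arrs\<^esub> snd r)"
    by (rule smooth_arrs_mult[OF MM smooth_map_fst[OF MA_manifold MA_manifold]
          smooth_map_snd[OF MA_manifold MA_manifold]])
  then show "smooth_map (product_manifold (mfd arrs) (mfd arrs)) (mfd arrs) (\<lambda>(x, y). x \<otimes>\<^bsub>arrs\<^esub> y)"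
    by (simp only: arrs_simps case_prod_unfold)
  show "smooth_map (mfd arrs) (mfd arrs) (\<lambda>x. inv\<^bsub>arrs\<^esub> x)"
    using smooth_arrs_inv[OF MA_manifold smooth_map_ident[OF MA_manifold]] by (simp only: arrs_simps)
qed (simp_all only: arrs_simps MA_manifold carrier_mfd)

lemma lie_group_objs: "lie_group objs"
proof (rule lie_group.intro[OF group_objs lie_group_axioms.intro])
  have MM: "smooth_manifold (product_manifold MO MO)" by simp
  note c = smooth_object_components[OF MM smooth_map_fst[OF MO_manifold MO_manifold]]
    smooth_object_components[OF MM smooth_map_snd[OF MO_manifold MO_manifold]]
  have "smooth_map (product_manifold MO MO) MO (\<lambda>r. (fst (fst r) \<otimes>\<^bsub>H0\<^esub> fst (snd r),
      snd (fst r) + A0 (fst (fst r)) (snd (snd r))))"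
    by (intro smooth_ops c MM)
  then show "smooth_map (product_manifold (mfd objs) (mfd objs)) (mfd objs) (\<lambda>(x, y). x \<otimes>\<^bsub>objs\<^esub> y)"
    by (simp add: case_prod_unfold objs_def)
  have "smooth_map MO MO (\<lambda>p. inv\<^bsub>objs\<^esub> p)"
  proof (rule smooth_map_cong[OF MO_manifold])
    show "smooth_map MO MO (\<lambda>p. (inv\<^bsub>H0\<^esub> fst p, - A0 (inv\<^bsub>H0\<^esub> fst p) (snd p)))"
      by (intro smooth_ops object_components MO_manifold)
  qed (auto simp: inv_objs)
  then show "smooth_map (mfd objs) (mfd objs) (\<lambda>x. inv\<^bsub>objs\<^esub> x)" by (simp only: objs_simps)
qed (simp_all only: objs_simps MO_manifold carrier_mfd)

lemma submersion_source: "submersion MA MO source"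
proof (rule submersionI[OF MA_manifold MO_manifold smooth_source])
  fix p assume "p \<in> topspace (mtop MA)"
  then obtain x a \<xi> m where p: "p = (x, a, \<xi>, m)" "a \<in> carrier H1" by (cases p) auto
  \<comment> \<open>The section through \<open>p\<close> freezes the components \<open>a\<close> and
    \<open>m\<close> of \<open>p\<close>.\<close>
  have "smooth_map MO MA (\<lambda>q. (fst q, a, snd q, m))"
    using p(2) by (intro smooth_ops object_components)
  then show "\<exists>\<sigma>. smooth_map MO MA \<sigma> \<and> \<sigma> (source p) = p \<and> (\<forall>q\<in>topspace (mtop MO). source (\<sigma> q) = q)"
    by (intro exI[of _ "\<lambda>q. (fst q, a, snd q, m)"]) (simp add: p)
qed

lemma submersion_target: "submersion MA MO target"
proof (rule submersionI[OF MA_manifold MO_manifold smooth_target])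
  fix p assume "p \<in> topspace (mtop MA)"
  then obtain x a \<xi> m where p: "p = (x, a, \<xi>, m)" "a \<in> carrier H1" "x \<in> carrier H0" by (cases p) auto
  \<comment> \<open>With \<open>a\<close> and \<open>m\<close> frozen, the other two components
    solve \<open>target p' = q\<close> for the \<open>H0\<close> and \<open>V0\<close> components of
    \<open>p'\<close>. Subtraction is written as a sum with a negative to match the closure
    rules.\<close>
  have "smooth_map MO MA (\<lambda>q. (inv\<^bsub>H0\<^esub> (t a) \<otimes>\<^bsub>H0\<^esub> fst q, a, snd q + - d m, m))"
    using p(2) by (intro smooth_ops object_components MO_manifold)
  then show "\<exists>\<sigma>. smooth_map MO MA \<sigma> \<and> \<sigma> (target p) = p \<and> (\<forall>q\<in>topspace (mtop MO). target (\<sigma> q) = q)"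
    by (intro exI[of _ "\<lambda>q. (inv\<^bsub>H0\<^esub> (t a) \<otimes>\<^bsub>H0\<^esub> fst q, a, snd q + - d m, m)"])
      (use p in \<open>auto simp: H0_cancel\<close>)
qed

section \<open>The Lie group of composable pairs\<close>

abbreviation "MQ \<equiv> product_manifold (product_manifold M1 VV1) MA"

definition pair_embedding :: "('h1 \<times> 'v1) \<times> 'h0 \<times> 'h1 \<times> 'v0 \<times> 'v1 \<Rightarrow>
    ('h0 \<times> 'h1 \<times> 'v0 \<times> 'v1) \<times> ('h0 \<times> 'h1 \<times> 'v0 \<times> 'v1)" where
  "pair_embedding q = ((fst (target (snd q)), fst (fst q), snd (target (snd q)), snd (fst q)), snd q)"

text \<open>The type is polymorphic because the same formula serves as retraction on pairs of arrows
  and as the linear left inverse on the model spaces.\<close>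

definition pair_retraction :: "('a \<times> 'b \<times> 'c \<times> 'd) \<times> 'g \<Rightarrow> ('b \<times> 'd) \<times> 'g" where
  "pair_retraction p = ((fst (snd (fst p)), snd (snd (snd (fst p)))), snd p)"

text \<open>\<open>pair_embedding\<close> is not linear, so the model spaces get an embedding of
  their own; zeros fill the slots that composability determines.\<close>

definition model_embedding :: "('b \<times> 'd) \<times> 'g \<Rightarrow> ('a::zero \<times> 'b \<times> 'c::zero \<times> 'd) \<times> 'g" where
  "model_embedding q = ((0, fst (fst q), 0, snd (fst q)), snd q)"

lemma smooth_pair_embedding: "smooth_map MQ (product_manifold MA MA) pair_embedding"
proof -
  have Q: "smooth_manifold MQ" and V: "smooth_manifold (product_manifold M1 VV1)" by simp_all
  note 1 = smooth_map_product_components[OF Q V MA_manifold smooth_map_ident[OF Q]]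
  note 2 = smooth_map_product_components[OF Q H1.manifold smooth_manifold_vector[OF fin1] 1(1)]
  note 3 = smooth_object_components[OF Q smooth_map_compose[OF Q MA_manifold MO_manifold 1(2) smooth_target]]
  have "smooth_map MQ (product_manifold MA MA)
      (\<lambda>q. ((fst (target (snd q)), fst (fst q), snd (target (snd q)), snd (fst q)), snd q))"
    by (intro smooth_map_Pair 1(2) 2 3)
  then show ?thesis by (simp only: pair_embedding_def[abs_def])
qed

lemma smooth_pair_retraction: "smooth_map (product_manifold MA MA) MQ pair_retraction"
proof -
  have MM: "smooth_manifold (product_manifold MA MA)" by simp
  note 1 = smooth_arrow_components[OF MM smooth_map_fst[OF MA_manifold MA_manifold]]
  have "smooth_map (product_manifold MA MA) MQ
      (\<lambda>p. ((fst (snd (fst p)), snd (snd (snd (fst p)))), snd p))"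
    by (intro smooth_map_Pair 1 smooth_map_snd[OF MA_manifold MA_manifold])
  then show ?thesis by (simp only: pair_retraction_def[abs_def])
qed

sublocale composable: retractable_embedding MQ "product_manifold MA MA"
  pair_embedding pair_retraction model_embedding pair_retraction
proof (rule retractable_embedding.intro)
  show "bounded_linear (model_embedding :: _ \<Rightarrow> ('e0 \<times> 'e1 \<times> 'v0 \<times> 'v1) \<times> ('e0 \<times> 'e1 \<times> 'v0 \<times> 'v1))"
    unfolding model_embedding_def[abs_def]
    by (intro bounded_linear_Pair bounded_linear_zero bounded_linear_ident bounded_linear_fst bounded_linear_snd
        bounded_linear_compose[OF bounded_linear_fst bounded_linear_fst]
        bounded_linear_compose[OF bounded_linear_snd bounded_linear_fst])
  show "bounded_linear (pair_retraction :: ('e0 \<times> 'e1 \<times> 'v0 \<times> 'v1) \<times> ('e0 \<times> 'e1 \<times> 'v0 \<times> 'v1) \<Rightarrow> _)"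
    unfolding pair_retraction_def[abs_def]
    by (intro bounded_linear_Pair bounded_linear_snd bounded_linear_fst_comp bounded_linear_snd_comp bounded_linear_ident)
qed (simp_all add: smooth_pair_embedding smooth_pair_retraction pair_embedding_def pair_retraction_def
    model_embedding_def)

definition composable_pairs where
  "composable_pairs = {(g, f). g \<in> carrier arrs \<and> f \<in> carrier arrs \<and> source g = target f}"

lemma pair_embedding_image: "pair_embedding ` topspace (mtop MQ) = composable_pairs"
proof
  show "pair_embedding ` topspace (mtop MQ) \<subseteq> composable_pairs"
    by (auto simp: pair_embedding_def composable_pairs_def)
  show "composable_pairs \<subseteq> pair_embedding ` topspace (mtop MQ)"
  proof
    fix p assume "p \<in> composable_pairs"
    then obtain x a \<xi> m b n where p: "p = ((t a \<otimes>\<^bsub>H0\<^esub> x, b, \<xi> + d m, n), (x, a, \<xi>, m))"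
      "x \<in> carrier H0" "a \<in> carrier H1" "b \<in> carrier H1"
      by (auto simp: composable_pairs_def)
    then show "p \<in> pair_embedding ` topspace (mtop MQ)"
      by (intro image_eqI[of _ _ "((b, n), (x, a, \<xi>, m))"]) (simp_all add: pair_embedding_def)
  qed
qed

abbreviation "MP \<equiv> composable.image_manifold"

lemma topspace_MP: "topspace (mtop MP) = composable_pairs"
  by (simp only: composable.topspace_image pair_embedding_image)

lemma MP_manifold: "smooth_manifold MP"
  by (rule composable.smooth_manifold_image)

lemma composable_manifold_MP: "composable_manifold MA source target MP"
  unfolding composable_manifold_def topspace_MP
  using composable.embedded_submanifold_image
  by (simp only: composable_pairs_def carrier_mfd simp_thms)

lemma smooth_pair_components:
  assumes R: "smooth_manifold R" and f: "smooth_map R MP f"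
  shows "smooth_map R MA (\<lambda>p. fst (f p))" "smooth_map R MA (\<lambda>p. snd (f p))"
  by (rule smooth_map_product_components[OF R MA_manifold MA_manifold
        smooth_map_compose[OF R MP_manifold composable.N f composable.smooth_map_inclusion]])+

text \<open>The fibre product of the arrow group with itself over the objects. The operations are
  literally those of the direct product, since \<open>strict_lie_2group\<close> asks for equality
  with them and not merely on the carrier.\<close>

definition pairs :: "(('h0 \<times> 'h1 \<times> 'v0 \<times> 'v1) \<times> ('h0 \<times> 'h1 \<times> 'v0 \<times> 'v1),
    ('e0 \<times> 'e1 \<times> 'v0 \<times> 'v1) \<times> ('e0 \<times> 'e1 \<times> 'v0 \<times> 'v1)) lie_grp" where
  "pairs = \<lparr>carrier = composable_pairs, mult = mult (arrs \<times>\<times> arrs), one = one (arrs \<times>\<times> arrs), mfd = MP\<rparr>"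

lemma pairs_simps [simp]:
  "carrier pairs = composable_pairs" "(g, f) \<otimes>\<^bsub>pairs\<^esub> (g', f') = (g \<otimes>\<^bsub>arrs\<^esub> g', f \<otimes>\<^bsub>arrs\<^esub> f')"
  "\<one>\<^bsub>pairs\<^esub> = (\<one>\<^bsub>arrs\<^esub>, \<one>\<^bsub>arrs\<^esub>)" "mfd pairs = MP"
  by (simp_all add: pairs_def DirProd_def)

text \<open>Composable pairs are the equalizer of two homomorphisms, the source of the first and the
  target of the second component; closure under products and inverses follows from this.\<close>

lemma composable_pairs_mult:
  assumes "(g, f) \<in> composable_pairs" "(g', f') \<in> composable_pairs"
  shows "(g \<otimes>\<^bsub>arrs\<^esub> g', f \<otimes>\<^bsub>arrs\<^esub> f') \<in> composable_pairs"
proof -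
  have *: "g \<in> carrier arrs" "f \<in> carrier arrs" "g' \<in> carrier arrs" "f' \<in> carrier arrs"
    "source g = target f" "source g' = target f'"
    using assms by (auto simp only: composable_pairs_def)
  then show ?thesis
    unfolding composable_pairs_def mem_Collect_eq prod.case hom_mult[OF source_hom *(1,3)] hom_mult[OF target_hom *(2,4)]
    by (simp only: monoid.m_closed[OF group.is_monoid[OF group_arrs]] simp_thms)
qed

lemma composable_pairs_inv:
  assumes "(g, f) \<in> composable_pairs"
  shows "(inv\<^bsub>arrs\<^esub> g, inv\<^bsub>arrs\<^esub> f) \<in> composable_pairs"
proof -
  have *: "g \<in> carrier arrs" "f \<in> carrier arrs" "source g = target f"
    using assms by (auto simp only: composable_pairs_def)
  interpret s: group_hom arrs objs source
    using group_arrs group_objs source_hom by (simp add: group_hom_def group_hom_axioms_def)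
  interpret t: group_hom arrs objs target
    using group_arrs group_objs target_hom by (simp add: group_hom_def group_hom_axioms_def)
  show ?thesis
    unfolding composable_pairs_def mem_Collect_eq prod.case s.hom_inv[OF *(1)] t.hom_inv[OF *(2)]
    using * by (simp only: group.inv_closed[OF group_arrs] simp_thms)
qed

lemma group_pairs: "group pairs"
proof (rule groupI)
  fix p q r assume pqr: "p \<in> carrier pairs" "q \<in> carrier pairs" "r \<in> carrier pairs"
  obtain g f g' f' g'' f'' where "p = (g, f)" "q = (g', f')" "r = (g'', f'')"
    by (cases p, cases q, cases r)
  then show "p \<otimes>\<^bsub>pairs\<^esub> q \<otimes>\<^bsub>pairs\<^esub> r = p \<otimes>\<^bsub>pairs\<^esub> (q \<otimes>\<^bsub>pairs\<^esub> r)"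
    using pqr monoid.m_assoc[OF group.is_monoid[OF group_arrs]]
    by (simp del: arrs_simps add: composable_pairs_def)
next
  show "\<one>\<^bsub>pairs\<^esub> \<in> carrier pairs" by (simp add: composable_pairs_def)
next
  fix p assume p: "p \<in> carrier pairs"
  obtain g f where gf: "p = (g, f)" by (cases p)
  then show "\<one>\<^bsub>pairs\<^esub> \<otimes>\<^bsub>pairs\<^esub> p = p"
    using p monoid.l_one[OF group.is_monoid[OF group_arrs]]
    by (simp del: arrs_simps add: composable_pairs_def)
  show "\<exists>q\<in>carrier pairs. q \<otimes>\<^bsub>pairs\<^esub> p = \<one>\<^bsub>pairs\<^esub>"
    using p gf composable_pairs_inv[of g f] group.l_inv[OF group_arrs]
    by (intro bexI[of _ "(inv\<^bsub>arrs\<^esub> g, inv\<^bsub>arrs\<^esub> f)"]) (simp_all del: arrs_simps add: composable_pairs_def)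
next
  fix p q assume "p \<in> carrier pairs" "q \<in> carrier pairs"
  then show "p \<otimes>\<^bsub>pairs\<^esub> q \<in> carrier pairs"
    using composable_pairs_mult[of "fst p" "snd p" "fst q" "snd q"]
    by (cases p, cases q) (simp del: arrs_simps)
qed

lemma inv_pairs:
  assumes "(g, f) \<in> composable_pairs"
  shows "inv\<^bsub>pairs\<^esub> (g, f) = (inv\<^bsub>arrs\<^esub> g, inv\<^bsub>arrs\<^esub> f)"
  by (rule group.inv_equality[OF group_pairs])
    (use assms composable_pairs_inv[OF assms] group.l_inv[OF group_arrs] in
      \<open>simp_all del: arrs_simps add: composable_pairs_def\<close>)

text \<open>The operations are smooth into the square of \<open>MA\<close> componentwise. As they
  preserve composability, \<open>composable.smooth_map_into_image\<close> makes them smooth into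
  \<open>MP\<close>.\<close>

lemma lie_group_pairs: "lie_group pairs"
proof (rule lie_group.intro[OF group_pairs lie_group_axioms.intro])
  let ?R = "product_manifold MP MP"
  have R: "smooth_manifold ?R" by (rule smooth_manifold_product[OF MP_manifold MP_manifold])
  note 1 = smooth_pair_components[OF R smooth_map_fst[OF MP_manifold MP_manifold]]
  note 2 = smooth_pair_components[OF R smooth_map_snd[OF MP_manifold MP_manifold]]
  have "smooth_map ?R MP (\<lambda>r. (fst (fst r) \<otimes>\<^bsub>arrs\<^esub> fst (snd r), snd (fst r) \<otimes>\<^bsub>arrs\<^esub> snd (snd r)))"
  proof (rule composable.smooth_map_into_image[OF R])
    show "smooth_map ?R (product_manifold MA MA)
        (\<lambda>r. (fst (fst r) \<otimes>\<^bsub>arrs\<^esub> fst (snd r), snd (fst r) \<otimes>\<^bsub>arrs\<^esub> snd (snd r)))"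
      by (intro smooth_map_Pair smooth_arrs_mult[OF R] 1 2)
    fix r assume "r \<in> topspace (mtop ?R)"
    then have "fst r \<in> composable_pairs" "snd r \<in> composable_pairs"
      unfolding mtop_product topspace_prod_topology topspace_MP
      by (simp_all only: mem_Times_iff)
    then show "(fst (fst r) \<otimes>\<^bsub>arrs\<^esub> fst (snd r), snd (fst r) \<otimes>\<^bsub>arrs\<^esub> snd (snd r))
        \<in> pair_embedding ` topspace (mtop MQ)"
      unfolding pair_embedding_image by (intro composable_pairs_mult) (simp_all only: prod.collapse)
  qed
  moreover have "(\<lambda>(x, y). x \<otimes>\<^bsub>pairs\<^esub> y) =
      (\<lambda>r. (fst (fst r) \<otimes>\<^bsub>arrs\<^esub> fst (snd r), snd (fst r) \<otimes>\<^bsub>arrs\<^esub> snd (snd r)))"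
    by (simp add: fun_eq_iff pairs_def DirProd_def)
  ultimately show "smooth_map (product_manifold (mfd pairs) (mfd pairs)) (mfd pairs) (\<lambda>(x, y). x \<otimes>\<^bsub>pairs\<^esub> y)"
    by (simp only: pairs_simps)
  note 3 = smooth_pair_components[OF MP_manifold smooth_map_ident[OF MP_manifold]]
  have "smooth_map MP MP (\<lambda>p. (inv\<^bsub>arrs\<^esub> (fst p), inv\<^bsub>arrs\<^esub> (snd p)))"
  proof (rule composable.smooth_map_into_image[OF MP_manifold])
    show "smooth_map MP (product_manifold MA MA) (\<lambda>p. (inv\<^bsub>arrs\<^esub> (fst p), inv\<^bsub>arrs\<^esub> (snd p)))"
      by (intro smooth_map_Pair smooth_arrs_inv[OF MP_manifold] 3)
    fix p assume "p \<in> topspace (mtop MP)"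
    then show "(inv\<^bsub>arrs\<^esub> (fst p), inv\<^bsub>arrs\<^esub> (snd p)) \<in> pair_embedding ` topspace (mtop MQ)"
      unfolding topspace_MP pair_embedding_image
      by (intro composable_pairs_inv) (simp only: prod.collapse)
  qed
  then have "smooth_map MP MP (\<lambda>p. inv\<^bsub>pairs\<^esub> p)"
  proof (rule smooth_map_cong[OF MP_manifold])
    fix p assume "p \<in> topspace (mtop MP)"
    then have "(fst p, snd p) \<in> composable_pairs"
      unfolding topspace_MP by (simp only: prod.collapse)
    then show "inv\<^bsub>pairs\<^esub> p = (inv\<^bsub>arrs\<^esub> (fst p), inv\<^bsub>arrs\<^esub> (snd p))"
      using inv_pairs by fastforce
  qed
  then show "smooth_map (mfd pairs) (mfd pairs) (\<lambda>x. inv\<^bsub>pairs\<^esub> x)" by (simp only: pairs_simps)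
qed (simp_all only: pairs_simps MP_manifold topspace_MP)

text \<open>The formula for \<open>vertical\<close> is smooth for arbitrary pairs of arrows and is
  restricted along the smooth inclusion of \<open>MP\<close>.\<close>

lemma smooth_vertical_pairs: "smooth_map MP MA (\<lambda>(g, f). vertical g f)"
  unfolding case_prod_unfold
  by (intro smooth_vertical[OF MP_manifold] smooth_pair_components[OF MP_manifold smooth_map_ident[OF MP_manifold]])

lemma vertical_hom: "(\<lambda>(g, f). vertical g f) \<in> hom pairs arrs"
proof (rule homI)
  fix p assume "p \<in> carrier pairs"
  then show "(case p of (g, f) \<Rightarrow> vertical g f) \<in> carrier arrs"
    by (auto simp: composable_pairs_def)
next
  fix p q assume "p \<in> carrier pairs" "q \<in> carrier pairs"
  then show "(case p \<otimes>\<^bsub>pairs\<^esub> q of (g, f) \<Rightarrow> vertical g f) =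
      (case p of (g, f) \<Rightarrow> vertical g f) \<otimes>\<^bsub>arrs\<^esub> (case q of (g, f) \<Rightarrow> vertical g f)"
    using vertical_interchange
    by (cases p, cases q) (simp del: arrs_simps structure_simps add: composable_pairs_def)
qed

section \<open>The Lie groupoid and the assembled 2-group\<close>

lemma lie_groupoid: "lie_groupoid MA MO source target unit_arrow vertical"
proof (rule lie_groupoid.intro)
  show "source ` topspace (mtop MA) = topspace (mtop MO)"
  proof (rule subset_antisym)
    show "topspace (mtop MO) \<subseteq> source ` topspace (mtop MA)"
    proof
      fix p assume "p \<in> topspace (mtop MO)"
      then show "p \<in> source ` topspace (mtop MA)"
        by (intro image_eqI[of _ _ "unit_arrow p"]) auto
    qed
  qed auto
  show "target ` topspace (mtop MA) = topspace (mtop MO)"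
  proof (rule subset_antisym)
    show "topspace (mtop MO) \<subseteq> target ` topspace (mtop MA)"
    proof
      fix p assume "p \<in> topspace (mtop MO)"
      then show "p \<in> target ` topspace (mtop MA)"
        by (intro image_eqI[of _ _ "unit_arrow p"]) auto
    qed
  qed auto
  show "\<exists>P. composable_manifold MA source target P \<and> smooth_map P MA (\<lambda>(g, f). vertical g f)"
    using composable_manifold_MP smooth_vertical_pairs by blast
  show "\<exists>j. smooth_map MA MA j \<and> (\<forall>f\<in>topspace (mtop MA). source (j f) = target f \<and>
      target (j f) = source f \<and> vertical (j f) f = unit_arrow (source f) \<and>
      vertical f (j f) = unit_arrow (target f))"
  proof (intro exI conjI ballI)
    \<comment> \<open>The vertical inverse of \<open>(x, a, \<xi>, m)\<close> starts at its target
      and carries the inverse of \<open>a\<close> and \<open>- m\<close>.\<close>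
    show "smooth_map MA MA (\<lambda>f. (t (fst (snd f)) \<otimes>\<^bsub>H0\<^esub> fst f, inv\<^bsub>H1\<^esub> (fst (snd f)),
        fst (snd (snd f)) + d (snd (snd (snd f))), - snd (snd (snd f))))"
      by (intro smooth_ops arrow_components MA_manifold)
  qed (auto simp: t_inv H0_cancel blin)
qed (auto simp: submersion_source submersion_target smooth_unit_arrow t_mult H0.m_assoc H1.m_assoc blin add.assoc)

definition two_group :: "('h0 \<times> 'h1 \<times> 'v0 \<times> 'v1, 'e0 \<times> 'e1 \<times> 'v0 \<times> 'v1, 'h0 \<times> 'v0, 'e0 \<times> 'v0) lie_2grp" where
  "two_group = \<lparr>arrows = arrs, objects = objs, src = source, tgt = target, ident = unit_arrow, vcomp = vertical\<rparr>"

lemma two_group_simps [simp]: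
  "arrows two_group = arrs" "objects two_group = objs" "src two_group = source" "tgt two_group = target"
  "ident two_group = unit_arrow" "vcomp two_group = vertical"
  by (simp_all add: two_group_def)

lemma strict_lie_2group: "strict_lie_2group two_group"
proof (rule strict_lie_2group.intro; unfold two_group_simps)
  show "lie_groupoid (mfd arrs) (mfd objs) source target unit_arrow vertical"
    using lie_groupoid by (simp only: arrs_simps objs_simps)
  show "lie_group arrs" "lie_group objs" by (rule lie_group_arrs lie_group_objs)+
  show "lie_morphism arrs objs source" "lie_morphism arrs objs target" "lie_morphism objs arrs unit_arrow"
    unfolding lie_morphism_def arrs_simps objs_simps
    by (intro conjI source_hom target_hom unit_arrow_hom smooth_source smooth_target smooth_unit_arrow)+
  show "\<exists>P. lie_group P \<and> composable_manifold (mfd arrs) source target (mfd P) \<and>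
      mult P = mult (arrs \<times>\<times> arrs) \<and> one P = one (arrs \<times>\<times> arrs) \<and>
      lie_morphism P arrs (\<lambda>(g, f). vertical g f)"
  \<comment> \<open>The manifold \<open>MP\<close> that already witnesses smooth composition in the
    groupoid also carries the group structure.\<close>
  proof (intro exI[of _ pairs] conjI lie_group_pairs)
    show "composable_manifold (mfd arrs) source target (mfd pairs)"
      using composable_manifold_MP by (simp only: arrs_simps pairs_simps)
    show "lie_morphism pairs arrs (\<lambda>(g, f). vertical g f)"
      unfolding lie_morphism_def using vertical_hom smooth_vertical_pairs by (simp only: arrs_simps pairs_simps simp_thms)
  qed (simp_all only: pairs_def monoid.simps lie_grp.simps partial_object.simps)
qed

end

theorem theorem3p5:
  fixes H :: "('h1, 'e1::real_normed_vector, 'h0, 'e0::real_normed_vector) lie_xmod"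
    and d :: "'v1::real_normed_vector \<Rightarrow>\<^sub>L 'v0::real_normed_vector"
    and \<Psi>1 :: "'h1 \<Rightarrow> 'v0 \<Rightarrow>\<^sub>L 'v1"
    and \<Psi>0 :: "'h0 \<Rightarrow> ('v0 \<Rightarrow>\<^sub>L 'v0) \<times> ('v1 \<Rightarrow>\<^sub>L 'v1)"
  defines "H0 \<equiv> X0 H" and "H1 \<equiv> X1 H" and "t \<equiv> bd H" and "\<Phi> \<equiv> act H"
  assumes fin0: "finite_dimensional (UNIV :: 'v0 set)"
    and fin1: "finite_dimensional (UNIV :: 'v1 set)"
    and H: "lie_crossed_module H"
    and \<Psi>: "strict_xmod_morphism H (aut_xmod d) \<Psi>1 \<Psi>0"
  shows "\<exists>L :: ('h0 \<times> 'h1 \<times> 'v0 \<times> 'v1, 'e0 \<times> 'e1 \<times> 'v0 \<times> 'v1, 'h0 \<times> 'v0, 'e0 \<times> 'v0) lie_2grp.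
    strict_lie_2group L \<and>
    mfd (objects L) = product_manifold (mfd H0) vector_manifold \<and>
    mfd (arrows L) =
      product_manifold (mfd H0)
        (product_manifold (mfd H1) (product_manifold vector_manifold vector_manifold)) \<and>
    (\<forall>x\<in>carrier H0. \<forall>a\<in>carrier H1. \<forall>\<xi> m.
      src L (x, a, \<xi>, m) = (x, \<xi>) \<and>
      tgt L (x, a, \<xi>, m) = (t a \<otimes>\<^bsub>H0\<^esub> x, \<xi> + d m)) \<and>
    (\<forall>x\<in>carrier H0. \<forall>y\<in>carrier H0. \<forall>a\<in>carrier H1. \<forall>b\<in>carrier H1. \<forall>\<xi> \<eta> m n.
      y = t a \<otimes>\<^bsub>H0\<^esub> x \<and> \<eta> = \<xi> + d m \<longrightarrow>
      vcomp L (y, b, \<eta>, n) (x, a, \<xi>, m) = (x, b \<otimes>\<^bsub>H1\<^esub> a, \<xi>, m + n)) \<and>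
    (\<forall>x\<in>carrier H0. \<forall>y\<in>carrier H0. \<forall>a\<in>carrier H1. \<forall>b\<in>carrier H1. \<forall>\<xi> \<eta> m n.
      (x, a, \<xi>, m) \<otimes>\<^bsub>arrows L\<^esub> (y, b, \<eta>, n) =
        (x \<otimes>\<^bsub>H0\<^esub> y, a \<otimes>\<^bsub>H1\<^esub> \<Phi> x b, \<xi> + fst (\<Psi>0 x) \<eta>,
         m + snd (\<Psi>0 (t a \<otimes>\<^bsub>H0\<^esub> x)) n + \<Psi>1 a (fst (\<Psi>0 x) \<eta>))) \<and>
    (\<forall>x\<in>carrier H0. \<forall>y\<in>carrier H0. \<forall>\<xi> \<eta>.
      (x, \<xi>) \<otimes>\<^bsub>objects L\<^esub> (y, \<eta>) = (x \<otimes>\<^bsub>H0\<^esub> y, \<xi> + fst (\<Psi>0 x) \<eta>)) \<and>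
    \<one>\<^bsub>arrows L\<^esub> = (\<one>\<^bsub>H0\<^esub>, \<one>\<^bsub>H1\<^esub>, 0, 0) \<and>
    \<one>\<^bsub>objects L\<^esub> = (\<one>\<^bsub>H0\<^esub>, 0) \<and>
    (\<forall>x\<in>carrier H0. \<forall>a\<in>carrier H1. \<forall>\<xi> m.
      inv\<^bsub>arrows L\<^esub> (x, a, \<xi>, m) =
        (inv\<^bsub>H0\<^esub> x, \<Phi> (inv\<^bsub>H0\<^esub> x) (inv\<^bsub>H1\<^esub> a), - fst (\<Psi>0 (inv\<^bsub>H0\<^esub> x)) \<xi>,
         - snd (\<Psi>0 (inv\<^bsub>H0\<^esub> (t a \<otimes>\<^bsub>H0\<^esub> x))) m
         + snd (\<Psi>0 (inv\<^bsub>H0\<^esub> (t a \<otimes>\<^bsub>H0\<^esub> x))) (\<Psi>1 a \<xi>)))"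
proof -
  interpret represented_crossed_module H d \<Psi>1 \<Psi>0
    by (rule represented_crossed_module.intro[OF fin0 fin1 H \<Psi>])
  show ?thesis
    unfolding H0_def H1_def t_def \<Phi>_def
    by (rule exI[of _ two_group]) (simp add: strict_lie_2group inv_arrs)
qed

end
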